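(* Let $R$ be a $(2^{\aleph_0})^+$-saturated o-minimal expansion of an ordered field and let $\mathbb{R}_{\mathrm{ind}}$ be the structure on $\mathbb{R}$ induced from $R$ by the standard part map (see context). Then for every $n\in\mathbb{N}$, the subsets of $\mathbb{R}^n$ that are definable (with parameters) in $\mathbb{R}_{\mathrm{ind}}$ are exactly the finite unions of differences $\operatorname{st}(X)\setminus \operatorname{st}(Y)$ with $X,Y\subseteq R^n$ definable in $R$.
   Context: $R$ is a $(2^{\aleph_0})^+$-saturated o-minimal expansion of an ordered field (necessarily real closed). "Definable" means definable with parameters in $R$, unless another structure is specified (then: with parameters in that structure). $\mathcal{O}=\{a\in R: |a|\le k\text{ for some }k\in\mathbb{N}\}$ is the convex hull of $\mathbb{Q}$ in $R$, a valuation ring with maximal ideal $\mathfrak{m}=\{a\in R: |a|\le 1/k\text{ for all integers }k>0\}$. The standard part map $\operatorname{st}:\mathcal{O}\to\mathbb{R}$ is the ordered ring homomorphism with kernel $\mathfrak{m}$ (so $\operatorname{st}(a)$ is the unique real infinitely close to $a$); it induces coordinatewise $\operatorname{st}:\mathcal{O}^n\to\mathbb{R}^n$. For $X\subseteq R^n$ put $\operatorname{st}(X):=\operatorname{st}(X\cap\mathcal{O}^n)$. $\mathbb{R}_{\mathrm{ind}}$ is the structure with underlying set $\mathbb{R}$ whose basic relations are all sets $\operatorname{st}(X)$ with $X\subseteq R^n$ definable in $R$, $n=0,1,2,\dots$. *)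

theory Defs
  imports Complex_Main "HOL-Library.FuncSet"
begin

unbundle cardinal_syntax

section \<open>First-order logic\<close>

datatype 'f trm = Var nat | Fun 'f "'f trm list"

datatype ('f, 'r) form =
    Eq "'f trm" "'f trm"
  | Rel 'r "'f trm list"
  | Neg "('f, 'r) form"
  | Conj "('f, 'r) form" "('f, 'r) form"
  | Ex nat "('f, 'r) form"

text \<open>
  The universe of a structure is the whole type \<open>'a\<close>. The language consists of the symbols in
  \<open>fun_syms\<close> (constants are those of arity 0) and \<open>rel_syms\<close>; the values of the
  other four fields matter only on these symbols and on argument lists of the right length.
\<close>

record ('f, 'r, 'a) struct =
  fun_syms :: "'f set"
  fun_arity :: "'f \<Rightarrow> nat"
  fun_int :: "'f \<Rightarrow> 'a list \<Rightarrow> 'a"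
  rel_syms :: "'r set"
  rel_arity :: "'r \<Rightarrow> nat"
  rel_int :: "'r \<Rightarrow> 'a list \<Rightarrow> bool"

primrec trm_of :: "('f, 'r, 'a) struct \<Rightarrow> 'f trm \<Rightarrow> bool" where
  "trm_of M (Var i) \<longleftrightarrow> True"
| "trm_of M (Fun f ts) \<longleftrightarrow>
     f \<in> fun_syms M \<and> length ts = fun_arity M f \<and> list_all (trm_of M) ts"

primrec form_of :: "('f, 'r, 'a) struct \<Rightarrow> ('f, 'r) form \<Rightarrow> bool" where
  "form_of M (Eq s t) \<longleftrightarrow> trm_of M s \<and> trm_of M t"
| "form_of M (Rel r ts) \<longleftrightarrow>
     r \<in> rel_syms M \<and> length ts = rel_arity M r \<and> list_all (trm_of M) ts"
| "form_of M (Neg p) \<longleftrightarrow> form_of M p"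
| "form_of M (Conj p q) \<longleftrightarrow> form_of M p \<and> form_of M q"
| "form_of M (Ex i p) \<longleftrightarrow> form_of M p"

primrec trm_vars :: "'f trm \<Rightarrow> nat set" where
  "trm_vars (Var i) = {i}"
| "trm_vars (Fun f ts) = \<Union> (set (map trm_vars ts))"

primrec free_vars :: "('f, 'r) form \<Rightarrow> nat set" where
  "free_vars (Eq s t) = trm_vars s \<union> trm_vars t"
| "free_vars (Rel r ts) = \<Union> (set (map trm_vars ts))"
| "free_vars (Neg p) = free_vars p"
| "free_vars (Conj p q) = free_vars p \<union> free_vars q"
| "free_vars (Ex i p) = free_vars p - {i}"

primrec trm_val :: "('f, 'r, 'a) struct \<Rightarrow> (nat \<Rightarrow> 'a) \<Rightarrow> 'f trm \<Rightarrow> 'a" where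
  "trm_val M e (Var i) = e i"
| "trm_val M e (Fun f ts) = fun_int M f (map (trm_val M e) ts)"

primrec sat :: "('f, 'r, 'a) struct \<Rightarrow> (nat \<Rightarrow> 'a) \<Rightarrow> ('f, 'r) form \<Rightarrow> bool" where
  "sat M e (Eq s t) \<longleftrightarrow> trm_val M e s = trm_val M e t"
| "sat M e (Rel r ts) \<longleftrightarrow> rel_int M r (map (trm_val M e) ts)"
| "sat M e (Neg p) \<longleftrightarrow> \<not> sat M e p"
| "sat M e (Conj p q) \<longleftrightarrow> sat M e p \<and> sat M e q"
| "sat M e (Ex i p) \<longleftrightarrow> (\<exists>a. sat M (e(i := a)) p)"

text \<open>
  Definability with parameters. Points of the \<open>n\<close>-th cartesian power of the universe are lists of
  length \<open>n\<close>. The variables \<open>0, \<dots>, n - 1\<close> are the coordinates, and \<open>e\<close> supplies the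
  parameters for the remaining free variables.
\<close>

definition definable :: "('f, 'r, 'a) struct \<Rightarrow> nat \<Rightarrow> 'a list set \<Rightarrow> bool" where
  "definable M n S \<longleftrightarrow>
     (\<exists>p e. form_of M p \<and>
        S = {xs. length xs = n \<and> sat M (\<lambda>i. if i < n then xs ! i else e i) p})"

text \<open>
  \<open>\<kappa>\<close>-saturation. A formula over the parameter set \<open>A\<close> in the single variable \<open>0\<close> is a pair
  \<open>(p, e)\<close> in which \<open>e\<close> sends the other free variables of \<open>p\<close> into \<open>A\<close>.
\<close>

definition form_over :: "('f, 'r, 'a) struct \<Rightarrow> 'a set \<Rightarrow> ('f, 'r) form \<times> (nat \<Rightarrow> 'a) \<Rightarrow> bool" where
  "form_over M A = (\<lambda>(p, e). form_of M p \<and> e ` (free_vars p - {0}) \<subseteq> A)"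

definition realizes ::
    "('f, 'r, 'a) struct \<Rightarrow> 'a \<Rightarrow> (('f, 'r) form \<times> (nat \<Rightarrow> 'a)) set \<Rightarrow> bool" where
  "realizes M a T \<longleftrightarrow> (\<forall>(p, e) \<in> T. sat M (e(0 := a)) p)"

definition saturated :: "'k rel \<Rightarrow> ('f, 'r, 'a) struct \<Rightarrow> bool" where
  "saturated \<kappa> M \<longleftrightarrow>
     (\<forall>A T. |A| <o \<kappa> \<and> (\<forall>\<phi> \<in> T. form_over M A \<phi>) \<and>
        (\<forall>T0. finite T0 \<and> T0 \<subseteq> T \<longrightarrow> (\<exists>a. realizes M a T0)) \<longrightarrow>
        (\<exists>a. realizes M a T))"


section \<open>O-minimal expansions of ordered fields\<close>

definition names_fun :: "('f, 'r, 'a) struct \<Rightarrow> nat \<Rightarrow> ('a list \<Rightarrow> 'a) \<Rightarrow> bool" where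
  "names_fun M n F \<longleftrightarrow>
     (\<exists>f \<in> fun_syms M. fun_arity M f = n \<and> (\<forall>xs. length xs = n \<longrightarrow> fun_int M f xs = F xs))"

definition names_rel :: "('f, 'r, 'a) struct \<Rightarrow> nat \<Rightarrow> ('a list \<Rightarrow> bool) \<Rightarrow> bool" where
  "names_rel M n P \<longleftrightarrow>
     (\<exists>r \<in> rel_syms M. rel_arity M r = n \<and> (\<forall>xs. length xs = n \<longrightarrow> rel_int M r xs = P xs))"

text \<open>
  The ordered field is the one carried by the type \<open>'a\<close>, in the language of ordered rings
  \<open>0, 1, -, +, *, <\<close>.
\<close>

definition expands_ordered_field :: "('f, 'r, 'a :: linordered_field) struct \<Rightarrow> bool" where
  "expands_ordered_field M \<longleftrightarrow>
     names_fun M 0 (\<lambda>xs. 0) \<and>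
     names_fun M 0 (\<lambda>xs. 1) \<and>
     names_fun M 1 (\<lambda>xs. - (xs ! 0)) \<and>
     names_fun M 2 (\<lambda>xs. xs ! 0 + xs ! 1) \<and>
     names_fun M 2 (\<lambda>xs. xs ! 0 * xs ! 1) \<and>
     names_rel M 2 (\<lambda>xs. xs ! 0 < xs ! 1)"

definition point_or_open_interval :: "'a :: linorder set \<Rightarrow> bool" where
  "point_or_open_interval I \<longleftrightarrow>
     (\<exists>a. I = {a}) \<or> (\<exists>a b. I = {a<..<b}) \<or> (\<exists>a. I = {a<..}) \<or> (\<exists>b. I = {..<b}) \<or> I = UNIV"

definition o_minimal :: "('f, 'r, 'a :: linorder) struct \<Rightarrow> bool" where
  "o_minimal M \<longleftrightarrow>
     (\<forall>S. definable M 1 S \<longrightarrow>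
        (\<exists>F. finite F \<and> (\<forall>I \<in> F. point_or_open_interval I) \<and> {a. [a] \<in> S} = \<Union> F))"


section \<open>The standard part map and the induced structure on the reals\<close>

definition finite_elems :: "'a :: linordered_field set" where
  "finite_elems = {a. \<exists>k::nat. \<bar>a\<bar> \<le> of_nat k}"

definition infinitesimals :: "'a :: linordered_field set" where
  "infinitesimals = {a. \<forall>k::nat. k > 0 \<longrightarrow> \<bar>a\<bar> \<le> 1 / of_nat k}"

definition is_standard_part :: "('a :: linordered_field \<Rightarrow> real) \<Rightarrow> bool" where
  "is_standard_part h \<longleftrightarrow>
     h \<in> extensional finite_elems \<and>
     h 1 = 1 \<and>
     (\<forall>a \<in> finite_elems. \<forall>b \<in> finite_elems. h (a + b) = h a + h b) \<and>
     (\<forall>a \<in> finite_elems. \<forall>b \<in> finite_elems. h (a * b) = h a * h b) \<and>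
     (\<forall>a \<in> finite_elems. \<forall>b \<in> finite_elems. a \<le> b \<longrightarrow> h a \<le> h b) \<and>
     {a \<in> finite_elems. h a = 0} = infinitesimals"

text \<open>Existence and uniqueness are proved below, in \<open>is_standard_part_st\<close> and
  \<open>is_standard_part_unique\<close>.\<close>

definition st :: "'a :: linordered_field \<Rightarrow> real" where
  "st = (THE h. is_standard_part h)"

definition st_set :: "'a :: linordered_field list set \<Rightarrow> real list set" where
  "st_set X = map st ` (X \<inter> lists finite_elems)"

text \<open>
  There are no function symbols. The relation symbols are the basic relations themselves, each
  tagged with its arity.
\<close>

definition R_ind ::
    "('f, 'r, 'a :: linordered_field) struct \<Rightarrow> (unit, nat \<times> real list set, real) struct" where
  "R_ind M =
     \<lparr>fun_syms = {}, fun_arity = (\<lambda>_. 0), fun_int = (\<lambda>_ _. 0),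
      rel_syms = {(n, st_set X) | n X. definable M n X},
      rel_arity = fst, rel_int = (\<lambda>r xs. xs \<in> snd r)\<rparr>"


subsection \<open>Existence and uniqueness of the standard part map\<close>

lemma finite_elems_of_rat: "of_rat q \<in> (finite_elems :: 'a :: linordered_field set)"
proof -
  obtain k :: nat where "\<bar>q\<bar> \<le> of_nat k"
    using real_arch_simple by blast
  then have "of_rat \<bar>q\<bar> \<le> (of_rat (of_nat k) :: 'a)"
    by (simp only: of_rat_less_eq)
  then show ?thesis
    by (auto simp: finite_elems_def abs_of_rat)
qed

lemma finite_elems_add:
  assumes "a \<in> finite_elems" "b \<in> finite_elems"
  shows "a + b \<in> (finite_elems :: 'a :: linordered_field set)"
proof -
  from assms obtain k l :: nat where "\<bar>a\<bar> \<le> of_nat k" "\<bar>b\<bar> \<le> of_nat l"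
    by (auto simp: finite_elems_def)
  then have "\<bar>a + b\<bar> \<le> of_nat (k + l)"
    using abs_triangle_ineq[of a b] unfolding of_nat_add by linarith
  then show ?thesis unfolding finite_elems_def by blast
qed

lemma finite_elems_mult:
  assumes "a \<in> finite_elems" "b \<in> finite_elems"
  shows "a * b \<in> (finite_elems :: 'a :: linordered_field set)"
proof -
  from assms obtain k l :: nat where "\<bar>a\<bar> \<le> of_nat k" "\<bar>b\<bar> \<le> of_nat l"
    by (auto simp: finite_elems_def)
  then have "\<bar>a * b\<bar> \<le> of_nat (k * l)"
    by (auto simp: abs_mult intro: mult_mono)
  then show ?thesis unfolding finite_elems_def by blast
qed

lemma finite_elems_uminus:
  "a \<in> finite_elems \<Longrightarrow> - a \<in> (finite_elems :: 'a :: linordered_field set)"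
  by (simp add: finite_elems_def)

lemma rat_ring_hom_unique:
  fixes f :: "rat \<Rightarrow> real"
  assumes one: "f 1 = 1" and add: "\<And>p q. f (p + q) = f p + f q"
    and mult: "\<And>p q. f (p * q) = f p * f q"
  shows "f q = of_rat q"
proof -
  have zero: "f 0 = 0" using add[of 0 0] by simp
  have neg: "f (- p) = - f p" for p using add[of p "- p"] zero by simp
  have nat: "f (of_nat n) = of_nat n" for n
    by (induction n) (simp_all add: zero add one)
  have int: "f (of_int i) = of_int i" for i
    by (cases i rule: int_cases2) (simp_all add: nat neg)
  obtain a b where q: "q = Fract a b" and "b > 0" by (cases q) auto
  then have "q * of_int b = of_int a" by (simp add: Fract_of_int_quotient)
  then have "f q * f (of_int b) = f (of_int a)" using mult[of q "of_int b"] by simp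
  then have "f q * of_int b = of_int a" by (simp only: int)
  then show ?thesis
    using \<open>b > 0\<close> by (simp add: q of_rat_rat field_simps)
qed

lemma is_standard_part_of_rat:
  fixes h :: "'a :: linordered_field \<Rightarrow> real"
  assumes "is_standard_part h"
  shows "h (of_rat q) = of_rat q"
  using assms finite_elems_of_rat[where ?'a = 'a]
  by (intro rat_ring_hom_unique) (auto simp: is_standard_part_def of_rat_add of_rat_mult)

lemma real_eq_by_rat:
  fixes r s :: real
  assumes "\<And>q. of_rat q < r \<Longrightarrow> of_rat q \<le> s" "\<And>q. r < of_rat q \<Longrightarrow> s \<le> of_rat q"
  shows "r = s"
proof (rule ccontr)
  assume "r \<noteq> s"
  then consider "r < s" | "s < r" by linarith
  then show False
  proof cases
    case 1
    then obtain q where "r < of_rat q" "of_rat q < s" using of_rat_dense by blast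
    with assms(2)[of q] show False by simp
  next
    case 2
    then obtain q where "s < of_rat q" "of_rat q < r" using of_rat_dense by blast
    with assms(1)[of q] show False by simp
  qed
qed

lemma is_standard_part_unique:
  fixes h g :: "'a :: linordered_field \<Rightarrow> real"
  assumes h: "is_standard_part h" and g: "is_standard_part g"
  shows "h = g"
proof (rule extensionalityI[of _ finite_elems])
  show "h \<in> extensional finite_elems" "g \<in> extensional finite_elems"
    using h g by (auto simp: is_standard_part_def)
  fix a :: 'a assume a: "a \<in> finite_elems"
  have mono: "k b \<le> k c" if "is_standard_part k" "b \<in> finite_elems" "c \<in> finite_elems" "b \<le> c"
    for k :: "'a \<Rightarrow> real" and b c using that by (auto simp: is_standard_part_def)
  have lo: "k (of_rat q) \<le> k a" if "is_standard_part k" "of_rat q \<le> a" for k :: "'a \<Rightarrow> real" and q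
    by (rule mono) (auto simp: that a finite_elems_of_rat)
  have up: "k a \<le> k (of_rat q)" if "is_standard_part k" "a \<le> of_rat q" for k :: "'a \<Rightarrow> real" and q
    by (rule mono) (auto simp: that a finite_elems_of_rat)
  show "h a = g a"
  proof (rule real_eq_by_rat)
    fix q :: rat
    show "of_rat q \<le> g a" if "of_rat q < h a"
      using that lo[OF g, of q] up[OF h, of q] h g
      by (cases "of_rat q \<le> a") (auto simp: is_standard_part_of_rat)
    show "g a \<le> of_rat q" if "h a < of_rat q"
      using that lo[OF h, of q] up[OF g, of q] h g
      by (cases "of_rat q \<le> a") (auto simp: is_standard_part_of_rat)
  qed
qed

lemma is_standard_part_exists: "\<exists>h :: 'a :: linordered_field \<Rightarrow> real. is_standard_part h"
proof -
  define h where "h = restrict (\<lambda>a::'a. Sup {real_of_rat q | q. of_rat q \<le> a}) finite_elems"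
  have key: "(of_rat q \<le> a \<longrightarrow> of_rat q \<le> h a) \<and> (a \<le> of_rat q \<longrightarrow> h a \<le> of_rat q)"
    if a: "a \<in> finite_elems" for a :: 'a and q
  proof -
    from a obtain k :: nat where k: "\<bar>a\<bar> \<le> of_nat k" by (auto simp: finite_elems_def)
    have bd: "real_of_rat p \<le> real_of_rat s" if "of_rat p \<le> a" "a \<le> of_rat s" for p s
      using order_trans[OF that] by (simp add: of_rat_less_eq)
    have k1: "a \<le> of_rat (of_nat k)" and k2: "of_rat (- of_nat k) \<le> a"
      using k by (auto simp: of_rat_minus abs_le_iff)
    have "bdd_above {real_of_rat q | q. of_rat q \<le> a}"
      by (rule bdd_aboveI[of _ "of_rat (of_nat k)"]) (use bd k1 in blast)
    moreover have "{real_of_rat q | q. of_rat q \<le> a} \<noteq> {}"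
      using k2 by blast
    ultimately show ?thesis
      using a bd unfolding h_def by (auto intro!: cSup_upper cSup_least)
  qed
  have lo: "of_rat q \<le> h a" if "of_rat q \<le> a" "a \<in> finite_elems" for a q
    using key that by blast
  have up: "h a \<le> of_rat q" if "a \<le> of_rat q" "a \<in> finite_elems" for a q
    using key that by blast
  have lo': "of_rat q < a" if "of_rat q < h a" "a \<in> finite_elems" for a q
    using up[of a q] that by (meson not_le)
  have up': "a < of_rat q" if "h a < of_rat q" "a \<in> finite_elems" for a q
    using lo[of q a] that by (meson not_le)
  have hrat: "h (of_rat q) = of_rat q" for q
    by (intro antisym lo up) (auto simp: finite_elems_of_rat)
  have mono: "h a \<le> h b" if "a \<le> b" "a \<in> finite_elems" "b \<in> finite_elems" for a b
  proof (rule ccontr)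
    assume "\<not> h a \<le> h b"
    then obtain q where "h b < of_rat q" "of_rat q < h a" using of_rat_dense[of "h b" "h a"] by auto
    then show False using up'[of b q] lo'[of q a] that by (meson less_trans not_le)
  qed
  have add: "h (a + b) = h a + h b" if a: "a \<in> finite_elems" and b: "b \<in> finite_elems" for a b
  proof (rule real_eq_by_rat[symmetric])
    fix q
    {
      assume "of_rat q < h a + h b"
      then obtain p where p: "of_rat q - h b < of_rat p" "of_rat p < h a"
        using of_rat_dense[of "of_rat q - h b" "h a"] by auto
      then have "of_rat (q - p) < h b" by (simp add: of_rat_diff)
      then have "of_rat p < a" "of_rat (q - p) < b" using p a b lo' by blast+
      then have "of_rat p + of_rat (q - p) \<le> a + b" by (intro add_mono) auto
      then show "of_rat q \<le> h (a + b)"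
        using a b by (intro lo) (auto simp: finite_elems_add of_rat_diff)
    next
      assume "h a + h b < of_rat q"
      then obtain p where p: "h a < of_rat p" "of_rat p < of_rat q - h b"
        using of_rat_dense[of "h a" "of_rat q - h b"] by auto
      then have "h b < of_rat (q - p)" by (simp add: of_rat_diff)
      then have "a < of_rat p" "b < of_rat (q - p)" using p a b up' by blast+
      then have "a + b \<le> of_rat p + of_rat (q - p)" by (intro add_mono) auto
      then show "h (a + b) \<le> of_rat q"
        using a b by (intro up) (auto simp: finite_elems_add of_rat_diff)
    }
  qed
  have zero: "h 0 = 0" and one: "h 1 = 1" using hrat[of 0] hrat[of 1] by simp_all
  have neg: "h (- a) = - h a" if "a \<in> finite_elems" for a
    using add[of a "- a"] that zero by (simp add: finite_elems_uminus)
  have sq_pos: "h (a * a) = h a * h a" if a: "a \<in> finite_elems" and "a \<ge> 0" for a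
  proof (rule real_eq_by_rat[symmetric])
    have aa: "a * a \<in> finite_elems" using a by (simp add: finite_elems_mult)
    have ha: "h a \<ge> 0" using lo[of 0 a] a \<open>a \<ge> 0\<close> by simp
    fix q
    {
      assume q: "of_rat q < h a * h a"
      show "of_rat q \<le> h (a * a)"
      proof (cases "q \<le> 0")
        case True
        then have "(of_rat q :: 'a) \<le> 0" by simp
        then have "of_rat q \<le> a * a" using \<open>a \<ge> 0\<close> by (meson mult_nonneg_nonneg order_trans)
        with aa show ?thesis by (rule lo[rotated])
      next
        case False
        have "sqrt (of_rat q) < h a"
          using real_sqrt_less_mono[OF q] ha by simp
        then obtain p where p: "sqrt (of_rat q) < of_rat p" "of_rat p < h a"
          using of_rat_dense by blast
        have "0 \<le> sqrt (real_of_rat q)" using False by simp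
        with p(1) have "0 < real_of_rat p" by (rule le_less_trans[rotated])
        then have p0: "p > 0" by simp
        have "real_of_rat q = sqrt (of_rat q) * sqrt (of_rat q)" using False by simp
        also have "\<dots> \<le> of_rat p * of_rat p" using p False p0 by (intro mult_mono) auto
        finally have "real_of_rat q \<le> of_rat (p * p)" by (simp add: of_rat_mult)
        moreover have "of_rat p * of_rat p \<le> a * a"
          using lo'[OF p(2) a] p0 \<open>a \<ge> 0\<close> by (intro mult_mono) auto
        then have "of_rat (p * p) \<le> h (a * a)" using aa by (intro lo) (auto simp: of_rat_mult)
        ultimately show ?thesis by simp
      qed
    next
      assume q: "h a * h a < of_rat q"
      have q0: "real_of_rat q \<ge> 0" using q by (meson less_imp_le order_trans zero_le_square)
      have "h a < sqrt (of_rat q)"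
        using real_sqrt_less_mono[OF q] ha by simp
      then obtain p where p: "h a < of_rat p" "of_rat p < sqrt (of_rat q)"
        using of_rat_dense by blast
      have p0: "real_of_rat p \<ge> 0" using p(1) ha by linarith
      then have p0': "p \<ge> 0" by simp
      have "real_of_rat (p * p) \<le> sqrt (of_rat q) * sqrt (of_rat q)"
        unfolding of_rat_mult using p p0 q0 by (intro mult_mono real_sqrt_ge_zero) linarith+
      then have "real_of_rat (p * p) \<le> of_rat q" using q0 by simp
      moreover have "a * a \<le> of_rat p * of_rat p"
        using up'[OF p(1) a] \<open>a \<ge> 0\<close> p0' by (intro mult_mono) auto
      then have "h (a * a) \<le> of_rat (p * p)" using aa by (intro up) (auto simp: of_rat_mult)
      ultimately show "h (a * a) \<le> of_rat q" by simp
    }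
  qed
  have sq: "h (a * a) = h a * h a" if a: "a \<in> finite_elems" for a
    using sq_pos[of a] sq_pos[of "- a"] neg[of a] a
    by (cases "a \<ge> 0") (auto simp: finite_elems_uminus)
  have mult: "h (a * b) = h a * h b" if a: "a \<in> finite_elems" and b: "b \<in> finite_elems" for a b
  proof -
    have ab: "a * b \<in> finite_elems" "a * a \<in> finite_elems" "b * b \<in> finite_elems"
      using a b by (auto simp: finite_elems_mult)
    have "(a + b) * (a + b) = (a * a + b * b) + (a * b + a * b)" by (simp add: algebra_simps)
    then have "h ((a + b) * (a + b)) = h ((a * a + b * b) + (a * b + a * b))"
      by (rule arg_cong)
    also have "\<dots> = (h (a * a) + h (b * b)) + (h (a * b) + h (a * b))"
      using ab by (simp only: add finite_elems_add)
    finally have "h ((a + b) * (a + b)) = (h (a * a) + h (b * b)) + (h (a * b) + h (a * b))" .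
    moreover have "h ((a + b) * (a + b)) = (h a + h b) * (h a + h b)"
      using a b by (simp only: sq add finite_elems_add)
    moreover have "h (a * a) = h a * h a" "h (b * b) = h b * h b"
      using a b by (simp_all only: sq)
    ultimately show ?thesis by (simp add: algebra_simps)
  qed
  have inf: "a \<in> finite_elems" if "a \<in> infinitesimals" for a :: 'a
    using that unfolding infinitesimals_def finite_elems_def
    by (auto intro!: exI[of _ 1] dest: spec[of _ 1])
  have ker: "a \<in> infinitesimals \<longleftrightarrow> h a = 0" if a: "a \<in> finite_elems" for a
  proof
    assume m: "a \<in> infinitesimals"
    show "h a = 0"
    proof (rule ccontr)
      assume "h a \<noteq> 0"
      then obtain n where n: "inverse (real (Suc n)) < \<bar>h a\<bar>"
        using reals_Archimedean[of "\<bar>h a\<bar>"] by auto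
      define q :: rat where "q = 1 / of_nat (Suc n)"
      have rq: "(of_rat q :: 'a) = 1 / of_nat (Suc n)" "real_of_rat q = inverse (real (Suc n))"
        unfolding q_def by (simp_all add: of_rat_divide of_rat_add inverse_eq_divide)
      have "\<bar>a\<bar> \<le> of_rat q"
        unfolding rq using m unfolding infinitesimals_def by blast
      then have "a \<le> of_rat q" "- a \<le> of_rat q" by (auto simp: abs_le_iff)
      then have "\<bar>h a\<bar> \<le> of_rat q"
        using up[of a q] up[of "- a" q] a neg[of a] by (auto simp: finite_elems_uminus)
      with n rq show False by simp
    qed
  next
    assume h0: "h a = 0"
    show "a \<in> infinitesimals"
      unfolding infinitesimals_def
    proof (intro CollectI allI impI)
      fix k :: nat assume k: "k > 0"
      define q :: rat where "q = 1 / of_nat k"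
      have rq: "(of_rat q :: 'a) = 1 / of_nat k" "real_of_rat q > 0"
        unfolding q_def using k by (simp_all add: of_rat_divide)
      have "a < of_rat q" "- a < of_rat q"
        using up'[of a q] up'[of "- a" q] a neg[of a] h0 rq(2) by (auto simp: finite_elems_uminus)
      then show "\<bar>a\<bar> \<le> 1 / of_nat k" by (simp add: abs_le_iff rq)
    qed
  qed
  have "is_standard_part h"
    unfolding is_standard_part_def
    using one add mult mono ker inf by (auto simp: h_def)
  then show ?thesis by blast
qed

lemma is_standard_part_st: "is_standard_part (st :: 'a :: linordered_field \<Rightarrow> real)"
  unfolding st_def using is_standard_part_exists is_standard_part_unique
  by (metis theI)

end

theory Submission
  imports Defs "HOL-Library.Countable" "HOL-Library.Nat_Bijection"
begin

text \<open>
  Call a definable cylinder over a finite set \<open>I\<close> of coordinates small if it contains no box with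
  rational corners. O-minimality enters through two facts about the line, propagated to higher
  dimension by saturation and induction on \<open>I\<close>. First, a definable set that is infinitesimally
  dense in a rational box contains a rational box; hence the standard parts of two disjoint definable
  sets meet inside the standard part of a small set. Second, the fibres of a small set over a
  coordinate hyperplane are, off a small set, finite up to infinitesimals, hence covered by finitely
  many sheets that are graphs over the hyperplane.

  Saturation beyond the continuum yields one infinitesimal that dominates all the infinitesimals
  attached to the points of a real coordinate space. Therefore the projection \<open>W\<close> of a difference
  \<open>st X - st Y\<close> is externally definable: for every section \<open>g\<close> of the standard part map there is a
  definable \<open>Z\<close> with \<open>W = {p. g p \<in> Z}\<close>. If \<open>g\<close> takes values in a sheet \<open>S\<close>, then \<open>W\<close> agrees
  with \<open>st (S \<inter> Z)\<close> on \<open>st S\<close> off a small set, because the projections of \<open>S \<inter> Z\<close> and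
  \<open>S - Z\<close> are disjoint. A downward induction on the number of coordinates then shows that externally
  definable sets are finite unions of differences, so these are closed under projection.
\<close>

section \<open>Definable predicates\<close>

text \<open>Infinite closeness is not a definable relation, whereas saturation and o-minimality
  speak of definable sets. The remedy is the same throughout: closeness up to one fixed
  infinitesimal, which must serve all points of a real coordinate space at once. The obstacle to
  projecting \<open>st X - st Y\<close> is that avoiding \<open>st Y\<close> is an open condition: a
  witness keeps some distance \<open>1 / (k + 1)\<close> from \<open>Y\<close>, with
  \<open>k\<close> depending on the point. The set \<open>Z\<close> that results from an
  infinitesimal distance depends on the section \<open>g\<close> and may separate points with the
  same standard part, so \<open>st Z\<close> may be too large. Since \<open>g\<close> is arbitrary,
  it can be chosen inside a sheet, where the ambiguous points have a small projection. Boxes have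
  rational corners because this makes smallness a countable family of conditions, accessible both to
  saturation and to a Baire-type argument. Over no coordinates at all a small set is empty, which is
  why the downward induction leaves no exceptional points.\<close>

primrec rename_trm :: "(nat \<Rightarrow> nat) \<Rightarrow> 'f trm \<Rightarrow> 'f trm" where
  "rename_trm s (Var i) = Var (s i)"
| "rename_trm s (Fun f ts) = Fun f (map (rename_trm s) ts)"

primrec rename :: "(nat \<Rightarrow> nat) \<Rightarrow> ('f, 'r) form \<Rightarrow> ('f, 'r) form" where
  "rename s (Eq t u) = Eq (rename_trm s t) (rename_trm s u)"
| "rename s (Rel r ts) = Rel r (map (rename_trm s) ts)"
| "rename s (Neg p) = Neg (rename s p)"
| "rename s (Conj p q) = Conj (rename s p) (rename s q)"
| "rename s (Ex i p) = Ex (s i) (rename s p)"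

lemma trm_of_rename [simp]: "trm_of M (rename_trm s t) \<longleftrightarrow> trm_of M t"
  by (induction t) (auto simp: list_all_iff)

lemma form_of_rename [simp]: "form_of M (rename s p) \<longleftrightarrow> form_of M p"
  by (induction p) (auto simp: list_all_iff)

lemma trm_val_rename: "trm_val M e (rename_trm s t) = trm_val M (e \<circ> s) t"
  by (induction t) (auto cong: map_cong simp: comp_def)

text \<open>Injectivity prevents the bound variable \<open>s i\<close> from capturing another
  variable. Substitutions that identify variables are obtained semantically in
  \<open>dpred_rename\<close>.\<close>

lemma sat_rename:
  assumes "inj s"
  shows "sat M e (rename s p) \<longleftrightarrow> sat M (e \<circ> s) p"
proof (induction p arbitrary: e)
  case (Ex i p)
  have "e(s i := a) \<circ> s = (e \<circ> s)(i := a)" for a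
    using assms by (auto simp: fun_eq_iff inj_eq)
  then show ?case by (simp only: sat.simps rename.simps Ex.IH)
qed (simp_all add: trm_val_rename comp_def)

text \<open>Points are assignments with infinitely many coordinates, so predicates of different
  arities combine without reindexing. The variables from \<open>n\<close> on are reserved for the
  parameters \<open>c\<close>.\<close>

definition dpred :: "('f, 'r, 'a) struct \<Rightarrow> ((nat \<Rightarrow> 'a) \<Rightarrow> bool) \<Rightarrow> bool" where
  "dpred M P \<longleftrightarrow>
     (\<exists>p c n. form_of M p \<and> (\<forall>e. P e \<longleftrightarrow> sat M (\<lambda>i. if i < n then e i else c i) p))"

lemma dpredI:
  "form_of M p \<Longrightarrow> (\<And>e. P e \<longleftrightarrow> sat M (\<lambda>i. if i < n then e i else c i) p) \<Longrightarrow> dpred M P"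
  unfolding dpred_def by blast

lemma dpred_finite_dep:
  fixes P :: "(nat \<Rightarrow> 'a) \<Rightarrow> bool"
  assumes "dpred M P"
  obtains n where "\<And>e e'. (\<And>i. i < n \<Longrightarrow> e i = e' i) \<Longrightarrow> P e \<longleftrightarrow> P e'"
proof -
  obtain p c n where P: "\<And>e. P e \<longleftrightarrow> sat M (\<lambda>i. if i < n then e i else c i) p"
    using assms by (auto simp: dpred_def)
  show ?thesis
  proof (rule that)
    fix e e' :: "nat \<Rightarrow> 'a" assume "\<And>i. i < n \<Longrightarrow> e i = e' i"
    then have "(\<lambda>i. if i < n then e i else c i) = (\<lambda>i. if i < n then e' i else c i)"
      by auto
    then show "P e \<longleftrightarrow> P e'" by (simp only: P)
  qed
qed

text \<open>The parameters can be moved to the variables \<open>t 0, t 1, \<dots>\<close>, which makes room for further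
  coordinates and for the parameters of another formula.\<close>

lemma dpred_place:
  fixes P :: "(nat \<Rightarrow> 'a) \<Rightarrow> bool"
  assumes "dpred M P"
  obtains n where "\<And>N (t :: nat \<Rightarrow> nat). N \<ge> n \<Longrightarrow> inj t \<Longrightarrow> (\<And>j. N \<le> t j) \<Longrightarrow>
    \<exists>p c. form_of M p \<and> (\<forall>h. (\<forall>j. h (t j) = c j) \<longrightarrow>
      (\<forall>e. P e \<longleftrightarrow> sat M (\<lambda>i. if i < N then e i else h i) p))"
proof -
  obtain p c n where p: "form_of M p"
    and P: "\<And>e. P e \<longleftrightarrow> sat M (\<lambda>i. if i < n then e i else c i) p"
    using assms by (auto simp: dpred_def)
  show ?thesis
  proof (rule that)
    fix N :: nat and t :: "nat \<Rightarrow> nat" assume N: "N \<ge> n" and t: "inj t" and Nt: "\<And>j. N \<le> t j"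
    define s where "s i = (if i < n then i else t (i - n))" for i
    have "inj s"
    proof (rule injI)
      fix i j assume "s i = s j"
      then show "i = j" using Nt[of "i - n"] Nt[of "j - n"] N t
        by (auto simp: s_def inj_eq split: if_splits)
    qed
    moreover have "(\<lambda>i. if i < N then e i else h i) \<circ> s = (\<lambda>i. if i < n then e i else c i)"
      if "\<forall>j. h (t j) = c (n + j)" for h e :: "nat \<Rightarrow> 'a"
    proof
      fix i
      show "((\<lambda>i. if i < N then e i else h i) \<circ> s) i = (if i < n then e i else c i)"
        using N Nt[of "i - n"] that[rule_format, of "i - n"] by (auto simp: s_def)
    qed
    ultimately show "\<exists>p c. form_of M p \<and> (\<forall>h. (\<forall>j. h (t j) = c j) \<longrightarrow>
      (\<forall>e. P e \<longleftrightarrow> sat M (\<lambda>i. if i < N then e i else h i) p))"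
      by (intro exI[of _ "rename s p"] exI[of _ "\<lambda>j. c (n + j)"]) (auto simp: p P sat_rename)
  qed
qed

lemma dpred_large:
  assumes "dpred M P"
  obtains n where "\<And>N. N \<ge> n \<Longrightarrow>
    \<exists>p c. form_of M p \<and> (\<forall>e. P e \<longleftrightarrow> sat M (\<lambda>i. if i < N then e i else c i) p)"
proof -
  obtain n where n: "\<And>N (t :: nat \<Rightarrow> nat). N \<ge> n \<Longrightarrow> inj t \<Longrightarrow> (\<And>j. N \<le> t j) \<Longrightarrow>
    \<exists>p c. form_of M p \<and> (\<forall>h. (\<forall>j. h (t j) = c j) \<longrightarrow>
      (\<forall>e. P e \<longleftrightarrow> sat M (\<lambda>i. if i < N then e i else h i) p))"
    using dpred_place[OF assms] by blast
  have "\<exists>p c. form_of M p \<and> (\<forall>e. P e \<longleftrightarrow> sat M (\<lambda>i. if i < N then e i else c i) p)"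
    if N: "N \<ge> n" for N
  proof -
    obtain p c where p: "form_of M p" and c: "\<And>h e. \<forall>j. h (N + j) = c j \<Longrightarrow>
        P e \<longleftrightarrow> sat M (\<lambda>i. if i < N then e i else h i) p"
        using n[of N "\<lambda>j. N + j"] N by (simp add: inj_def) blast
    show ?thesis
      by (intro exI[of _ p] exI[of _ "\<lambda>i. c (i - N)"] conjI p allI c) simp
  qed
  then show ?thesis by (rule that)
qed

lemma dpred_neg:
  assumes "dpred M P" shows "dpred M (\<lambda>e. \<not> P e)"
proof -
  obtain p c n where "form_of M p" "\<And>e. P e \<longleftrightarrow> sat M (\<lambda>i. if i < n then e i else c i) p"
    using assms by (auto simp: dpred_def)
  then show ?thesis by (intro dpredI[of M "Neg p"]) auto
qed

lemma dpred_conj: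
  assumes "dpred M P" "dpred M Q" shows "dpred M (\<lambda>e. P e \<and> Q e)"
proof -
  obtain n1 where n1: "\<And>N (t :: nat \<Rightarrow> nat). N \<ge> n1 \<Longrightarrow> inj t \<Longrightarrow> (\<And>j. N \<le> t j) \<Longrightarrow>
    \<exists>p c. form_of M p \<and> (\<forall>h. (\<forall>j. h (t j) = c j) \<longrightarrow>
      (\<forall>e. P e \<longleftrightarrow> sat M (\<lambda>i. if i < N then e i else h i) p))"
    using dpred_place[OF assms(1)] by blast
  obtain n2 where n2: "\<And>N (t :: nat \<Rightarrow> nat). N \<ge> n2 \<Longrightarrow> inj t \<Longrightarrow> (\<And>j. N \<le> t j) \<Longrightarrow>
    \<exists>p c. form_of M p \<and> (\<forall>h. (\<forall>j. h (t j) = c j) \<longrightarrow>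
      (\<forall>e. Q e \<longleftrightarrow> sat M (\<lambda>i. if i < N then e i else h i) p))"
    using dpred_place[OF assms(2)] by blast
  define N where "N = max n1 n2"
  obtain p c where p: "form_of M p" and c: "\<And>h e. \<forall>j. h (N + 2 * j) = c j \<Longrightarrow>
        P e \<longleftrightarrow> sat M (\<lambda>i. if i < N then e i else h i) p"
    using n1[of N "\<lambda>j. N + 2 * j"] by (simp add: inj_def N_def le_SucI trans_le_add1) blast
  obtain q d where q: "form_of M q" and d: "\<And>h e. \<forall>j. h (N + (2 * j + 1)) = d j \<Longrightarrow>
        Q e \<longleftrightarrow> sat M (\<lambda>i. if i < N then e i else h i) q"
    using n2[of N "\<lambda>j. N + (2 * j + 1)"] by (simp add: inj_def N_def le_SucI trans_le_add1) blast
  \<comment> \<open>The parameters of \<open>P\<close> occupy the even slots above \<open>N\<close>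
    and those of \<open>Q\<close> the odd ones, so the two formulas share no parameter
    variable.\<close>
  define h where "h i = (if even (i - N) then c ((i - N) div 2) else d ((i - N) div 2))" for i
  show ?thesis
  proof (rule dpredI)
    show "form_of M (Conj p q)" using p q by simp
    show "P e \<and> Q e \<longleftrightarrow> sat M (\<lambda>i. if i < N then e i else h i) (Conj p q)" for e
      using c[of h e] d[of h e] by (simp add: h_def)
  qed
qed

lemma dpred_disj:
  assumes "dpred M P" "dpred M Q" shows "dpred M (\<lambda>e. P e \<or> Q e)"
proof -
  have "dpred M (\<lambda>e. \<not> (\<not> P e \<and> \<not> Q e))"
    by (rule dpred_neg, rule dpred_conj; rule dpred_neg) (rule assms)+
  then show ?thesis by simp
qed

lemma dpred_imp:
  assumes "dpred M P" "dpred M Q" shows "dpred M (\<lambda>e. P e \<longrightarrow> Q e)"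
proof -
  have "dpred M (\<lambda>e. \<not> P e \<or> Q e)"
    by (rule dpred_disj, rule dpred_neg) (rule assms)+
  then show ?thesis by simp
qed

lemma dpred_const: "dpred M (\<lambda>e. b)"
proof (cases b)
  case True
  then show ?thesis by (intro dpredI[of M "Eq (Var 0) (Var 0)"]) auto
next
  case False
  then show ?thesis by (intro dpredI[of M "Neg (Eq (Var 0) (Var 0))"]) auto
qed

lemma dpred_ball:
  "finite I \<Longrightarrow> (\<And>i. i \<in> I \<Longrightarrow> dpred M (P i)) \<Longrightarrow> dpred M (\<lambda>e. \<forall>i\<in>I. P i e)"
  by (induction I rule: finite_induct) (auto simp: dpred_const intro: dpred_conj)

lemma dpred_bex:
  "finite I \<Longrightarrow> (\<And>i. i \<in> I \<Longrightarrow> dpred M (P i)) \<Longrightarrow> dpred M (\<lambda>e. \<exists>i\<in>I. P i e)"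
  by (induction I rule: finite_induct) (auto simp: dpred_const intro: dpred_disj)

lemma dpred_ex_coord:
  assumes "dpred M P" shows "dpred M (\<lambda>e. \<exists>a. P (e(k := a)))"
proof -
  obtain n where n: "\<And>N. N \<ge> n \<Longrightarrow>
    \<exists>p c. form_of M p \<and> (\<forall>e. P e \<longleftrightarrow> sat M (\<lambda>i. if i < N then e i else c i) p)"
    using dpred_large[OF assms] by blast
  define N where "N = max n (Suc k)"
  obtain p c where p: "form_of M p" and
    c: "\<And>e. P e \<longleftrightarrow> sat M (\<lambda>i. if i < N then e i else c i) p"
    using n[of N] by (auto simp: N_def)
  have "(\<lambda>i. if i < N then (e(k := a)) i else c i) = (\<lambda>i. if i < N then e i else c i)(k := a)"
    for e a by (auto simp: N_def)
  then show ?thesis using p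
    by (intro dpredI[of M "Ex k p" _ N c]) (simp_all add: c)
qed

lemma dpred_coord_eq: "dpred M (\<lambda>e. e j = e k)"
  by (rule dpredI[of M "Eq (Var j) (Var k)" _ "Suc (max j k)" undefined]) auto

lemma dpred_shift:
  assumes "dpred M P" shows "dpred M (\<lambda>e. P (\<lambda>i. e (N + i)))"
proof -
  obtain p c n where p: "form_of M p"
    and P: "\<And>e. P e \<longleftrightarrow> sat M (\<lambda>i. if i < n then e i else c i) p"
    using assms by (auto simp: dpred_def)
  show ?thesis
  proof (rule dpredI)
    show "form_of M (rename ((+) N) p)" using p by simp
    show "P (\<lambda>i. e (N + i)) \<longleftrightarrow>
        sat M (\<lambda>i. if i < N + n then e i else c (i - N)) (rename ((+) N) p)" for e
      by (simp add: P sat_rename comp_def cong: if_cong)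
  qed
qed

text \<open>Since \<open>s\<close> may identify variables, renaming inside the formula could cause
  capture. Instead the predicate is moved to variables from \<open>N\<close> on, beyond the relevant
  values of \<open>s\<close>; each of them is equated with its target and then bound by an
  existential quantifier.\<close>

lemma dpred_rename:
  assumes "dpred M P" shows "dpred M (\<lambda>e. P (\<lambda>i. e (s i)))"
proof -
  obtain n where n: "\<And>e e'. (\<And>i. i < n \<Longrightarrow> e i = e' i) \<Longrightarrow> P e \<longleftrightarrow> P e'"
    using dpred_finite_dep[OF assms] by blast
  define N where "N = Suc (Max (insert 0 (s ` {..<n})))"
  have N: "s i < N" if "i < n" for i
    using that by (auto simp: N_def less_Suc_eq_le intro!: Max_ge)
  have "dpred M (\<lambda>e. P (\<lambda>i. if i < j then e (s i) else e (N + i)))" if "j \<le> n" for j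
    using that
  proof (induction j)
    case 0
    then show ?case using dpred_shift[OF assms] by simp
  next
    case (Suc j)
    let ?Q = "\<lambda>e. e (N + j) = e (s j) \<and> P (\<lambda>i. if i < j then e (s i) else e (N + i))"
    have "dpred M ?Q" using Suc by (intro dpred_conj dpred_coord_eq) simp
    then have "dpred M (\<lambda>e. \<exists>a. ?Q (e(N + j := a)))" by (rule dpred_ex_coord)
    moreover have "(\<exists>a. ?Q (e(N + j := a))) \<longleftrightarrow> P (\<lambda>i. if i < Suc j then e (s i) else e (N + i))" for e
    proof -
      have ne: "s i \<noteq> N + j" if "i \<le> j" for i using N[of i] that Suc.prems by simp
      have "(\<exists>a. ?Q (e(N + j := a))) \<longleftrightarrow> ?Q (e(N + j := e (s j)))"
        using ne[of j] by auto
      also have "\<dots> \<longleftrightarrow> P (\<lambda>i. if i < j then (e(N + j := e (s j))) (s i) else (e(N + j := e (s j))) (N + i))"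
        using ne[of j] by auto
      also have "(\<lambda>i. if i < j then (e(N + j := e (s j))) (s i) else (e(N + j := e (s j))) (N + i)) =
          (\<lambda>i. if i < Suc j then e (s i) else e (N + i))"
        using ne by (auto simp: fun_eq_iff less_Suc_eq)
      finally show ?thesis .
    qed
    ultimately show ?case by simp
  qed
  from this[of n] have "dpred M (\<lambda>e. P (\<lambda>i. if i < n then e (s i) else e (N + i)))" by simp
  moreover have "P (\<lambda>i. if i < n then e (s i) else e (N + i)) \<longleftrightarrow> P (\<lambda>i. e (s i))" for e
    by (rule n) simp
  ultimately show ?thesis by simp
qed

text \<open>Scalar binders prepend a coordinate, as de Bruijn indices do.\<close>

lemma dpred_ex:
  assumes "dpred M (\<lambda>e. P (e 0) (\<lambda>i. e (Suc i)))" shows "dpred M (\<lambda>e. \<exists>a. P a e)"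
  using dpred_rename[OF dpred_ex_coord[OF assms, of 0], of "\<lambda>i. i - 1"] by simp

lemma dpred_all:
  assumes "dpred M (\<lambda>e. P (e 0) (\<lambda>i. e (Suc i)))" shows "dpred M (\<lambda>e. \<forall>a. P a e)"
proof -
  have "dpred M (\<lambda>e. \<exists>a. \<not> P a e)"
    by (rule dpred_ex, rule dpred_neg) (rule assms)
  then have "dpred M (\<lambda>e. \<not> (\<exists>a. \<not> P a e))" by (rule dpred_neg)
  then show ?thesis by simp
qed

text \<open>A binder for a whole point puts its coordinates on the even variables. Only finitely many of
  them matter, so this is first-order quantification.\<close>

lemma dpred_ex_point:
  fixes P :: "(nat \<Rightarrow> 'a) \<Rightarrow> (nat \<Rightarrow> 'a) \<Rightarrow> bool"
  assumes "dpred M (\<lambda>e. P (\<lambda>i. e (2 * i)) (\<lambda>i. e (2 * i + 1)))"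
  shows "dpred M (\<lambda>e. \<exists>x. P x e)"
proof -
  define R where "R e = P (\<lambda>i. e (2 * i)) (\<lambda>i. e (2 * i + 1))" for e
  have R: "dpred M R" using assms by (simp add: R_def[abs_def])
  obtain n where n: "\<And>e e'. (\<And>i. i < n \<Longrightarrow> e i = e' i) \<Longrightarrow> R e \<longleftrightarrow> R e'"
    using dpred_finite_dep[OF R] by blast
  have block: "dpred M (\<lambda>e. \<exists>x. R (\<lambda>i. if i \<in> E then x i else e i))" if "finite E" for E
    using that
  proof (induction E rule: finite_induct)
    case empty
    then show ?case using R by simp
  next
    case (insert k E)
    have "(\<exists>x. R (\<lambda>i. if i \<in> insert k E then x i else e i)) \<longleftrightarrow>
        (\<exists>a x. R (\<lambda>i. if i \<in> E then x i else (e(k := a)) i))" for e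
    proof
      assume "\<exists>x. R (\<lambda>i. if i \<in> insert k E then x i else e i)"
      then obtain x where x: "R (\<lambda>i. if i \<in> insert k E then x i else e i)" by blast
      have "(\<lambda>i. if i \<in> insert k E then x i else e i) =
          (\<lambda>i. if i \<in> E then x i else (e(k := x k)) i)" by auto
      with x show "\<exists>a x. R (\<lambda>i. if i \<in> E then x i else (e(k := a)) i)" by metis
    next
      assume "\<exists>a x. R (\<lambda>i. if i \<in> E then x i else (e(k := a)) i)"
      then obtain a x where x: "R (\<lambda>i. if i \<in> E then x i else (e(k := a)) i)" by blast
      have "(\<lambda>i. if i \<in> E then x i else (e(k := a)) i) =
          (\<lambda>i. if i \<in> insert k E then (x(k := a)) i else e i)" using insert by auto
      with x show "\<exists>x. R (\<lambda>i. if i \<in> insert k E then x i else e i)" by metis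
    qed
    then show ?case using dpred_ex_coord[OF insert.IH, of k] by presburger
  qed
  define E where "E = {i. i < n \<and> even i}"
  have "(\<exists>x. R (\<lambda>i. if i \<in> E then x i else e i)) \<longleftrightarrow> (\<exists>x. P x (\<lambda>i. e (2 * i + 1)))" for e
  proof
    assume "\<exists>x. R (\<lambda>i. if i \<in> E then x i else e i)"
    then show "\<exists>x. P x (\<lambda>i. e (2 * i + 1))" by (auto simp: E_def R_def)
  next
    assume "\<exists>x. P x (\<lambda>i. e (2 * i + 1))"
    then obtain x where "P x (\<lambda>i. e (2 * i + 1))" by blast
    then have "R (\<lambda>i. if even i then x (i div 2) else e i)" by (simp add: R_def)
    moreover have "R (\<lambda>i. if even i then x (i div 2) else e i) \<longleftrightarrow>
        R (\<lambda>i. if i \<in> E then x (i div 2) else e i)"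
      by (rule n) (auto simp: E_def)
    ultimately show "\<exists>x. R (\<lambda>i. if i \<in> E then x i else e i)"
      by (intro exI[of _ "\<lambda>i. x (i div 2)"]) simp
  qed
  moreover have "finite E" by (simp add: E_def)
  ultimately have "dpred M (\<lambda>e. \<exists>x. P x (\<lambda>i. e (2 * i + 1)))" using block[of E] by simp
  from dpred_rename[OF this, of "\<lambda>i. i div 2"] show ?thesis by simp
qed

lemma dpred_all_point:
  assumes "dpred M (\<lambda>e. P (\<lambda>i. e (2 * i)) (\<lambda>i. e (2 * i + 1)))"
  shows "dpred M (\<lambda>e. \<forall>x. P x e)"
proof -
  have "dpred M (\<lambda>e. \<exists>x. \<not> P x e)"
    by (rule dpred_ex_point, rule dpred_neg) (rule assms)
  then have "dpred M (\<lambda>e. \<not> (\<exists>x. \<not> P x e))" by (rule dpred_neg)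
  then show ?thesis by simp
qed

section \<open>Definable terms, given by their graphs, and substitution\<close>

definition dterm :: "('f, 'r, 'a) struct \<Rightarrow> ((nat \<Rightarrow> 'a) \<Rightarrow> 'a) \<Rightarrow> bool" where
  "dterm M t \<longleftrightarrow> dpred M (\<lambda>e. e 0 = t (\<lambda>i. e (Suc i)))"

lemma dterm_eq:
  assumes "dterm M t" shows "dpred M (\<lambda>e. e k = t (\<lambda>i. e (s i)))"
  using dpred_rename[OF assms[unfolded dterm_def], of "case_nat k s"] by simp

lemma dterm_rename: "dterm M t \<Longrightarrow> dterm M (\<lambda>e. t (\<lambda>i. e (s i)))"
  unfolding dterm_def[of M "\<lambda>e. t (\<lambda>i. e (s i))"] by (rule dterm_eq[of M t 0 "\<lambda>i. Suc (s i)"])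

text \<open>The value \<open>f e i\<close> is put on variable \<open>i\<close> by quantifying over
  the graph of the term, one variable at a time, while the original assignment is kept on the
  variables from \<open>n\<close> on.\<close>

lemma dpred_subst:
  assumes P: "dpred M P" and f: "\<And>i. dterm M (\<lambda>e. f e i)"
  shows "dpred M (\<lambda>e. P (f e))"
proof -
  obtain n where n: "\<And>e e'. (\<And>i. i < n \<Longrightarrow> e i = e' i) \<Longrightarrow> P e \<longleftrightarrow> P e'"
    using dpred_finite_dep[OF P] by blast
  have "dpred M (\<lambda>e. P (\<lambda>i. if i < j then f (\<lambda>l. e (n + l)) i else e i))" if "j \<le> n" for j
    using that
  proof (induction j)
    case 0
    then show ?case using P by simp
  next
    case (Suc j)
    let ?Q = "\<lambda>e. e j = f (\<lambda>l. e (n + l)) j \<and> P (\<lambda>i. if i < j then f (\<lambda>l. e (n + l)) i else e i)"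
    have "dpred M ?Q" using Suc by (intro dpred_conj dterm_eq[OF f]) simp
    then have "dpred M (\<lambda>e. \<exists>a. ?Q (e(j := a)))" by (rule dpred_ex_coord)
    moreover have "(\<exists>a. ?Q (e(j := a))) \<longleftrightarrow>
        P (\<lambda>i. if i < Suc j then f (\<lambda>l. e (n + l)) i else e i)" for e
    proof -
      have upd: "(\<lambda>l. (e(j := a)) (n + l)) = (\<lambda>l. e (n + l))" for a
        using Suc.prems by auto
      have "(\<lambda>i. if i < j then f (\<lambda>l. e (n + l)) i else (e(j := f (\<lambda>l. e (n + l)) j)) i) =
          (\<lambda>i. if i < Suc j then f (\<lambda>l. e (n + l)) i else e i)"
        by (auto simp: fun_eq_iff less_Suc_eq)
      then show ?thesis unfolding upd fun_upd_same by simp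
    qed
    ultimately show ?case by simp
  qed
  from this[of n] have "dpred M (\<lambda>e. P (\<lambda>i. if i < n then f (\<lambda>l. e (n + l)) i else e i))" by simp
  moreover have "P (\<lambda>i. if i < n then f (\<lambda>l. e (n + l)) i else e i) \<longleftrightarrow> P (f (\<lambda>l. e (n + l)))" for e
    by (rule n) simp
  ultimately have "dpred M (\<lambda>e. P (f (\<lambda>l. e (n + l))))" by simp
  from dpred_rename[OF this, of "\<lambda>i. i - n"] show ?thesis by simp
qed

lemma dterm_var: "dterm M (\<lambda>e. e i)"
  unfolding dterm_def by (rule dpred_coord_eq)

lemma dterm_const: "dterm M (\<lambda>e. c)"
  unfolding dterm_def by (rule dpredI[of M "Eq (Var 0) (Var 1)" _ 1 "\<lambda>_. c"]) auto

lemma dterm_upd: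
  "dterm M t \<Longrightarrow> dterm M (\<lambda>e. x e i) \<Longrightarrow> dterm M (\<lambda>e. ((x e)(k := t e)) i)"
  by (cases "i = k") simp_all

lemma dpred_subst2:
  assumes "dpred M (\<lambda>e. R (e 0) (e 1))" "dterm M t" "dterm M u"
  shows "dpred M (\<lambda>e. R (t e) (u e))"
proof -
  have "dterm M (\<lambda>e. case_nat (t e) (\<lambda>_. u e) i)" for i
    using assms(2,3) by (cases i) auto
  from dpred_subst[where f = "\<lambda>e. case_nat (t e) (\<lambda>_. u e)", OF assms(1) this]
  show ?thesis by simp
qed

lemma dpred_eq: "dterm M t \<Longrightarrow> dterm M u \<Longrightarrow> dpred M (\<lambda>e. t e = u e)"
  by (rule dpred_subst2[where R = "(=)", OF dpred_coord_eq])

lemma dterm_subst2: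
  assumes "dterm M (\<lambda>e. g (e 0) (e 1))" "dterm M t" "dterm M u"
  shows "dterm M (\<lambda>e. g (t e) (u e))"
proof -
  have "dpred M (\<lambda>e. e 0 = g (e (Suc 0)) (e (Suc 1)))"
    using assms(1) by (simp add: dterm_def)
  moreover have "dterm M (\<lambda>e. case_nat (e 0)
      (case_nat (t (\<lambda>i. e (Suc i))) (\<lambda>_. u (\<lambda>i. e (Suc i)))) i)" for i
  proof (cases i)
    case 0
    then show ?thesis by (simp add: dterm_var)
  next
    case (Suc j)
    then show ?thesis using assms(2,3) by (cases j) (auto intro: dterm_rename)
  qed
  ultimately have "dpred M (\<lambda>e. (\<lambda>e. e 0 = g (e (Suc 0)) (e (Suc 1))) (case_nat (e 0)
      (case_nat (t (\<lambda>i. e (Suc i))) (\<lambda>_. u (\<lambda>i. e (Suc i))))))"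
    by (rule dpred_subst)
  then show ?thesis by (simp add: dterm_def)
qed

lemma names_fun_dterm2:
  assumes "names_fun M 2 (\<lambda>xs. g (xs ! 0) (xs ! 1))" "dterm M t" "dterm M u"
  shows "dterm M (\<lambda>e. g (t e) (u e))"
proof (rule dterm_subst2[where g = g, OF _ assms(2,3)])
  obtain f where f: "f \<in> fun_syms M" "fun_arity M f = 2"
    "\<And>xs. length xs = 2 \<Longrightarrow> fun_int M f xs = g (xs ! 0) (xs ! 1)"
    using assms(1) by (auto simp: names_fun_def)
  show "dterm M (\<lambda>e. g (e 0) (e 1))" unfolding dterm_def
    by (rule dpredI[of M "Eq (Var 0) (Fun f [Var 1, Var 2])" _ 3 undefined])
      (use f in \<open>auto simp: numeral_2_eq_2\<close>)
qed

lemma names_rel_dpred2: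
  assumes "names_rel M 2 (\<lambda>xs. R (xs ! 0) (xs ! 1))" "dterm M t" "dterm M u"
  shows "dpred M (\<lambda>e. R (t e) (u e))"
proof (rule dpred_subst2[where R = R, OF _ assms(2,3)])
  obtain r where r: "r \<in> rel_syms M" "rel_arity M r = 2"
    "\<And>xs. length xs = 2 \<Longrightarrow> rel_int M r xs = R (xs ! 0) (xs ! 1)"
    using assms(1) by (auto simp: names_rel_def)
  show "dpred M (\<lambda>e. R (e 0) (e 1))"
    by (rule dpredI[of M "Rel r [Var 0, Var 1]" _ 2 undefined])
      (use r in \<open>auto simp: numeral_2_eq_2\<close>)
qed

section \<open>Definable cylinders and their translation to sets of lists\<close>

definition dset :: "('f, 'r, 'a) struct \<Rightarrow> (nat \<Rightarrow> 'a) set \<Rightarrow> bool" where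
  "dset M X \<longleftrightarrow> dpred M (\<lambda>x. x \<in> X)"

lemma dset_Collect: "dset M {x. P x} \<longleftrightarrow> dpred M P"
  by (simp add: dset_def)

lemma dpred_mem: "dset M X \<Longrightarrow> (\<And>i. dterm M (\<lambda>e. f e i)) \<Longrightarrow> dpred M (\<lambda>e. f e \<in> X)"
  unfolding dset_def by (rule dpred_subst)

text \<open>A subset of the power indexed by \<open>I\<close> is encoded as a cylinder of full
  assignments, so that adding or removing coordinates needs no change of type.\<close>

definition depends :: "nat set \<Rightarrow> (nat \<Rightarrow> 'a) set \<Rightarrow> bool" where
  "depends I X \<longleftrightarrow> (\<forall>x y. (\<forall>i\<in>I. x i = y i) \<longrightarrow> (x \<in> X \<longleftrightarrow> y \<in> X))"

lemma dependsD: "depends I X \<Longrightarrow> (\<And>i. i \<in> I \<Longrightarrow> x i = y i) \<Longrightarrow> x \<in> X \<longleftrightarrow> y \<in> X"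
  unfolding depends_def by blast

lemma depends_mono: "depends I X \<Longrightarrow> I \<subseteq> J \<Longrightarrow> depends J X"
  unfolding depends_def by (meson subsetD)

lemma definable_dset:
  assumes "definable M n S"
  shows "dset M {x. map x [0..<n] \<in> S}" "depends {..<n} {x. map x [0..<n] \<in> S}"
proof -
  obtain p e where p: "form_of M p"
    and S: "S = {xs. length xs = n \<and> sat M (\<lambda>i. if i < n then xs ! i else e i) p}"
    using assms by (auto simp: definable_def)
  have "(\<lambda>i. if i < n then map x [0..<n] ! i else e i) = (\<lambda>i. if i < n then x i else e i)" for x
    by auto
  then show "dset M {x. map x [0..<n] \<in> S}"
    unfolding dset_Collect by (intro dpredI[OF p, of _ n e]) (simp add: S)
  have "map x [0..<n] = map y [0..<n]" if "\<forall>i\<in>{..<n}. x i = y i" for x y :: "nat \<Rightarrow> 'c"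
    using that by auto
  then show "depends {..<n} {x. map x [0..<n] \<in> S}"
    unfolding depends_def by (metis mem_Collect_eq)
qed

lemma dset_definable:
  assumes "dset M X" "depends {..<n} X"
  shows "definable M n {map x [0..<n] | x. x \<in> X}"
proof -
  obtain n0 where n0: "\<And>N. N \<ge> n0 \<Longrightarrow>
    \<exists>p c. form_of M p \<and> (\<forall>e. e \<in> X \<longleftrightarrow> sat M (\<lambda>i. if i < N then e i else c i) p)"
    using dpred_large[OF assms(1)[unfolded dset_def]] by blast
  define N where "N = max n0 n"
  obtain p c where p: "form_of M p" and
    c: "\<And>e. e \<in> X \<longleftrightarrow> sat M (\<lambda>i. if i < N then e i else c i) p"
    using n0[of N] by (auto simp: N_def)
  have key: "sat M (\<lambda>i. if i < n then xs ! i else c i) p \<longleftrightarrow>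
      (\<exists>x. xs = map x [0..<n] \<and> x \<in> X)" if "length xs = n" for xs
  proof -
    define x where "x i = (if i < n then xs ! i else c i)" for i
    have "(\<lambda>i. if i < N then x i else c i) = (\<lambda>i. if i < n then xs ! i else c i)"
      by (auto simp: N_def x_def less_max_iff_disj fun_eq_iff)
    then have "sat M (\<lambda>i. if i < n then xs ! i else c i) p \<longleftrightarrow> x \<in> X" using c[of x] by simp
    moreover have "map x [0..<n] = xs" using that by (intro nth_equalityI) (auto simp: x_def)
    moreover have "x \<in> X" if "xs = map y [0..<n]" "y \<in> X" for y
      using dependsD[OF assms(2), of x y] that by (simp add: x_def)
    ultimately show ?thesis by blast
  qed
  have "{map x [0..<n] | x. x \<in> X} =
      {xs. length xs = n \<and> sat M (\<lambda>i. if i < n then xs ! i else c i) p}"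
    using key by (auto simp del: map_eq_conv)
  with p show ?thesis unfolding definable_def by blast
qed

lemma dpred_ball_point:
  assumes "dset M X" "dpred M (\<lambda>e. P (\<lambda>i. e (2 * i)) (\<lambda>i. e (2 * i + 1)))"
  shows "dpred M (\<lambda>e. \<forall>x\<in>X. P x e)"
proof -
  have "dpred M (\<lambda>e. \<forall>x. x \<in> X \<longrightarrow> P x e)"
    by (rule dpred_all_point, rule dpred_imp, rule dpred_mem) (rule assms dterm_var)+
  then show ?thesis by (simp add: Ball_def)
qed

lemma dpred_bex_point:
  assumes "dset M X" "dpred M (\<lambda>e. P (\<lambda>i. e (2 * i)) (\<lambda>i. e (2 * i + 1)))"
  shows "dpred M (\<lambda>e. \<exists>x\<in>X. P x e)"
proof -
  have "dpred M (\<lambda>e. \<exists>x. x \<in> X \<and> P x e)"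
    by (rule dpred_ex_point, rule dpred_conj, rule dpred_mem) (rule assms dterm_var)+
  then show ?thesis by (simp add: Bex_def)
qed

lemma dset_UNIV: "dset M UNIV"
  by (simp add: dset_def dpred_const)

lemma dset_empty: "dset M {}"
  by (simp add: dset_def dpred_const)

lemma dset_Int: "dset M X \<Longrightarrow> dset M Y \<Longrightarrow> dset M (X \<inter> Y)"
  by (simp add: dset_def dpred_conj)

lemma dset_Un: "dset M X \<Longrightarrow> dset M Y \<Longrightarrow> dset M (X \<union> Y)"
  by (simp add: dset_def dpred_disj)

lemma dset_Diff: "dset M X \<Longrightarrow> dset M Y \<Longrightarrow> dset M (X - Y)"
  by (simp add: dset_def dpred_conj dpred_neg)

lemma dset_UN: "finite I \<Longrightarrow> (\<And>i. i \<in> I \<Longrightarrow> dset M (X i)) \<Longrightarrow> dset M (\<Union>i\<in>I. X i)"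
  by (simp add: dset_def dpred_bex)

section \<open>Standard parts\<close>

abbreviation eps :: "nat \<Rightarrow> 'a :: linordered_field" where
  "eps k \<equiv> 1 / of_nat (Suc k)"

lemma infinitesimal_iff: "x \<in> infinitesimals \<longleftrightarrow> (\<forall>k. \<bar>x\<bar> \<le> eps k)"
  unfolding infinitesimals_def by (simp del: of_nat_Suc) (metis Suc_pred' zero_less_Suc)

lemma eps_pos: "0 < (eps k :: 'a :: linordered_field)"
  by (simp del: of_nat_Suc)

lemma eps_mono: "k \<le> l \<Longrightarrow> (eps l :: 'a :: linordered_field) \<le> eps k"
  by (simp add: frac_le del: of_nat_Suc)

lemma eps_strict: "k < l \<Longrightarrow> (eps l :: 'a :: linordered_field) < eps k"
  by (simp add: frac_less2 del: of_nat_Suc)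

lemma infinitesimal_less: "x \<in> infinitesimals \<Longrightarrow> \<bar>x\<bar> < eps k"
  using eps_strict[of k "Suc k", where ?'a = 'a] unfolding infinitesimal_iff
  by (meson lessI le_less_trans)

lemma infinitesimal_le: "y \<in> infinitesimals \<Longrightarrow> \<bar>x\<bar> \<le> \<bar>y\<bar> \<Longrightarrow> x \<in> infinitesimals"
  unfolding infinitesimal_iff using order_trans by blast

lemma infinitesimal_uminus: "- x \<in> infinitesimals \<longleftrightarrow> x \<in> infinitesimals"
  by (simp add: infinitesimal_iff)

lemma infinitesimal_finite: "x \<in> infinitesimals \<Longrightarrow> x \<in> finite_elems"
  unfolding infinitesimal_iff finite_elems_def by (auto intro!: exI[of _ 1] dest: spec[of _ 0])

lemma finite_elems_le: "y \<in> finite_elems \<Longrightarrow> \<bar>x\<bar> \<le> \<bar>y\<bar> \<Longrightarrow> x \<in> finite_elems"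
  unfolding finite_elems_def using order_trans by blast

lemma finite_elems_between:
  assumes "x \<in> finite_elems" "y \<in> finite_elems" "x \<le> z" "z \<le> y"
  shows "z \<in> finite_elems"
proof (cases "z \<ge> 0")
  case True
  with assms show ?thesis by (intro finite_elems_le[OF assms(2)]) auto
next
  case False
  with assms show ?thesis by (intro finite_elems_le[OF assms(1)]) auto
qed

lemma st_of_rat: "st (of_rat q :: 'a :: linordered_field) = of_rat q"
  by (rule is_standard_part_of_rat[OF is_standard_part_st])

lemma st_add: "x \<in> finite_elems \<Longrightarrow> y \<in> finite_elems \<Longrightarrow> st (x + y) = st x + st y"
  using is_standard_part_st[where ?'a = 'a] by (simp add: is_standard_part_def)

lemma st_mono: "x \<in> finite_elems \<Longrightarrow> y \<in> finite_elems \<Longrightarrow> x \<le> y \<Longrightarrow> st x \<le> st y"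
  using is_standard_part_st[where ?'a = 'a] by (simp add: is_standard_part_def)

lemma st_eq_0_iff: "x \<in> finite_elems \<Longrightarrow> st x = 0 \<longleftrightarrow> x \<in> infinitesimals"
  using is_standard_part_st[where ?'a = 'a] unfolding is_standard_part_def by blast

lemma finite_elems_diff: "x \<in> finite_elems \<Longrightarrow> y \<in> finite_elems \<Longrightarrow> x - y \<in> finite_elems"
  using finite_elems_add[of x "- y"] finite_elems_uminus[of y] by simp

lemma st_eq_iff:
  assumes "x \<in> finite_elems" "y \<in> finite_elems"
  shows "st x = st y \<longleftrightarrow> x - y \<in> infinitesimals"
  using st_add[of "x - y" y] finite_elems_diff[OF assms] assms st_eq_0_iff[of "x - y"] by auto

lemma finite_elems_near:
  assumes "x \<in> finite_elems" "y - x \<in> infinitesimals"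
  shows "y \<in> finite_elems" "st y = st x"
proof -
  show "y \<in> finite_elems"
    using finite_elems_add[OF assms(1) infinitesimal_finite[OF assms(2)]] by simp
  with assms show "st y = st x" by (simp add: st_eq_iff)
qed

text \<open>The rationals need not be dense in the field, so a bounded \<open>x\<close> and a gap of
  standard size are required. On the grid of mesh \<open>d\<close>, a quarter of the gap, starting
  at \<open>- N\<close>, the first point above \<open>x\<close> and its successor still lie below
  \<open>y\<close>.\<close>

lemma rational_interval_between:
  fixes x y :: "'a :: linordered_field"
  assumes x: "\<bar>x\<bar> \<le> of_nat N" and xy: "x + eps k \<le> y"
  obtains p q :: rat where "p < q" "x < of_rat p" "of_rat q < y"
proof -
  define d :: rat where "d = 1 / of_nat (4 * Suc k)"
  have d0: "d > 0" by (simp add: d_def del: of_nat_Suc of_nat_mult)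
  have d: "4 * of_rat d = (eps k :: 'a)"
  proof -
    have "4 * d = 1 / of_nat (Suc k)"
      unfolding d_def of_nat_mult by (simp del: of_nat_Suc)
    then have "of_rat (4 * d) = (of_rat (1 / of_nat (Suc k)) :: 'a)" by simp
    then show ?thesis by (simp add: of_rat_mult of_rat_divide of_rat_add)
  qed
  define c where "c j = - of_nat N + of_nat j * d" for j :: nat
  have ex: "\<exists>j. x < of_rat (c j)"
  proof -
    obtain j :: nat where "(2 * of_nat N + 1) / d < of_nat j" using reals_Archimedean2 by blast
    then have "2 * of_nat N + 1 < of_nat j * d" using d0 by (simp add: field_simps)
    then have "of_nat N < c j" by (simp add: c_def)
    then have "of_rat (of_nat N) < (of_rat (c j) :: 'a)" by (simp only: of_rat_less)
    then have "x < of_rat (c j)" using x by simp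
    then show ?thesis ..
  qed
  define j where "j = (LEAST j. x < of_rat (c j))"
  have j: "x < of_rat (c j)" unfolding j_def using ex by (rule LeastI_ex)
  have cj: "(of_rat (c j) :: 'a) \<le> x + of_rat d"
  proof (cases j)
    case 0
    have "- of_nat N \<le> x" using x by (simp add: abs_le_iff minus_le_iff)
    moreover have "of_rat d \<ge> (0 :: 'a)" using d0 by simp
    ultimately have "- of_nat N \<le> x + of_rat d" by (rule add_increasing2[rotated])
    moreover have "of_rat (c j) = (- of_nat N :: 'a)" unfolding 0 c_def by (simp add: of_rat_minus)
    ultimately show ?thesis by simp
  next
    case (Suc i)
    then have "i < (LEAST j. x < of_rat (c j))" by (simp add: j_def)
    then have "\<not> x < of_rat (c i)" by (rule not_less_Least)
    moreover have "c j = c i + d" by (simp add: c_def Suc algebra_simps)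
    ultimately show ?thesis by (simp add: of_rat_add)
  qed
  have d1: "of_rat d > (0 :: 'a)" using d0 by simp
  have "of_rat (c j + d) = of_rat (c j) + (of_rat d :: 'a)" by (simp add: of_rat_add)
  then have "of_rat (c j + d) < y" using cj xy d d1 by linarith
  with j d0 show ?thesis by (intro that[of "c j" "c j + d"]) auto
qed

text \<open>The counterpart of \<open>st_set\<close> for cylinders: coordinates outside
  \<open>V\<close> are unconstrained, so the result is a cylinder over \<open>V\<close> as
  well.\<close>

definition st_pts :: "nat set \<Rightarrow> (nat \<Rightarrow> 'a :: linordered_field) set \<Rightarrow> (nat \<Rightarrow> real) set" where
  "st_pts V X = {p. \<exists>x\<in>X. \<forall>i\<in>V. x i \<in> finite_elems \<and> st (x i) = p i}"

text \<open>The definable substitute for \<open>near\<close>: with an infinitesimal \<open>d\<close>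
  it implies \<open>near\<close>, and \<open>near\<close> implies it with \<open>d = eps k\<close>
  for every \<open>k\<close>.\<close>

definition close :: "'a :: linordered_field \<Rightarrow> nat set \<Rightarrow> (nat \<Rightarrow> 'a) \<Rightarrow> (nat \<Rightarrow> 'a) \<Rightarrow> bool" where
  "close d I x y \<longleftrightarrow> (\<forall>i\<in>I. \<bar>x i - y i\<bar> < d)"

definition near :: "nat set \<Rightarrow> (nat \<Rightarrow> 'a :: linordered_field) \<Rightarrow> (nat \<Rightarrow> 'a) \<Rightarrow> bool" where
  "near I x y \<longleftrightarrow> (\<forall>i\<in>I. x i - y i \<in> infinitesimals)"

definition lifts :: "nat set \<Rightarrow> (nat \<Rightarrow> real) \<Rightarrow> (nat \<Rightarrow> 'a :: linordered_field) \<Rightarrow> bool" where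
  "lifts V p x \<longleftrightarrow> (\<forall>i\<in>V. x i \<in> finite_elems \<and> st (x i) = p i)"

lemma st_pts_iff: "p \<in> st_pts V X \<longleftrightarrow> (\<exists>x\<in>X. lifts V p x)"
  by (simp add: st_pts_def lifts_def)

lemma close_near: "close d I x y \<Longrightarrow> d \<in> infinitesimals \<Longrightarrow> near I x y"
  unfolding close_def near_def by (meson abs_ge_self infinitesimal_le less_imp_le order_trans)

lemma lifts_near:
  assumes "lifts V p x" shows "lifts V p y \<longleftrightarrow> near V x y"
  unfolding lifts_def near_def
proof (intro ball_cong refl)
  fix i assume "i \<in> V"
  with assms have x: "x i \<in> finite_elems" "st (x i) = p i" by (auto simp: lifts_def)
  show "y i \<in> finite_elems \<and> st (y i) = p i \<longleftrightarrow> x i - y i \<in> infinitesimals"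
  proof
    assume "y i \<in> finite_elems \<and> st (y i) = p i"
    then show "x i - y i \<in> infinitesimals" using st_eq_iff[of "x i" "y i"] x by simp
  next
    assume "x i - y i \<in> infinitesimals"
    then have "y i - x i \<in> infinitesimals" using infinitesimal_uminus[of "x i - y i"] by simp
    then show "y i \<in> finite_elems \<and> st (y i) = p i"
      using finite_elems_near[OF x(1), of "y i"] x(2) by simp
  qed
qed

lemma lifts_mono: "lifts V p x \<Longrightarrow> U \<subseteq> V \<Longrightarrow> lifts U p x"
  unfolding lifts_def by blast

lemma st_pts_mono: "X \<subseteq> Y \<Longrightarrow> st_pts V X \<subseteq> st_pts V Y"
  unfolding st_pts_def by blast

lemma st_pts_Un: "st_pts V (X \<union> Y) = st_pts V X \<union> st_pts V Y"
  unfolding st_pts_def by blast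

lemma st_pts_UN: "st_pts V (\<Union>i\<in>I. X i) = (\<Union>i\<in>I. st_pts V (X i))"
  unfolding st_pts_def by blast

section \<open>Consequences of saturation\<close>

locale saturated_o_minimal =
  fixes M :: "('f, 'r, 'a :: linordered_field) struct"
  assumes expands: "expands_ordered_field M"
    and o_min: "o_minimal M"
    and saturated: "saturated (cardSuc |UNIV :: nat set set| ) M"
begin

lemma dterm_add: "dterm M t \<Longrightarrow> dterm M u \<Longrightarrow> dterm M (\<lambda>e. t e + u e)"
  using expands by (intro names_fun_dterm2[where g = "(+)"]) (simp_all add: expands_ordered_field_def)

lemma dterm_mult: "dterm M t \<Longrightarrow> dterm M u \<Longrightarrow> dterm M (\<lambda>e. t e * u e)"
  using expands by (intro names_fun_dterm2[where g = "(*)"]) (simp_all add: expands_ordered_field_def)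

lemma dterm_diff: "dterm M t \<Longrightarrow> dterm M u \<Longrightarrow> dterm M (\<lambda>e. t e - u e)"
  using dterm_add[of t "\<lambda>e. - 1 * u e"] dterm_mult[OF dterm_const[of M "- 1"], of u] by simp

lemma dpred_less: "dterm M t \<Longrightarrow> dterm M u \<Longrightarrow> dpred M (\<lambda>e. t e < u e)"
  using expands by (intro names_rel_dpred2[where R = "(<)"]) (simp_all add: expands_ordered_field_def)

lemma dpred_le: "dterm M t \<Longrightarrow> dterm M u \<Longrightarrow> dpred M (\<lambda>e. t e \<le> u e)"
  unfolding not_less[symmetric] by (intro dpred_neg dpred_less)

lemma dpred_abs_less: "dterm M t \<Longrightarrow> dterm M u \<Longrightarrow> dpred M (\<lambda>e. \<bar>t e\<bar> < u e)"
proof -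
  assume tu: "dterm M t" "dterm M u"
  have "dpred M (\<lambda>e. t e < u e \<and> 0 - t e < u e)"
    by (intro dpred_conj dpred_less dterm_diff dterm_const tu)
  then show ?thesis by (simp add: abs_less_iff)
qed

lemma dpred_close:
  assumes "finite I" "dterm M d" "\<And>i. dterm M (\<lambda>e. x e i)" "\<And>i. dterm M (\<lambda>e. y e i)"
  shows "dpred M (\<lambda>e. close (d e) I (x e) (y e))"
  unfolding close_def by (intro dpred_ball dpred_abs_less dterm_diff assms)

lemmas d_intros = dpred_conj dpred_disj dpred_imp dpred_neg dpred_ball dpred_bex dpred_const
  dpred_ball_point dpred_bex_point dpred_ex dpred_all dpred_ex_point dpred_all_point
  dpred_less dpred_le dpred_abs_less dpred_eq dpred_mem dpred_close
  dterm_var dterm_const dterm_upd dterm_add dterm_diff dterm_mult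

text \<open>A family indexed by subsets of the naturals uses at most continuum many parameters,
  hence falls under the hypothesis on the successor cardinal. The injection \<open>f\<close>
  expresses this bound on the index type.\<close>

lemma saturation:
  fixes Q :: "'i \<Rightarrow> 'a \<Rightarrow> bool" and f :: "'i \<Rightarrow> nat set"
  assumes f: "inj f" and Q: "\<And>i. dpred M (\<lambda>e. Q i (e 0))"
    and fip: "\<And>F. finite F \<Longrightarrow> \<exists>a. \<forall>i\<in>F. Q i a"
  obtains a where "\<And>i. Q i a"
proof -
  have "\<exists>p c. form_of M p \<and> (\<forall>a. Q i a \<longleftrightarrow> sat M (c(0 := a)) p)" for i
  proof -
    obtain n where n: "\<And>N. N \<ge> n \<Longrightarrow>
      \<exists>p c. form_of M p \<and> (\<forall>e. Q i (e 0) \<longleftrightarrow> sat M (\<lambda>i. if i < N then e i else c i) p)"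
      using dpred_large[OF Q[of i]] by blast
    obtain p c where p: "form_of M p"
      and c: "\<And>e. Q i (e 0) \<longleftrightarrow> sat M (\<lambda>i. if i < Suc n then e i else c i) p"
      using n[of "Suc n"] by auto
    have "(\<lambda>i. if i < Suc n then ((\<lambda>_. 0)(0 := a)) i else c i) =
        (\<lambda>i. if i < Suc n then 0 else c i)(0 := a)" for a
      by auto
    then have "Q i a \<longleftrightarrow> sat M ((\<lambda>i. if i < Suc n then 0 else c i)(0 := a)) p" for a
      using c[of "(\<lambda>_. 0)(0 := a)"] by simp
    with p show ?thesis by blast
  qed
  then obtain p c where p: "\<And>i. form_of M (p i)"
    and c: "\<And>i a. Q i a \<longleftrightarrow> sat M ((c i)(0 := a)) (p i)" by metis
  define A where "A = (\<lambda>(i, k). c i k) ` UNIV"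
  define T where "T = range (\<lambda>i. (p i, c i))"
  \<comment> \<open>A pair is coded by one subset of the naturals: the tag \<open>0\<close> records
    \<open>k\<close>, the tag \<open>1\<close> the members of \<open>f i\<close>. Thus all the
    parameters of all the formulas number at most the continuum.\<close>
  define g where "g = (\<lambda>(i, k :: nat). insert (prod_encode (0, k)) ((\<lambda>m. prod_encode (1, m)) ` f i))"
  have "inj g"
  proof (rule injI)
    fix x y :: "'i \<times> nat" assume "g x = g y"
    obtain i k where x: "x = (i, k)" by fastforce
    obtain j l where y: "y = (j, l)" by fastforce
    have 1: "prod_encode (0, m) \<in> g (i, k) \<longleftrightarrow> m = k" for m i k by (auto simp: g_def)
    have 2: "prod_encode (1, m) \<in> g (i, k) \<longleftrightarrow> m \<in> f i" for m i k by (auto simp: g_def)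
    have "k = l" using 1[of k i k] 1[of k j l] \<open>g x = g y\<close> by (simp add: x y)
    moreover have "f i = f j" using 2[of _ i k] 2[of _ j l] \<open>g x = g y\<close> by (auto simp: x y)
    ultimately show "x = y" using f by (simp add: x y inj_eq)
  qed
  then have "|UNIV :: ('i \<times> nat) set| \<le>o |UNIV :: nat set set|"
    by (intro card_of_ordLeqI) auto
  then have "|A| \<le>o |UNIV :: nat set set|"
    unfolding A_def using card_of_image ordLeq_transitive by blast
  then have "|A| <o cardSuc |UNIV :: nat set set|"
    using cardSuc_greater[OF card_of_Card_order] ordLeq_ordLess_trans by blast
  moreover have "\<forall>\<phi>\<in>T. form_over M A \<phi>"
    using p by (auto simp: T_def form_over_def A_def)
  moreover have "\<exists>a. realizes M a T0" if "finite T0" "T0 \<subseteq> T" for T0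
  proof -
    obtain F where "finite F" "T0 = (\<lambda>i. (p i, c i)) ` F"
      using \<open>finite T0\<close> \<open>T0 \<subseteq> T\<close> unfolding T_def by (meson finite_subset_image)
    moreover obtain a where "\<forall>i\<in>F. Q i a" using fip[OF \<open>finite F\<close>] by blast
    ultimately have "realizes M a T0" by (auto simp: realizes_def c)
    then show ?thesis ..
  qed
  ultimately have "\<exists>a. realizes M a T"
    by (intro saturated[unfolded saturated_def, THEN spec, THEN spec, THEN mp, of A T] conjI) simp_all
  then obtain a where "realizes M a T" ..
  then show ?thesis by (intro that[of a]) (auto simp: realizes_def T_def c)
qed

text \<open>Finitely many of the conditions \<open>0 < d \<le> eps l\<close> and
  \<open>Q l d\<close> hold at \<open>eps k\<close> for the largest index \<open>k\<close> involved.
  Saturation realizes all of them together, and then \<open>d\<close> is below every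
  \<open>eps l\<close>.\<close>

lemma overspill:
  fixes Q :: "nat \<Rightarrow> 'a \<Rightarrow> bool"
  assumes "\<And>l. dpred M (\<lambda>e. Q l (e 0))" and Q: "\<And>l k. Q l (eps k)"
  obtains d where "d > 0" "d \<in> infinitesimals" "\<And>l. Q l d"
proof -
  obtain d where d: "\<And>l. 0 < d \<and> d \<le> eps l \<and> Q l d"
  proof (rule saturation[where f = "\<lambda>l. {l}" and Q = "\<lambda>l d. 0 < d \<and> d \<le> eps l \<and> Q l d"])
    show "inj (\<lambda>l :: nat. {l})" by (simp add: inj_def)
    show "dpred M (\<lambda>e. 0 < e 0 \<and> e 0 \<le> eps l \<and> Q l (e 0))" for l
      by (intro d_intros assms)
    show "\<exists>a. \<forall>l\<in>F. 0 < a \<and> a \<le> eps l \<and> Q l a" if "finite F" for F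
    proof (intro exI[of _ "eps (Max (insert 0 F))"] ballI conjI Q eps_pos eps_mono)
      fix l assume "l \<in> F"
      then show "l \<le> Max (insert 0 F)" using that by simp
    qed
  qed blast
  then have "\<bar>d\<bar> \<le> eps l" for l by (metis abs_of_pos)
  with d show ?thesis by (intro that[of d]) (auto simp: infinitesimal_iff)
qed

lemma overspill1:
  assumes "dpred M (\<lambda>e. Q (e 0))" and "\<And>k. Q (eps k)"
  obtains d where "d > 0" "d \<in> infinitesimals" "Q d"
  using overspill[of "\<lambda>_. Q"] assms by blast

text \<open>The Dedekind cuts of all the coordinates, coded as one set of naturals; this makes real
  sequences an admissible index type for \<open>saturation\<close>.\<close>

definition code_pt :: "(nat \<Rightarrow> real) \<Rightarrow> nat set" where
  "code_pt p = {prod_encode (n, to_nat q) | n q. real_of_rat q < p n}"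

lemma inj_code_pt: "inj code_pt"
proof (rule injI, rule ext, rule ccontr)
  fix p p' n assume eq: "code_pt p = code_pt p'" and "p n \<noteq> p' n"
  have mem: "prod_encode (n, to_nat q) \<in> code_pt p \<longleftrightarrow> real_of_rat q < p n" for q p
    by (auto simp: code_pt_def)
  from \<open>p n \<noteq> p' n\<close> consider "p n < p' n" | "p' n < p n" by linarith
  then show False
  proof cases
    case 1
    then obtain q where "p n < of_rat q" "of_rat q < p' n" using of_rat_dense by blast
    with mem[of q p] mem[of q p'] eq show False by simp
  next
    case 2
    then obtain q where "p' n < of_rat q" "of_rat q < p n" using of_rat_dense by blast
    with mem[of q p] mem[of q p'] eq show False by simp
  qed
qed

text \<open>This is where saturation beyond the continuum enters.\<close>

lemma infinitesimal_bound:
  fixes e :: "(nat \<Rightarrow> real) \<Rightarrow> nat \<Rightarrow> 'a"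
  assumes e: "\<And>p k. e p k \<in> infinitesimals"
  obtains d where "d > 0" "d \<in> infinitesimals" "\<And>p k. \<bar>e p k\<bar> < d"
proof -
  \<comment> \<open>The index \<open>k\<close> has two roles: it selects the coordinate of
    \<open>e\<close> to be dominated, and it supplies the bound \<open>eps k\<close> that keeps
    \<open>d\<close> infinitesimal.\<close>
  define Q where "Q = (\<lambda>(p, k) d. \<bar>e p k\<bar> < d \<and> 0 < d \<and> d \<le> eps k)"
  define f where "f = (\<lambda>(p, k). code_pt (case_nat (real k) p))"
  obtain d where d: "\<And>i. Q i d"
  proof (rule saturation[where f = f and Q = Q])
    show "inj f"
    proof (rule injI, clarify)
      fix p p' :: "nat \<Rightarrow> real" and k k' assume "f (p, k) = f (p', k')"
      then have *: "case_nat (real k) p = case_nat (real k') p'"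
        using inj_code_pt by (auto simp: f_def inj_eq)
      from fun_cong[OF this, of 0] have "k = k'" by simp
      moreover have "p i = p' i" for i using fun_cong[OF *, of "Suc i"] by simp
      ultimately show "p = p' \<and> k = k'" by auto
    qed
    show "dpred M (\<lambda>e. Q i (e 0))" for i
      unfolding Q_def by (cases i) (simp only: prod.case, intro d_intros)
    show "\<exists>a. \<forall>i\<in>F. Q i a" if "finite F" for F
    proof (intro exI[of _ "eps (Max (insert 0 (snd ` F)))"] ballI)
      fix i assume i: "i \<in> F"
      obtain p k where pk: "i = (p, k)" by fastforce
      have "k \<in> insert 0 (snd ` F)" using i pk by force
      then have "k \<le> Max (insert 0 (snd ` F))" using that by (intro Max_ge) auto
      then show "Q i (eps (Max (insert 0 (snd ` F))))"
        using infinitesimal_less[OF e] unfolding Q_def pk prod.case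
        by (intro conjI eps_pos eps_mono) blast+
    qed
  qed blast
  have d': "\<bar>e p k\<bar> < d \<and> 0 < d \<and> d \<le> eps k" for p k using d[of "(p, k)"] by (simp add: Q_def)
  then have "\<bar>d\<bar> \<le> eps k" for k by (metis abs_of_pos)
  with d' show ?thesis by (intro that[of d]) (auto simp: infinitesimal_iff)
qed

text \<open>Saturation concerns types in one variable; this extends it to points. A value
  \<open>a\<close> of one coordinate that occurs in every \<open>X k\<close> is realized and fixed,
  and the slices are treated by induction on \<open>I\<close>.\<close>

lemma decreasing_nonempty:
  fixes X :: "nat \<Rightarrow> (nat \<Rightarrow> 'a) set"
  assumes "finite I" "\<And>k. dset M (X k)" "\<And>k. depends I (X k)"
    "\<And>k. X (Suc k) \<subseteq> X k" "\<And>k. X k \<noteq> {}"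
  obtains x where "\<And>k. x \<in> X k"
proof -
  have "\<exists>x. \<forall>k. x \<in> X k" using assms
  proof (induction I arbitrary: X rule: finite_induct)
    case empty
    have "x \<in> X k" for x k using empty.prems(2)[of k] empty.prems(4)[of k]
      by (auto simp: depends_def)
    then show ?case by blast
  next
    case (insert v I)
    have anti: "X l \<subseteq> X k" if "k \<le> l" for k l
      using lift_Suc_antimono_le[of X k l] insert.prems(3) that by blast
    obtain a where a: "\<And>k. \<exists>x\<in>X k. x v = a"
    proof (rule saturation[where f = "\<lambda>l. {l}" and Q = "\<lambda>k a. \<exists>x\<in>X k. x v = a"])
      show "inj (\<lambda>l :: nat. {l})" by (simp add: inj_def)
      show "dpred M (\<lambda>e. \<exists>x\<in>X k. x v = e 0)" for k
        by (intro d_intros insert.prems)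
      show "\<exists>a. \<forall>k\<in>F. \<exists>x\<in>X k. x v = a" if "finite F" for F
      proof -
        obtain x where "x \<in> X (Max (insert 0 F))" using insert.prems(4) by blast
        then have "x \<in> X k" if "k \<in> F" for k
          using anti[of k "Max (insert 0 F)"] that \<open>finite F\<close> by auto
        then show ?thesis by blast
      qed
    qed blast
    have "\<exists>x. \<forall>k. x \<in> {x. x(v := a) \<in> X k}"
    proof (rule insert.IH)
      show "dset M {x. x(v := a) \<in> X k}" for k
        unfolding dset_Collect by (intro d_intros insert.prems)
      show "depends I {x. x(v := a) \<in> X k}" for k
        unfolding depends_def mem_Collect_eq
        by (intro allI impI dependsD[OF insert.prems(2)]) auto
      show "{x. x(v := a) \<in> X (Suc k)} \<subseteq> {x. x(v := a) \<in> X k}" for k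
        using insert.prems(3) by blast
      show "{x. x(v := a) \<in> X k} \<noteq> {}" for k
      proof -
        obtain x where "x \<in> X k" "x v = a" using a[of k] by blast
        then have "x(v := a) \<in> X k" by (metis fun_upd_triv)
        then show ?thesis by blast
      qed
    qed
    then show ?case by blast
  qed
  then show ?thesis using that by blast
qed

text \<open>Surjectivity of the standard part map: \<open>a\<close> realizes the Dedekind cut of
  \<open>r\<close>, whose finite parts have rational solutions.\<close>

lemma ex_st:
  obtains s :: "real \<Rightarrow> 'a" where "\<And>r. s r \<in> finite_elems" "\<And>r. st (s r) = r"
proof -
  have "\<exists>a :: 'a. a \<in> finite_elems \<and> st a = r" for r
  proof -
    define Q where "Q q a \<longleftrightarrow> (real_of_rat q < r \<longrightarrow> of_rat q \<le> a) \<and> (r < real_of_rat q \<longrightarrow> a \<le> of_rat q)"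
      for q and a :: 'a
    obtain a where a: "\<And>q. Q q a"
    proof (rule saturation[where f = "\<lambda>q. {to_nat q}" and Q = Q])
      show "inj (\<lambda>q :: rat. {to_nat q})" by (simp add: inj_def)
      show "dpred M (\<lambda>e. Q q (e 0))" for q unfolding Q_def by (intro d_intros)
      show "\<exists>a. \<forall>q\<in>F. Q q a" if "finite F" for F
      proof -
        have "\<exists>b. \<forall>q\<in>F. (real_of_rat q < r \<longrightarrow> q \<le> b) \<and> (r < real_of_rat q \<longrightarrow> b \<le> q)"
          using that
        proof (induction F rule: finite_induct)
          case (insert q F)
          then obtain b where b: "\<forall>q\<in>F. (real_of_rat q < r \<longrightarrow> q \<le> b) \<and> (r < real_of_rat q \<longrightarrow> b \<le> q)"
            by blast
          have lt: "p \<le> q" if "real_of_rat p < r" "r < real_of_rat q" for p q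
          proof -
            have "real_of_rat p < of_rat q" using that by linarith
            then show ?thesis by (simp add: of_rat_less)
          qed
          consider "real_of_rat q < r" | "r < real_of_rat q" | "real_of_rat q = r" by linarith
          then show ?case
          proof cases
            case 1
            with b lt show ?thesis by (intro exI[of _ "max b q"]) (auto simp: le_max_iff_disj)
          next
            case 2
            with b lt show ?thesis by (intro exI[of _ "min b q"]) (auto simp: min_le_iff_disj)
          next
            case 3
            with b show ?thesis by (intro exI[of _ b]) auto
          qed
        qed simp
        then obtain b where "\<forall>q\<in>F. Q q (of_rat b)" by (auto simp: Q_def of_rat_less_eq)
        then show ?thesis by blast
      qed
    qed blast
    obtain p where p: "r - 1 < of_rat p" "of_rat p < r" using of_rat_dense[of "r - 1" r] by auto
    obtain q where q: "r < of_rat q" "of_rat q < r + 1" using of_rat_dense[of r "r + 1"] by auto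
    have fin: "a \<in> finite_elems"
      by (rule finite_elems_between[OF finite_elems_of_rat[of p] finite_elems_of_rat[of q]])
        (use a p q in \<open>auto simp: Q_def\<close>)
    have "r = st a"
    proof (rule real_eq_by_rat)
      fix q
      show "of_rat q \<le> st a" if "of_rat q < r"
        using st_mono[OF finite_elems_of_rat[of q] fin] a[of q] that by (simp add: st_of_rat Q_def)
      show "st a \<le> of_rat q" if "r < of_rat q"
        using st_mono[OF fin finite_elems_of_rat[of q]] a[of q] that by (simp add: st_of_rat Q_def)
    qed
    with fin show ?thesis by blast
  qed
  then show ?thesis using that by metis
qed

end

lemma depends_Diff:
  assumes "depends I X" "depends I Y" shows "depends I (X - Y)"
  unfolding depends_def Diff_iff
  by (intro allI impI conj_cong arg_cong[of _ _ Not] dependsD[OF assms(1)] dependsD[OF assms(2)]) auto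

lemma depends_Int:
  assumes "depends I X" "depends I Y" shows "depends I (X \<inter> Y)"
  unfolding depends_def Int_iff
  by (intro allI impI conj_cong dependsD[OF assms(1)] dependsD[OF assms(2)]) auto

lemma depends_Un:
  assumes "depends I X" "depends I Y" shows "depends I (X \<union> Y)"
  unfolding depends_def Un_iff
  by (intro allI impI disj_cong dependsD[OF assms(1)] dependsD[OF assms(2)]) auto

lemma depends_UN:
  assumes "\<And>j. j \<in> J \<Longrightarrow> depends I (X j)" shows "depends I (\<Union>j\<in>J. X j)"
  unfolding depends_def UN_iff
  by (intro allI impI bex_cong refl dependsD[OF assms]) auto

section \<open>Definable subsets of the line\<close>

lemma point_or_open_interval_convex:
  assumes "point_or_open_interval I" "x \<in> I" "z \<in> I" "x \<le> y" "y \<le> z"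
  shows "y \<in> I"
  using assms unfolding point_or_open_interval_def
  by (elim disjE exE) (auto intro: le_less_trans less_le_trans)

text \<open>The boundary of \<open>A\<close> in the order topology, in a first-order form that gives
  a definable set when \<open>A\<close> is definable.\<close>

definition bd :: "'a :: linorder set \<Rightarrow> 'a \<Rightarrow> bool" where
  "bd A b \<longleftrightarrow> (\<forall>c d. c < b \<and> b < d \<longrightarrow> (\<exists>z. c < z \<and> z < d \<and> z \<in> A) \<and> (\<exists>z. c < z \<and> z < d \<and> z \<notin> A))"

lemma bd_Un: "bd (A \<union> B) b \<Longrightarrow> bd A b \<or> bd B b"
proof (rule ccontr)
  assume AB: "bd (A \<union> B) b" and "\<not> (bd A b \<or> bd B b)"
  then obtain c d c' d' where cd: "c < b" "b < d" "c' < b" "b < d'"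
    and A: "(\<forall>z. c < z \<and> z < d \<longrightarrow> z \<notin> A) \<or> (\<forall>z. c < z \<and> z < d \<longrightarrow> z \<in> A)"
    and B: "(\<forall>z. c' < z \<and> z < d' \<longrightarrow> z \<notin> B) \<or> (\<forall>z. c' < z \<and> z < d' \<longrightarrow> z \<in> B)"
    unfolding bd_def by blast
  have "max c c' < b" "b < min d d'" using cd by auto
  then have "(\<exists>z. max c c' < z \<and> z < min d d' \<and> z \<in> A \<union> B)"
    "(\<exists>z. max c c' < z \<and> z < min d d' \<and> z \<notin> A \<union> B)"
    using AB unfolding bd_def by blast+
  with A B show False by (auto 4 4)
qed

lemma bd_piece_finite:
  fixes I :: "'a :: linordered_field set"
  assumes "point_or_open_interval I"
  shows "finite {b. bd I b}"
proof -
  have lt: "\<not> bd I b" if "\<And>z. c < z \<Longrightarrow> z < d \<Longrightarrow> z \<notin> I" "c < b" "b < d" for b c d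
    using that unfolding bd_def by blast
  have gt: "\<not> bd I b" if "\<And>z. c < z \<Longrightarrow> z < d \<Longrightarrow> z \<in> I" "c < b" "b < d" for b c d
    using that unfolding bd_def by blast
  have sub: "\<exists>E. finite E \<and> {b. bd I b} \<subseteq> E"
    using assms unfolding point_or_open_interval_def
  proof (elim disjE exE)
    fix a assume I: "I = {a}"
    have "\<not> bd I b" if "b \<noteq> a" for b
      using that lt[of "b - 1" a b] lt[of a "b + 1" b] I by (cases "b < a") auto
    then show ?thesis by (intro exI[of _ "{a}"]) auto
  next
    fix a c assume I: "I = {a<..<c}"
    have "\<not> bd I b" if ne: "b \<noteq> a" "b \<noteq> c" for b
    proof -
      consider "b < a" | "c < b" | "a < b" "b < c" using ne less_linear[of b a] less_linear[of b c] by blast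
      then show ?thesis
        by cases (use lt[of "b - 1" a b] lt[of c "b + 1" b] gt[of a c b] I in auto)
    qed
    then show ?thesis by (intro exI[of _ "{a, c}"]) auto
  next
    fix a assume I: "I = {a<..}"
    have "\<not> bd I b" if "b \<noteq> a" for b
      using that lt[of "b - 1" a b] gt[of a "b + 1" b] I by (cases "b < a") auto
    then show ?thesis by (intro exI[of _ "{a}"]) auto
  next
    fix a assume I: "I = {..<a}"
    have "\<not> bd I b" if "b \<noteq> a" for b
      using that gt[of "b - 1" a b] lt[of a "b + 1" b] I by (cases "b < a") auto
    then show ?thesis by (intro exI[of _ "{a}"]) auto
  next
    assume I: "I = UNIV"
    have "\<not> bd I b" for b using gt[of "b - 1" "b + 1" b] I by auto
    then show ?thesis by (intro exI[of _ "{}"]) auto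
  qed
  then show ?thesis using finite_subset by blast
qed

lemma bd_finite_pieces:
  fixes F :: "'a :: linordered_field set set"
  assumes "finite F" "\<forall>I\<in>F. point_or_open_interval I"
  shows "finite {b. bd (\<Union>F) b}"
  using assms
proof (induction F rule: finite_induct)
  case empty
  have "\<not> bd {} b" for b :: 'a unfolding bd_def using lt_ex gt_ex by blast
  then show ?case by simp
next
  case (insert I F)
  have "{b. bd (\<Union>(insert I F)) b} \<subseteq> {b. bd I b} \<union> {b. bd (\<Union>F) b}"
    using bd_Un by auto
  then show ?case using insert bd_piece_finite by (meson finite_Un finite_subset insertCI)
qed

text \<open>Bounded subsets of the field need not have least upper bounds. Finite unions of points
  and intervals have them when nonempty and bounded above, hence so do definable sets.\<close>

definition has_sup :: "'a :: linorder set \<Rightarrow> bool" where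
  "has_sup A \<longleftrightarrow> (\<exists>b. (\<forall>x\<in>A. x \<le> b) \<and> (\<forall>c<b. \<exists>x\<in>A. c < x))"

lemma has_sup_Un:
  assumes "A = {} \<or> has_sup A" "B = {} \<or> has_sup B"
  shows "A \<union> B = {} \<or> has_sup (A \<union> B)"
proof (cases "A = {} \<or> B = {}")
  case True
  then show ?thesis using assms by auto
next
  case False
  with assms obtain a b where a: "\<forall>x\<in>A. x \<le> a" "\<forall>c<a. \<exists>x\<in>A. c < x"
    and b: "\<forall>x\<in>B. x \<le> b" "\<forall>c<b. \<exists>x\<in>B. c < x"
    unfolding has_sup_def by blast
  have "(\<forall>x\<in>A \<union> B. x \<le> max a b) \<and> (\<forall>c<max a b. \<exists>x\<in>A \<union> B. c < x)"
    using a b by (auto simp: le_max_iff_disj less_max_iff_disj)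
  then show ?thesis unfolding has_sup_def by blast
qed

lemma has_sup_piece:
  fixes I :: "'a :: linordered_field set"
  assumes "point_or_open_interval I" "\<forall>x\<in>I. x \<le> u"
  shows "I = {} \<or> has_sup I"
  using assms(1) unfolding point_or_open_interval_def
proof (elim disjE exE)
  fix a assume "I = {a}"
  then show ?thesis unfolding has_sup_def by auto
next
  fix a b assume I: "I = {a<..<b}"
  have "\<exists>x\<in>I. c < x" if "c < b" "a < b" for c
  proof -
    obtain x where "max a c < x" "x < b" using dense[of "max a c" b] \<open>a < b\<close> \<open>c < b\<close> by auto
    then show ?thesis using I by auto
  qed
  then show ?thesis unfolding has_sup_def by (cases "a < b") (use I in \<open>auto intro!: exI[of _ b]\<close>)
next
  fix a assume "I = {a<..}"
  then have "max a u + 1 \<in> I" by (simp add: less_max_iff_disj add_strict_increasing2 max_def)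
  with assms(2) have "max a u + 1 \<le> u" by blast
  then show ?thesis by (simp add: max_def split: if_splits)
next
  fix b assume I: "I = {..<b}"
  have "\<exists>x\<in>I. c < x" if "c < b" for c using dense[OF that] I by auto
  then show ?thesis unfolding has_sup_def using I by (auto intro!: exI[of _ b])
next
  assume "I = UNIV"
  with assms(2) have "u + 1 \<le> u" by blast
  then show ?thesis by simp
qed

lemma has_sup_pieces:
  fixes F :: "'a :: linordered_field set set"
  assumes "finite F" "\<forall>I\<in>F. point_or_open_interval I" "\<forall>x\<in>\<Union>F. x \<le> u"
  shows "\<Union>F = {} \<or> has_sup (\<Union>F)"
  using assms
proof (induction F rule: finite_induct)
  case (insert I F)
  have "I = {} \<or> has_sup I" by (rule has_sup_piece) (use insert.prems in auto)
  then have "I \<union> \<Union>F = {} \<or> has_sup (I \<union> \<Union>F)"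
    by (rule has_sup_Un) (use insert in auto)
  then show ?case by simp
qed simp

lemma st_less:
  assumes "x \<in> finite_elems" "y \<in> finite_elems" "st x < st y"
  shows "x < y"
  using st_mono[OF assms(2,1)] assms(3) by (meson not_le)

text \<open>Counts solutions of \<open>P\<close> below \<open>y\<close> by a recursion that is a
  first-order formula for each fixed \<open>n\<close>; this makes the \<open>j\<close>-th boundary
  point of a fibre definable.\<close>

primrec at_least :: "nat \<Rightarrow> ('b :: linorder \<Rightarrow> bool) \<Rightarrow> 'b \<Rightarrow> bool" where
  "at_least 0 P y \<longleftrightarrow> True"
| "at_least (Suc n) P y \<longleftrightarrow> (\<exists>b<y. P b \<and> at_least n P b)"

lemma at_least_mono: "at_least n P y \<Longrightarrow> y < z \<Longrightarrow> at_least n P z"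
  by (cases n) (auto intro: less_trans)

lemma at_least_Suc: "at_least (Suc n) P y \<Longrightarrow> at_least n P y"
  using at_least_mono by auto

lemma at_least_card:
  assumes "finite {b. P b}" "at_least n P y"
  shows "n \<le> card {b. P b \<and> b < y}"
  using assms(2)
proof (induction n arbitrary: y)
  case (Suc n)
  then obtain b where b: "b < y" "P b" "at_least n P b" by auto
  have "Suc (card {c. P c \<and> c < b}) = card (insert b {c. P c \<and> c < b})"
    using assms(1) by (subst card_insert_disjoint) auto
  also have "\<dots> \<le> card {c. P c \<and> c < y}"
    using assms(1) b by (intro card_mono) auto
  finally show ?case using Suc.IH[OF b(3)] by simp
qed simp

section \<open>Boxes with rational corners\<close>

definition rbox :: "nat set \<Rightarrow> (nat \<Rightarrow> rat) \<Rightarrow> (nat \<Rightarrow> rat) \<Rightarrow> (nat \<Rightarrow> 'a :: linordered_field) set" where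
  "rbox I a b = {x. \<forall>i\<in>I. of_rat (a i) < x i \<and> x i < of_rat (b i)}"

text \<open>The dichotomy that replaces dimension: a cylinder over \<open>I\<close> that contains no box with
  rational corners counts as small.\<close>

definition has_box :: "nat set \<Rightarrow> (nat \<Rightarrow> 'a :: linordered_field) set \<Rightarrow> bool" where
  "has_box I X \<longleftrightarrow> (\<exists>a b. (\<forall>i\<in>I. a i < b i) \<and> rbox I a b \<subseteq> X)"

lemma has_boxI: "(\<And>i. i \<in> I \<Longrightarrow> a i < b i) \<Longrightarrow> rbox I a b \<subseteq> X \<Longrightarrow> has_box I X"
  unfolding has_box_def by blast

lemma has_box_mono: "has_box I X \<Longrightarrow> X \<subseteq> Y \<Longrightarrow> has_box I Y"
  unfolding has_box_def by blast

lemma has_box_IntE: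
  assumes "has_box I (X \<inter> Y)"
  obtains a b where "\<forall>i\<in>I. a i < b i" "rbox I a b \<subseteq> Y" "rbox I a b \<subseteq> X"
  using assms unfolding has_box_def le_inf_iff by blast

lemma rbox_nonempty:
  assumes "\<forall>i\<in>I. a i < b i" shows "rbox I a b \<noteq> ({} :: (nat \<Rightarrow> 'a :: linordered_field) set)"
proof -
  have "of_rat (a i) < (of_rat ((a i + b i) / 2) :: 'a) \<and> (of_rat ((a i + b i) / 2) :: 'a) < of_rat (b i)"
    if "i \<in> I" for i
  proof -
    have "a i < b i" using assms that by blast
    then show ?thesis unfolding of_rat_less by (simp add: field_simps)
  qed
  then have "(\<lambda>i. of_rat ((a i + b i) / 2) :: 'a) \<in> rbox I a b" by (auto simp: rbox_def)
  then show ?thesis by blast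
qed

lemma has_box_nonempty: "has_box I X \<Longrightarrow> X \<noteq> {}"
  using rbox_nonempty unfolding has_box_def by fastforce

lemma depends_rbox: "depends I (rbox I a b)"
  by (auto simp: depends_def rbox_def)

lemma rbox_cong: "(\<And>i. i \<in> I \<Longrightarrow> a i = a' i \<and> b i = b' i) \<Longrightarrow> rbox I a b = rbox I a' b'"
  by (auto simp: rbox_def)

definition rat_pt :: "rat list \<Rightarrow> nat \<Rightarrow> rat" where
  "rat_pt l i = (if i < length l then l ! i else 0)"

lemma ex_rat_pt: "finite I \<Longrightarrow> \<exists>l. \<forall>i\<in>I. rat_pt l i = a i"
proof -
  assume "finite I"
  then obtain n where "\<forall>i\<in>I. i < n" using finite_nat_set_iff_bounded by blast
  then show ?thesis by (intro exI[of _ "map a [0..<n]"]) (auto simp: rat_pt_def)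
qed

text \<open>Enumerates the rational boxes, up to their values on a finite set of coordinates.
  Statements about all boxes become the countable families that \<open>overspill\<close> and
  \<open>cover_of_dense\<close> accept.\<close>

definition nat_box :: "nat \<Rightarrow> (nat \<Rightarrow> rat) \<times> (nat \<Rightarrow> rat)" where
  "nat_box n = map_prod rat_pt rat_pt (from_nat n)"

lemma ex_nat_box:
  assumes "finite I" obtains n where "\<And>i. i \<in> I \<Longrightarrow> fst (nat_box n) i = a i \<and> snd (nat_box n) i = b i"
proof -
  obtain l where l: "\<forall>i\<in>I. rat_pt l i = a i" using ex_rat_pt[OF assms] by blast
  obtain l' where l': "\<forall>i\<in>I. rat_pt l' i = b i" using ex_rat_pt[OF assms] by blast
  show ?thesis using l l' by (intro that[of "to_nat (l, l')"]) (auto simp: nat_box_def)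
qed

lemma ex_eps_le: "0 < q \<Longrightarrow> \<exists>k. (eps k :: 'a :: linordered_field) \<le> of_rat q"
proof -
  assume q: "0 < q"
  obtain k where "inverse (of_nat (Suc k)) < q" using reals_Archimedean[OF q] by blast
  then have "of_rat (inverse (of_nat (Suc k))) \<le> (of_rat q :: 'a)" by (simp add: of_rat_less_eq del: of_nat_Suc)
  then show ?thesis by (intro exI[of _ k]) (simp add: of_rat_divide of_rat_add inverse_eq_divide)
qed

lemma finite_elems_bound: "x \<in> finite_elems \<Longrightarrow> \<exists>N. \<bar>x\<bar> \<le> of_nat N"
  by (simp add: finite_elems_def)

lemma close_cong:
  assumes "\<And>i. i \<in> I \<Longrightarrow> x i = x' i" "\<And>i. i \<in> I \<Longrightarrow> y i = y' i"
  shows "close d I x y \<longleftrightarrow> close d I x' y'"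
  using assms by (simp add: close_def)

lemma near_close: "near I x y \<Longrightarrow> close (eps k) I x y"
  unfolding near_def close_def using infinitesimal_less by blast

section \<open>Boundary points and intervals of definable subsets of the line\<close>

context saturated_o_minimal
begin

lemma dset_rbox: "finite I \<Longrightarrow> dset M (rbox I a b)"
  unfolding rbox_def dset_Collect by (intro d_intros)

lemma pieces:
  assumes "dpred M (\<lambda>e. e 0 \<in> A)"
  obtains F where "finite F" "\<forall>I\<in>F. point_or_open_interval I" "A = \<Union>F"
proof -
  let ?S = "{map x [0..<1] | x. x \<in> {x. x 0 \<in> A}}"
  have "definable M 1 ?S"
    by (rule dset_definable) (use assms in \<open>auto simp: dset_Collect depends_def\<close>)
  then have "\<exists>F. finite F \<and> (\<forall>I\<in>F. point_or_open_interval I) \<and> {a. [a] \<in> ?S} = \<Union>F"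
    by (rule o_min[unfolded o_minimal_def, THEN spec, THEN mp])
  then obtain F where F: "finite F" "\<forall>I\<in>F. point_or_open_interval I" "{a. [a] \<in> ?S} = \<Union>F"
    by blast
  have "{a. [a] \<in> ?S} = A"
    by (auto intro!: exI[of _ "\<lambda>_. _"])
  with F show ?thesis by (intro that[of F]) auto
qed

lemma finite_bd:
  assumes "dpred M (\<lambda>e. e 0 \<in> A)" shows "finite {b. bd A b}"
proof -
  obtain F where "finite F" "\<forall>I\<in>F. point_or_open_interval I" "A = \<Union>F"
    using pieces[OF assms] by blast
  then show ?thesis using bd_finite_pieces by simp
qed

lemma dpred_bd:
  assumes "dpred M (\<lambda>e. R (e 0) (\<lambda>i. e (Suc i)))"
  shows "dpred M (\<lambda>e. bd {z. R z (\<lambda>i. e (Suc i))} (e 0))"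
proof -
  have R: "dpred M (\<lambda>e. R (e 0) (\<lambda>i. e (s i)))" for s
    using dpred_rename[OF assms, of "case_nat 0 s"] by simp
  show ?thesis unfolding bd_def mem_Collect_eq
    by (intro dpred_all dpred_imp dpred_conj dpred_ex dpred_neg dpred_less dterm_var R)
qed

lemma dpred_at_least:
  assumes "dpred M (\<lambda>e. P (e 0) (\<lambda>i. e (Suc i)))"
  shows "dpred M (\<lambda>e. at_least n (\<lambda>b. P b (\<lambda>i. e (Suc i))) (e 0))"
proof (induction n)
  case 0
  show ?case by (simp add: dpred_const)
next
  case (Suc n)
  have 1: "dpred M (\<lambda>e. P (e 0) (\<lambda>i. e (Suc (Suc i))))"
    using dpred_rename[OF assms, of "case_nat 0 (\<lambda>i. Suc (Suc i))"] by simp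
  have 2: "dpred M (\<lambda>e. at_least n (\<lambda>b. P b (\<lambda>i. e (Suc (Suc i)))) (e 0))"
    using dpred_rename[OF Suc, of "case_nat 0 (\<lambda>i. Suc (Suc i))"] by simp
  show ?case unfolding at_least.simps
    by (intro dpred_ex dpred_conj dpred_less dterm_var 1 2)
qed

text \<open>Definable connectedness: the boundary point is the supremum of \<open>L\<close>, the
  part of the segment from \<open>y\<close> to \<open>z\<close> up to which \<open>A\<close> is not
  left; the supremum exists by o-minimality.\<close>

lemma bd_between:
  assumes A: "dpred M (\<lambda>e. e 0 \<in> A)" and "y \<in> A" "z \<notin> A" "y < z"
  obtains b where "y \<le> b" "b \<le> z" "bd A b"
proof -
  define L where "L = {u. y \<le> u \<and> u \<le> z \<and> (\<forall>w. y \<le> w \<and> w \<le> u \<longrightarrow> w \<in> A)}"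
  have "dpred M (\<lambda>e. e 0 \<in> L)"
    unfolding L_def mem_Collect_eq by (intro d_intros A)
  then obtain F where F: "finite F" "\<forall>I\<in>F. point_or_open_interval I" "L = \<Union>F"
    using pieces by blast
  have "\<forall>x\<in>L. x \<le> z" by (simp add: L_def)
  then have "L = {} \<or> has_sup L" using has_sup_pieces F by blast
  moreover have yL: "y \<in> L" using assms by (auto simp: L_def)
  ultimately obtain b where b: "\<forall>x\<in>L. x \<le> b" "\<forall>c<b. \<exists>x\<in>L. c < x"
    unfolding has_sup_def by blast
  have yb: "y \<le> b" using b yL by blast
  have bz: "b \<le> z"
  proof (rule ccontr)
    assume "\<not> b \<le> z"
    then obtain x where "x \<in> L" "z < x" using b by (meson not_le)
    then show False by (simp add: L_def)
  qed
  have below: "w \<in> A" if w: "y \<le> w" "w < b" for w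
  proof -
    obtain x where "x \<in> L" "w < x" using b(2) w(2) by blast
    then show ?thesis using w by (simp add: L_def)
  qed
  have "bd A b" unfolding bd_def
  proof (intro allI impI)
    fix c d assume cd: "c < b \<and> b < d"
    have "\<exists>w. c < w \<and> w < d \<and> w \<in> A"
    proof -
      obtain x where "x \<in> L" "c < x" using b cd by blast
      then have "x \<le> b" using b by blast
      then show ?thesis using \<open>x \<in> L\<close> \<open>c < x\<close> cd by (auto simp: L_def intro!: exI[of _ x])
    qed
    moreover have "\<exists>w. c < w \<and> w < d \<and> w \<notin> A"
    proof (rule ccontr)
      assume "\<not> (\<exists>w. c < w \<and> w < d \<and> w \<notin> A)"
      then have all: "w \<in> A" if "c < w" "w < d" for w using that by blast
      have "b \<noteq> z" using all[of z] cd \<open>z \<notin> A\<close> by blast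
      then have "b < min d z" using bz cd by simp
      then obtain u where u: "b < u" "u < min d z" using dense by blast
      have "w \<in> A" if "y \<le> w" "w \<le> u" for w
      proof (cases "w < b")
        case True
        then show ?thesis using below that by blast
      next
        case False
        then show ?thesis using all[of w] that u cd by auto
      qed
      then have "u \<in> L" using u yb by (auto simp: L_def)
      then show False using b u by (meson not_le)
    qed
    ultimately show "(\<exists>w. c < w \<and> w < d \<and> w \<in> A) \<and> (\<exists>w. c < w \<and> w < d \<and> w \<notin> A)" ..
  qed
  then show ?thesis using that yb bz by blast
qed

text \<open>By the pigeonhole principle two of the infinitely many rationals, \<open>r < r'\<close>,
  have nearby points of \<open>A\<close> in the same piece. Convexity puts everything between those
  points into the piece, in particular the middle third of the interval from \<open>r\<close> to
  \<open>r'\<close>; the outer thirds absorb the infinitesimal displacement.\<close>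

lemma dense_interval:
  assumes A: "dpred M (\<lambda>e. e 0 \<in> A)" and "p < q"
    and dense: "\<And>x. of_rat p < x \<Longrightarrow> x < of_rat q \<Longrightarrow> \<exists>y\<in>A. x - y \<in> infinitesimals"
  obtains p' q' where "p \<le> p'" "p' < q'" "q' \<le> q" "\<And>x. of_rat p' < x \<Longrightarrow> x < of_rat q' \<Longrightarrow> x \<in> A"
proof -
  obtain F where F: "finite F" "\<forall>I\<in>F. point_or_open_interval I" "A = \<Union>F"
    using pieces[OF A] by blast
  have "\<exists>y I. I \<in> F \<and> y \<in> I \<and> of_rat r - y \<in> infinitesimals" if "r \<in> {p<..<q}" for r
    using dense[of "of_rat r"] that F(3) by (auto simp: of_rat_less)
  then obtain y I where yI: "\<And>r. r \<in> {p<..<q} \<Longrightarrow> I r \<in> F \<and> y r \<in> I r \<and> of_rat r - y r \<in> infinitesimals"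
    by metis
  have "\<not> inj_on I {p<..<q}"
  proof
    assume "inj_on I {p<..<q}"
    moreover have "I ` {p<..<q} \<subseteq> F" using yI by blast
    ultimately show False
      using infinite_Ioo[OF \<open>p < q\<close>] F(1) finite_imageD finite_subset by blast
  qed
  then obtain r r' where r: "r \<in> {p<..<q}" "r' \<in> {p<..<q}" "r < r'" "I r = I r'"
    unfolding inj_on_def by (metis linorder_less_linear)
  have fin: "y t \<in> finite_elems \<and> st (y t) = of_rat t" if "t \<in> {p<..<q}" for t
    using finite_elems_near[OF finite_elems_of_rat, of "y t" t] yI[OF that]
      infinitesimal_uminus[of "of_rat t - y t"] by (simp add: st_of_rat)
  define p' where "p' = (2 * r + r') / 3"
  define q' where "q' = (r + 2 * r') / 3"
  have pq: "r < p'" "p' < q'" "q' < r'" using r(3) by (auto simp: p'_def q'_def field_simps)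
  show ?thesis
  proof (rule that[of p' q'])
    show "p \<le> p'" "p' < q'" "q' \<le> q" using pq r by auto
    fix x :: 'a assume x: "of_rat p' < x" "x < of_rat q'"
    have "y r < of_rat p'"
      by (rule st_less) (use fin[OF r(1)] pq in \<open>auto simp: finite_elems_of_rat st_of_rat of_rat_less\<close>)
    moreover have "of_rat q' < y r'"
      by (rule st_less) (use fin[OF r(2)] pq in \<open>auto simp: finite_elems_of_rat st_of_rat of_rat_less\<close>)
    ultimately have "y r \<le> x" "x \<le> y r'" using x by auto
    then have "x \<in> I r"
      using point_or_open_interval_convex[of "I r" "y r" "y r'" x] F(2) yI[OF r(1)] yI[OF r(2)] r(4)
      by auto
    then show "x \<in> A" using F(3) yI r(1) by blast
  qed
qed

section \<open>Infinitesimally dense definable sets contain boxes\<close>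

text \<open>Named as a property of \<open>I\<close> because the covering lemma for \<open>I\<close>
  follows from it and is used in the induction step to one more coordinate.\<close>

definition dense_prop :: "nat set \<Rightarrow> bool" where
  "dense_prop I \<longleftrightarrow> (\<forall>D a b. dset M D \<longrightarrow> depends I D \<longrightarrow> (\<forall>i\<in>I. a i < b i) \<longrightarrow>
     (\<forall>x\<in>rbox I a b. \<exists>y\<in>D. near I x y) \<longrightarrow> has_box I (D \<inter> rbox I a b))"

lemma near_overspill:
  assumes D: "dset M D" and I: "finite I" and x: "\<And>k. \<exists>y\<in>D. close (eps k) I x y"
  shows "\<exists>y\<in>D. near I x y"
proof -
  obtain d where "d > 0" "d \<in> infinitesimals" "\<exists>y\<in>D. close d I x y"
    by (rule overspill1[of "\<lambda>d. \<exists>y\<in>D. close d I x y"]) (intro d_intros D I, rule x)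
  then show ?thesis using close_near by blast
qed

text \<open>A Baire category argument. If no \<open>T j\<close> contained a box inside the given
  one, then each \<open>T n\<close> would fail to be infinitesimally dense in every rational subbox,
  so boxes could be shrunk to avoid \<open>T 0\<close>, \<open>T 1\<close> and so on; saturation
  would then give a point outside the whole cover.\<close>

lemma cover_of_dense:
  assumes dense: "dense_prop I" and I: "finite I"
    and T: "\<And>j :: nat. dset M (T j)" "\<And>j. depends I (T j)"
    and ab: "\<forall>i\<in>I. a i < b i" and cover: "rbox I a b \<subseteq> (\<Union>j. T j)"
  shows "\<exists>j. has_box I (T j \<inter> rbox I a b)"
proof (rule ccontr)
  assume none: "\<not> (\<exists>j. has_box I (T j \<inter> rbox I a b))"
  have avoid: "has_box I (rbox I a b - (\<Union>j<n. T j))" for n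
  proof (induction n)
    case 0
    show ?case using ab by (intro has_boxI[of I a b]) auto
  next
    case (Suc n)
    then obtain a' b' where ab': "\<forall>i\<in>I. a' i < b' i" and sub: "rbox I a' b' \<subseteq> rbox I a b - (\<Union>j<n. T j)"
      unfolding has_box_def by blast
    have "\<not> has_box I (T n \<inter> rbox I a' b')"
      using none has_box_mono[of I "T n \<inter> rbox I a' b'" "T n \<inter> rbox I a b"] sub by blast
    then obtain x where x: "x \<in> rbox I a' b'" "\<not> (\<exists>y\<in>T n. near I x y)"
      using dense T ab' unfolding dense_prop_def by blast
    then obtain k where k: "\<not> (\<exists>y\<in>T n. close (eps k) I x y)"
      using near_overspill[OF T(1) I] by blast
    \<comment> \<open>The point \<open>x\<close> may be infinitely close to a face of the box, so a
      subinterval is sought in the intersection of the box with the \<open>eps k\<close>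
      neighbourhood of \<open>x\<close>, not around \<open>x\<close> itself.\<close>
    have "\<exists>p q. p < q \<and> max (of_rat (a' i)) (x i - eps k) < of_rat p \<and>
        of_rat q < min (of_rat (b' i)) (x i + eps k)" if i: "i \<in> I" for i
    proof -
      have lt: "of_rat (a' i) < x i" "x i < of_rat (b' i)" using x i by (auto simp: rbox_def)
      obtain m where m: "(eps m :: 'a) \<le> of_rat (b' i - a' i)"
        using ex_eps_le[of "b' i - a' i"] ab' i by auto
      \<comment> \<open>\<open>eps K\<close> is a lower bound for the length of that intersection,
        being at most the side of the box and at most \<open>eps k\<close>.\<close>
      define K where "K = max m k"
      have K: "(eps K :: 'a) \<le> eps m" "(eps K :: 'a) \<le> eps k"
        by (intro eps_mono; simp add: K_def)+
      have K0: "(eps k :: 'a) > 0" by (rule eps_pos)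
      have fin: "x i \<in> finite_elems"
        by (rule finite_elems_between[OF finite_elems_of_rat[of "a' i"] finite_elems_of_rat[of "b' i"]])
          (use lt in auto)
      have efin: "(eps k :: 'a) \<in> finite_elems"
        using finite_elems_of_rat[of "1 / of_nat (Suc k)", where ?'a = 'a]
        by (simp add: of_rat_divide of_rat_add)
      have "max (of_rat (a' i)) (x i - eps k) \<in> finite_elems"
        using finite_elems_of_rat[of "a' i"] finite_elems_diff[OF fin efin] by (auto simp: max_def)
      then obtain N where N: "\<bar>max (of_rat (a' i)) (x i - eps k)\<bar> \<le> of_nat N"
        using finite_elems_bound by blast
      have "max (of_rat (a' i)) (x i - eps k) + eps K \<le> min (of_rat (b' i)) (x i + eps k)"
      proof -
        have "eps K \<le> of_rat (b' i) - (of_rat (a' i) :: 'a)"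
          using K(1) m unfolding of_rat_diff by (rule order_trans)
        then have "of_rat (a' i) + eps K \<le> (of_rat (b' i) :: 'a)" by (simp only: le_diff_eq add.commute)
        moreover have "of_rat (a' i) + eps K \<le> x i + eps k" using lt K by (intro add_mono) auto
        moreover have "x i - eps k + eps K \<le> of_rat (b' i)"
        proof -
          have "x i - eps k + eps K \<le> x i" using K by (simp add: algebra_simps)
          then show ?thesis using lt by simp
        qed
        moreover have "x i - eps k + eps K \<le> x i + eps k"
        proof -
          have "x i - eps k + eps K \<le> x i" using K by (simp add: algebra_simps)
          then show ?thesis using K0 by (meson less_imp_le order_trans less_add_same_cancel1)
        qed
        ultimately show ?thesis by (simp add: max_def min_def)
      qed
      from rational_interval_between[OF N this] show ?thesis by metis
    qed
    then obtain p q where pq: "\<And>i. i \<in> I \<Longrightarrow> p i < q i \<and> max (of_rat (a' i)) (x i - eps k) < of_rat (p i) \<and>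
        of_rat (q i) < min (of_rat (b' i)) (x i + eps k)" by metis
    have "y \<in> rbox I a' b' \<and> close (eps k) I x y" if y: "y \<in> rbox I p q" for y
    proof -
      have "of_rat (a' i) < y i \<and> y i < of_rat (b' i) \<and> \<bar>x i - y i\<bar> < eps k" if "i \<in> I" for i
      proof -
        have "of_rat (p i) < y i" "y i < of_rat (q i)" using y that by (auto simp: rbox_def)
        moreover have "of_rat (a' i) < (of_rat (p i) :: 'a)" "x i - eps k < of_rat (p i)"
          "of_rat (q i) < (of_rat (b' i) :: 'a)" "of_rat (q i) < x i + eps k"
          using pq[OF that] by simp_all
        ultimately show ?thesis
          by (auto simp: abs_less_iff algebra_simps intro: less_trans)
      qed
      then show ?thesis by (auto simp: rbox_def close_def)
    qed
    then have "rbox I p q \<subseteq> rbox I a b - (\<Union>j<Suc n. T j)"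
      using sub k by (fastforce simp: less_Suc_eq)
    then show ?case using pq by (intro has_boxI[of I p q]) auto
  qed
  obtain x where x: "\<And>n. x \<in> rbox I a b - (\<Union>j<n. T j)"
  proof (rule decreasing_nonempty[of I "\<lambda>n. rbox I a b - (\<Union>j<n. T j)"])
    show "dset M (rbox I a b - (\<Union>j<n. T j))" for n
      by (intro dset_Diff dset_rbox dset_UN I T) simp
    show "depends I (rbox I a b - (\<Union>j<n. T j))" for n
      by (intro depends_Diff depends_UN depends_rbox T)
    show "rbox I a b - (\<Union>j<Suc n. T j) \<subseteq> rbox I a b - (\<Union>j<n. T j)" for n
      by (auto simp: less_Suc_eq)
    show "rbox I a b - (\<Union>j<n. T j) \<noteq> {}" for n by (rule has_box_nonempty[OF avoid])
  qed (rule I, rule that)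
  obtain j where "x \<in> T j" using x[of 0] cover by blast
  then show False using x[of "Suc j"] by blast
qed

lemma dense_singleton: "dense_prop {v}"
  unfolding dense_prop_def
proof (intro allI impI)
  fix D :: "(nat \<Rightarrow> 'a) set" and a b
  assume D: "dset M D" "depends {v} D" and ab: "\<forall>i\<in>{v}. a i < b i"
    and dense: "\<forall>x\<in>rbox {v} a b. \<exists>y\<in>D. near {v} x y"
  define A where "A = {z. (\<lambda>_. 0)(v := z) \<in> D}"
  have DA: "x \<in> D \<longleftrightarrow> x v \<in> A" for x
    using dependsD[OF D(2), of x "(\<lambda>_. 0)(v := x v)"] by (simp add: A_def)
  obtain p q where pq: "a v \<le> p" "p < q" "q \<le> b v"
    "\<And>x. of_rat p < x \<Longrightarrow> x < of_rat q \<Longrightarrow> x \<in> A"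
  proof (rule dense_interval[of A "a v" "b v"])
    show "dpred M (\<lambda>e. e 0 \<in> A)" unfolding A_def mem_Collect_eq by (intro d_intros D)
    show "a v < b v" using ab by simp
    fix x :: 'a assume "of_rat (a v) < x" "x < of_rat (b v)"
    then have "(\<lambda>_. x) \<in> rbox {v} a b" by (simp add: rbox_def)
    then show "\<exists>y\<in>A. x - y \<in> infinitesimals"
      using dense DA by (fastforce simp: near_def)
  qed blast
  show "has_box {v} (D \<inter> rbox {v} a b)"
  proof (rule has_boxI[of _ "\<lambda>_. p" "\<lambda>_. q"])
    have "of_rat (a v) < x \<and> x < of_rat (b v)" if "of_rat p < x" "x < of_rat q" for x :: 'a
      using that pq(1,3) by (meson le_less_trans less_le_trans of_rat_less_eq)
    then show "rbox {v} (\<lambda>_. p) (\<lambda>_. q) \<subseteq> D \<inter> rbox {v} a b"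
      using pq(4) by (auto simp: DA rbox_def)
  qed (use pq in auto)
qed

text \<open>A Fubini argument in both directions. Fibres along \<open>v\<close> of a thickening of
  \<open>D\<close> contain rational intervals, and a countable cover fixes one interval over a whole
  box. The slices of \<open>D\<close> at heights in this interval are then dense in the box, and a
  second cover, along \<open>v\<close>, fixes one box contained in all slices over a
  subinterval.\<close>

lemma dense_insert:
  assumes I: "finite I" and "v \<notin> I" and dense: "dense_prop I"
  shows "dense_prop (insert v I)"
  unfolding dense_prop_def
proof (intro allI impI)
  let ?V = "insert v I"
  fix D :: "(nat \<Rightarrow> 'a) set" and a b
  assume D: "dset M D" "depends ?V D" and ab: "\<forall>i\<in>?V. a i < b i"
    and near: "\<forall>x\<in>rbox ?V a b. \<exists>y\<in>D. near ?V x y"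
  have V: "finite ?V" using I by simp
  \<comment> \<open>Density is made uniform and definable: a single infinitesimal \<open>n\<close>
    replaces \<open>near\<close> for all points of the box.\<close>
  obtain n where n: "n \<in> infinitesimals" "\<forall>x\<in>rbox ?V a b. \<exists>y\<in>D. close n ?V x y"
  proof (rule overspill1[of "\<lambda>d. \<forall>x\<in>rbox ?V a b. \<exists>y\<in>D. close d ?V x y"])
    show "dpred M (\<lambda>e. \<forall>x\<in>rbox ?V a b. \<exists>y\<in>D. close (e 0) ?V x y)"
      by (intro d_intros D V dset_rbox)
    show "\<forall>x\<in>rbox ?V a b. \<exists>y\<in>D. close (eps k) ?V x y" for k
      using near near_close by blast
  qed blast
  \<comment> \<open>The fibre over \<open>x\<close> of \<open>D\<close>, thickened only in the
    directions of \<open>I\<close>; the coordinate \<open>v\<close> stays exact.\<close>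
  define A where "A x z \<longleftrightarrow> (\<exists>d\<in>D. close n I x d \<and> d v = z)" for x z
  have A_cong: "A x z \<longleftrightarrow> A y z" if "\<And>i. i \<in> I \<Longrightarrow> x i = y i" for x y z
    unfolding A_def using close_cong[of I x y] that by blast
  define T where "T j = (let (c :: rat, d :: rat) = from_nat j in {x. a v \<le> c \<and> c < d \<and> d \<le> b v \<and>
    (\<forall>z. of_rat c < z \<and> z < of_rat d \<longrightarrow> A x z)})" for j
  have "\<exists>j. has_box I (T j \<inter> rbox I a b)"
  proof (rule cover_of_dense[OF dense I])
    fix j
    show "dset M (T j)"
      unfolding T_def Let_def A_def by (cases "from_nat j :: rat \<times> rat")
        (simp only: prod.case dset_Collect, intro d_intros D I)
    show "depends I (T j)" unfolding depends_def T_def Let_def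
      by (cases "from_nat j :: rat \<times> rat") (simp, metis A_cong)
  next
    show "\<forall>i\<in>I. a i < b i" using ab by simp
    show "rbox I a b \<subseteq> (\<Union>j. T j)"
    proof
      fix x :: "nat \<Rightarrow> 'a" assume x: "x \<in> rbox I a b"
      obtain p q where pq: "a v \<le> p" "p < q" "q \<le> b v"
        "\<And>z. of_rat p < z \<Longrightarrow> z < of_rat q \<Longrightarrow> z \<in> Collect (A x)"
      proof (rule dense_interval[of "Collect (A x)" "a v" "b v"])
        show "dpred M (\<lambda>e. e 0 \<in> Collect (A x))"
          unfolding A_def mem_Collect_eq by (intro d_intros D I)
        show "a v < b v" using ab by simp
        fix z :: 'a assume z: "of_rat (a v) < z" "z < of_rat (b v)"
        have "x(v := z) \<in> rbox ?V a b" using x z \<open>v \<notin> I\<close> by (auto simp: rbox_def)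
        then obtain y where y: "y \<in> D" "close n ?V (x(v := z)) y" using n(2) by blast
        then have "A x (y v)" using \<open>v \<notin> I\<close> unfolding A_def
          by (intro bexI[of _ y]) (auto simp: close_def split: if_splits)
        moreover have "z - y v \<in> infinitesimals"
          using close_near[OF y(2) n(1)] by (simp add: near_def)
        ultimately show "\<exists>y\<in>Collect (A x). z - y \<in> infinitesimals" by blast
      qed blast
      then have "x \<in> T (to_nat (p, q))" by (simp add: T_def)
      then show "x \<in> (\<Union>j. T j)" by blast
    qed
  qed
  then obtain j where "has_box I (T j \<inter> rbox I a b)" ..
  then obtain a' b' where ab': "\<forall>i\<in>I. a' i < b' i" "rbox I a' b' \<subseteq> (rbox I a b :: (nat \<Rightarrow> 'a) set)"
    and Tj: "rbox I a' b' \<subseteq> T j"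
    by (rule has_box_IntE)
  obtain c d :: rat where cd: "from_nat j = (c, d)" by (rule prod.exhaust)
  from Tj have T: "rbox I a' b' \<subseteq> {x. a v \<le> c \<and> c < d \<and> d \<le> b v \<and>
      (\<forall>z. of_rat c < z \<and> z < of_rat d \<longrightarrow> A x z)}"
    by (simp add: T_def cd)
  have c: "a v \<le> c" "c < d" "d \<le> b v"
    using T rbox_nonempty[OF ab'(1), where ?'a = 'a] by blast+
  \<comment> \<open>Exactness along \<open>v\<close> gives a point of \<open>D\<close> at height
    \<open>z\<close> itself and near \<open>x\<close> over \<open>I\<close>, which is density of the
    slice of \<open>D\<close>, no longer of its thickening.\<close>
  have slice: "has_box I ({x. x(v := z) \<in> D} \<inter> rbox I a' b')" if z: "of_rat c < z" "z < of_rat d" for z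
  proof -
    have "dset M {x. x(v := z) \<in> D}" unfolding dset_Collect by (intro d_intros D)
    moreover have "depends I {x. x(v := z) \<in> D}" unfolding depends_def mem_Collect_eq
      by (intro allI impI dependsD[OF D(2)]) auto
    moreover have "\<exists>y\<in>{x. x(v := z) \<in> D}. near I x y" if "x \<in> rbox I a' b'" for x
    proof -
      have "A x z" using T that z by blast
      then obtain y where "y \<in> D" "close n I x y" "y v = z" unfolding A_def by blast
      then show ?thesis using close_near[OF _ n(1)] by (intro bexI[of _ y]) auto
    qed
    ultimately show ?thesis using dense ab'(1) unfolding dense_prop_def by blast
  qed
  \<comment> \<open>The heights at which the slice of \<open>D\<close> contains the
    \<open>l\<close>-th rational box; this is a cylinder over \<open>v\<close> alone.\<close>
  define T' where "T' l = (let (e, f) = nat_box l in {x. (\<forall>i\<in>I. e i < f i) \<and>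
    rbox I e f \<subseteq> (rbox I a' b' :: (nat \<Rightarrow> 'a) set) \<and> (\<forall>u\<in>rbox I e f. u(v := x v) \<in> D)})" for l
  have "\<exists>l. has_box {v} (T' l \<inter> rbox {v} (\<lambda>_. c) (\<lambda>_. d))"
  proof (rule cover_of_dense[OF dense_singleton])
    fix l
    show "dset M (T' l)"
      unfolding T'_def Let_def by (cases "nat_box l")
        (simp only: prod.case dset_Collect, intro d_intros D I dset_rbox)
    show "depends {v} (T' l)" unfolding depends_def T'_def Let_def
      by (cases "nat_box l") simp
  next
    show "rbox {v} (\<lambda>_. c) (\<lambda>_. d) \<subseteq> (\<Union>l. T' l)"
    proof
      fix x :: "nat \<Rightarrow> 'a" assume "x \<in> rbox {v} (\<lambda>_. c) (\<lambda>_. d)"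
      then have "has_box I ({u. u(v := x v) \<in> D} \<inter> rbox I a' b')"
        by (intro slice) (auto simp: rbox_def)
      then obtain e f where ef: "\<forall>i\<in>I. e i < f i" "rbox I e f \<subseteq> {u. u(v := x v) \<in> D} \<inter> rbox I a' b'"
        unfolding has_box_def by blast
      obtain l where l: "\<And>i. i \<in> I \<Longrightarrow> fst (nat_box l) i = e i \<and> snd (nat_box l) i = f i"
        using ex_nat_box[OF I] by blast
      have "rbox I (fst (nat_box l)) (snd (nat_box l)) = (rbox I e f :: (nat \<Rightarrow> 'a) set)"
        by (rule rbox_cong) (use l in auto)
      then have "x \<in> T' l" using ef l unfolding T'_def by (auto simp: case_prod_unfold)
      then show "x \<in> (\<Union>l. T' l)" by blast
    qed
  qed (use c in auto)
  then obtain l where "has_box {v} (T' l \<inter> rbox {v} (\<lambda>_. c) (\<lambda>_. d))" ..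
  then obtain g h where gh: "g v < h v"
    and sub: "rbox {v} g h \<subseteq> T' l \<inter> rbox {v} (\<lambda>_. c) (\<lambda>_. d)"
    unfolding has_box_def by auto
  obtain e f where ef: "nat_box l = (e, f)" by (rule prod.exhaust)
  have T'_iff: "x \<in> T' l \<longleftrightarrow> (\<forall>i\<in>I. e i < f i) \<and> rbox I e f \<subseteq> (rbox I a' b' :: (nat \<Rightarrow> 'a) set) \<and>
    (\<forall>u\<in>rbox I e f. u(v := x v) \<in> D)" for x
    by (simp add: T'_def ef)
  have "rbox {v} g h \<noteq> ({} :: (nat \<Rightarrow> 'a) set)" by (rule rbox_nonempty) (use gh in simp)
  then have ef': "\<forall>i\<in>I. e i < f i" "rbox I e f \<subseteq> (rbox I a' b' :: (nat \<Rightarrow> 'a) set)"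
    using sub T'_iff by blast+
  show "has_box ?V (D \<inter> rbox ?V a b)"
  proof (rule has_boxI[of _ "e(v := g v)" "f(v := h v)"])
    fix i assume "i \<in> ?V"
    then show "(e(v := g v)) i < (f(v := h v)) i" using gh ef' by auto
  next
    show "rbox ?V (e(v := g v)) (f(v := h v)) \<subseteq> D \<inter> rbox ?V a b"
    proof
      fix x :: "nat \<Rightarrow> 'a" assume x: "x \<in> rbox ?V (e(v := g v)) (f(v := h v))"
      then have xI: "x \<in> rbox I e f" using \<open>v \<notin> I\<close> by (auto simp: rbox_def split: if_splits)
      have xv: "x \<in> rbox {v} g h" using x by (simp add: rbox_def)
      then have "x(v := x v) \<in> D" using sub T'_iff xI by blast
      moreover have "x \<in> rbox {v} (\<lambda>_. c) (\<lambda>_. d)" using sub xv by blast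
      then have "of_rat (a v) < x v \<and> x v < of_rat (b v)"
        using c by (auto simp: rbox_def) (meson le_less_trans less_le_trans of_rat_less_eq)+
      moreover have "x \<in> rbox I a b" using xI ef' ab' by blast
      ultimately show "x \<in> D \<inter> rbox ?V a b" by (auto simp: rbox_def)
    qed
  qed
qed

lemma dense_prop_finite: "finite I \<Longrightarrow> dense_prop I"
proof (induction I rule: finite_induct)
  case empty
  show ?case unfolding dense_prop_def
  proof (intro allI impI)
    fix D :: "(nat \<Rightarrow> 'a) set" and a b :: "nat \<Rightarrow> rat"
    assume "depends {} D" "\<forall>x\<in>rbox {} a b. \<exists>y\<in>D. near {} x y"
    then have "D = UNIV" unfolding depends_def rbox_def by blast
    then show "has_box {} (D \<inter> rbox {} a b)" by (intro has_boxI[of _ a b]) auto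
  qed
next
  case (insert v I)
  then show ?case using dense_insert by blast
qed

lemma dense_box:
  assumes "finite I" "dset M D" "depends I D" "\<forall>i\<in>I. a i < b i"
    "\<And>x. x \<in> rbox I a b \<Longrightarrow> \<exists>y\<in>D. near I x y"
  shows "has_box I (D \<inter> rbox I a b)"
  using dense_prop_finite[OF assms(1)] assms(2-) unfolding dense_prop_def by blast

lemmas cover_box = cover_of_dense[OF dense_prop_finite]

text \<open>The covering lemma with only two distinct members of the cover; it makes the small sets
  closed under finite unions.\<close>

lemma has_box_Un:
  assumes "finite I" "dset M X" "depends I X" "dset M Y" "depends I Y" "has_box I (X \<union> Y)"
  shows "has_box I X \<or> has_box I Y"
proof -
  obtain a b where ab: "\<forall>i\<in>I. a i < b i" "rbox I a b \<subseteq> X \<union> Y"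
    using assms(6) unfolding has_box_def by blast
  have "\<exists>j :: nat. has_box I ((if j = 0 then X else Y) \<inter> rbox I a b)"
    by (rule cover_box[where T = "\<lambda>j. if j = 0 then X else Y"]) (use assms ab in \<open>auto split: if_splits\<close>)
  then show ?thesis using has_box_mono by (auto split: if_splits)
qed

section \<open>Sheets over a coordinate subspace\<close>

abbreviation cyl :: "nat set \<Rightarrow> (nat \<Rightarrow> 'a) set \<Rightarrow> bool" where
  "cyl V X \<equiv> dset M X \<and> depends V X"

text \<open>A fixed section of the standard part map, which provides a common base point for sheets
  in different directions.\<close>

definition lift :: "real \<Rightarrow> 'a" where
  "lift r = (SOME a. a \<in> finite_elems \<and> st a = r)"

lemma lift: "lift r \<in> finite_elems" "st (lift r) = r"
proof -
  have "\<exists>a :: 'a. a \<in> finite_elems \<and> st a = r" using ex_st by metis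
  from someI_ex[OF this] show "lift r \<in> finite_elems" "st (lift r) = r"
    by (simp_all add: lift_def)
qed

lemma lifts_lift: "lifts V p (\<lambda>i. lift (p i))"
  by (simp add: lifts_def lift)

text \<open>Two lifts of the same real point differ by infinitesimals that depend on the point.
  Dominating continuum many infinitesimals makes the bound uniform, so that \<open>close d\<close>
  can stand for \<open>near\<close> inside a definition.\<close>

lemma lifts_close_bound:
  assumes "\<And>p. P p \<Longrightarrow> lifts V p (x p :: nat \<Rightarrow> 'a) \<and> lifts V p (y p)"
  obtains d where "d > 0" "d \<in> infinitesimals" "\<And>p. P p \<Longrightarrow> close d V (x p) (y p)"
proof -
  define e where "e p k = (if P p \<and> k \<in> V then x p k - y p k else 0)" for p k
  have "e p k \<in> infinitesimals" for p k
    using assms[of p] lifts_near[of V p "x p" "y p"]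
    by (auto simp: e_def near_def infinitesimal_iff simp del: of_nat_Suc)
  then obtain d where d: "d > 0" "d \<in> infinitesimals" "\<And>p k. \<bar>e p k\<bar> < d"
    using infinitesimal_bound by blast
  have "close d V (x p) (y p)" if "P p" for p
    unfolding close_def
  proof
    fix k assume "k \<in> V"
    then show "\<bar>x p k - y p k\<bar> < d" using d(3)[of p k] that by (simp add: e_def)
  qed
  with d show ?thesis using that by blast
qed

text \<open>Points of \<open>X\<close> and \<open>Y\<close> with equal standard parts need not
  coincide. Thickening \<open>Y\<close> by a uniform infinitesimal catches all such pairs in one
  definable set.\<close>

lemma st_pts_Int:
  assumes V: "finite V" and X: "cyl V X" and Y: "cyl V Y"
  obtains d where "d > 0" "d \<in> infinitesimals" "cyl V {x \<in> X. \<exists>y\<in>Y. close d V x y}"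
    "st_pts V X \<inter> st_pts V Y = st_pts V {x \<in> X. \<exists>y\<in>Y. close d V x y}"
proof -
  let ?W = "st_pts V X \<inter> st_pts V Y"
  have "\<exists>x y. p \<in> ?W \<longrightarrow> x \<in> X \<and> y \<in> Y \<and> lifts V p x \<and> lifts V p y" for p
    by (auto simp: st_pts_iff)
  then obtain x y where xy: "\<And>p. p \<in> ?W \<Longrightarrow> x p \<in> X \<and> y p \<in> Y \<and> lifts V p (x p) \<and> lifts V p (y p)"
    by metis
  obtain d where d: "d > 0" "d \<in> infinitesimals" "\<And>p. p \<in> ?W \<Longrightarrow> close d V (x p) (y p)"
    using lifts_close_bound[of "\<lambda>p. p \<in> ?W" V x y] xy by blast
  let ?Z = "{x \<in> X. \<exists>y\<in>Y. close d V x y}"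
  have "dset M ?Z" unfolding dset_Collect using X Y by (intro d_intros V) auto
  moreover have "depends V ?Z" unfolding depends_def mem_Collect_eq
    by (intro allI impI conj_cong bex_cong refl dependsD[OF conjunct2[OF X]] close_cong) auto
  moreover have "?W = st_pts V ?Z"
  proof (intro equalityI subsetI)
    fix p assume "p \<in> ?W"
    then show "p \<in> st_pts V ?Z" using xy[of p] d(3)[of p] by (auto simp: st_pts_iff)
  next
    fix p assume "p \<in> st_pts V ?Z"
    then obtain x y where "x \<in> X" "y \<in> Y" "close d V x y" "lifts V p x"
      by (auto simp: st_pts_iff)
    moreover from this have "lifts V p y" using lifts_near close_near d(2) by blast
    ultimately show "p \<in> ?W" by (auto simp: st_pts_iff)
  qed
  ultimately show ?thesis using that[of d] d by blast
qed

text \<open>If the thickened intersection contained a box, \<open>Y\<close> would be infinitesimally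
  dense in it and so contain a smaller box, whose points also belong to \<open>X\<close>.\<close>

lemma st_pts_disjoint:
  assumes V: "finite V" and X: "cyl V X" and Y: "cyl V Y" and "X \<inter> Y = {}"
  obtains Z where "cyl V Z" "\<not> has_box V Z" "st_pts V X \<inter> st_pts V Y \<subseteq> st_pts V Z"
proof -
  obtain d where d: "d \<in> infinitesimals" "cyl V {x \<in> X. \<exists>y\<in>Y. close d V x y}"
    "st_pts V X \<inter> st_pts V Y = st_pts V {x \<in> X. \<exists>y\<in>Y. close d V x y}"
    using st_pts_Int[OF V X Y] by blast
  have "\<not> has_box V {x \<in> X. \<exists>y\<in>Y. close d V x y}"
  proof
    assume "has_box V {x \<in> X. \<exists>y\<in>Y. close d V x y}"
    then obtain a b where ab: "\<forall>i\<in>V. a i < b i" "rbox V a b \<subseteq> {x \<in> X. \<exists>y\<in>Y. close d V x y}"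
      unfolding has_box_def by blast
    have "has_box V (Y \<inter> rbox V a b)"
      by (rule dense_box) (use V Y ab close_near[OF _ d(1)] in blast)+
    then have "Y \<inter> rbox V a b \<noteq> {}" by (rule has_box_nonempty)
    then show False using ab \<open>X \<inter> Y = {}\<close> by blast
  qed
  with d show ?thesis using that by blast
qed

lemma has_box_UN:
  assumes I: "finite I" and "finite A" "\<And>a. a \<in> A \<Longrightarrow> cyl I (X a)" "\<And>a. a \<in> A \<Longrightarrow> \<not> has_box I (X a)"
  shows "cyl I (\<Union>a\<in>A. X a) \<and> \<not> has_box I (\<Union>a\<in>A. X a)"
  using assms(2-)
proof (induction A rule: finite_induct)
  case empty
  then show ?case using has_box_nonempty[of I "{}"] by (auto simp: dset_empty depends_def)
next
  case (insert a A)
  then have "cyl I (X a)" "\<not> has_box I (X a)" "cyl I (\<Union>a\<in>A. X a) \<and> \<not> has_box I (\<Union>a\<in>A. X a)"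
    by auto
  then show ?case using has_box_Un[OF I, of "X a" "\<Union>a\<in>A. X a"]
    by (auto intro: dset_Un depends_Un)
qed

text \<open>The fibres of a small set over a coordinate hyperplane are, off a small set, finite up to
  infinitesimals. The sheets \<open>G j\<close> consist of the \<open>j\<close>-th boundary points of the thickened fibres.\<close>

definition sheeted :: "nat \<Rightarrow> nat set \<Rightarrow> (nat \<Rightarrow> 'a) set \<Rightarrow> (nat \<Rightarrow> 'a) set \<Rightarrow>
    (nat \<Rightarrow> (nat \<Rightarrow> 'a) set) \<Rightarrow> nat \<Rightarrow> bool" where
  "sheeted v J D T G N \<longleftrightarrow> cyl J T \<and> \<not> has_box J T \<and> (\<forall>j. cyl (insert v J) (G j)) \<and>
     (\<forall>j. \<forall>x\<in>G j. \<forall>y\<in>G j. (\<forall>i\<in>J. x i = y i) \<longrightarrow> x v = y v) \<and>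
     (\<forall>p\<in>st_pts (insert v J) D. p \<notin> st_pts J T \<longrightarrow>
       (\<exists>j<N. \<exists>y. y \<in> finite_elems \<and> st y = p v \<and> (\<lambda>i. lift (p i))(v := y) \<in> G j))"

text \<open>A thickened fibre has a boundary point infinitely close to a given finite point of it
  unless it contains an interval of a certain infinitesimal length above that point; the base points
  with such intervals form the small set \<open>T\<close>. Saturation bounds the number of boundary
  points uniformly.\<close>

lemma sheets:
  assumes J: "finite J" and v: "v \<notin> J" and D: "cyl (insert v J) D" "\<not> has_box (insert v J) D"
  shows "\<exists>T G N. sheeted v J D T G N"
proof -
  let ?V = "insert v J"
  have V: "finite ?V" using J by simp
  have "\<exists>x. p \<in> st_pts ?V D \<longrightarrow> x \<in> D \<and> lifts ?V p x" for p by (auto simp: st_pts_iff)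
  then obtain x where x: "\<And>p. p \<in> st_pts ?V D \<Longrightarrow> x p \<in> D \<and> lifts ?V p (x p)" by metis
  obtain n where n: "n > 0" "n \<in> infinitesimals"
    "\<And>p. p \<in> st_pts ?V D \<Longrightarrow> close n J (\<lambda>i. lift (p i)) (x p)"
    using lifts_close_bound[of "\<lambda>p. p \<in> st_pts ?V D" J "\<lambda>p i. lift (p i)" x] x lifts_lift
      lifts_mono[OF _ subset_insertI] by metis
  \<comment> \<open>By the choice of \<open>n\<close>, the fibre over the fixed lift of
    \<open>p\<close> contains the \<open>v\<close>-coordinate of the chosen point
    \<open>x p\<close>.\<close>
  define A where "A x = {z. \<exists>d\<in>D. close n J x d \<and> d v = z}" for x
  have A_cong: "A x = A y" if "\<And>i. i \<in> J \<Longrightarrow> x i = y i" for x y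
    unfolding A_def using close_cong[of J x y] that by blast
  have A_dpred: "dpred M (\<lambda>e. t e \<in> A (f e))" if "dterm M t" "\<And>i. dterm M (\<lambda>e. f e i)" for t f
  proof -
    have t: "dterm M (\<lambda>e. t (\<lambda>i. e (2 * i + 1)))" using that(1) by (rule dterm_rename)
    have f: "dterm M (\<lambda>e. f (\<lambda>i. e (2 * i + 1)) i)" for i using that(2) by (rule dterm_rename)
    show ?thesis unfolding A_def mem_Collect_eq
      using D by (intro dpred_bex_point dpred_conj dpred_close dpred_eq dterm_var dterm_const J t f) auto
  qed

  \<comment> \<open>The condition \<open>\<bar>y * e\<bar> < 1\<close> confines the interval to a
    bounded region when \<open>e = eps k\<close>, so that it contains a rational interval, and
    admits every finite \<open>y\<close> when \<open>e\<close> is infinitesimal.\<close>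
  define T where "T e = {x. \<exists>y. \<bar>y * e\<bar> < 1 \<and> (\<forall>z. y < z \<and> z < y + e \<longrightarrow> z \<in> A x)}" for e
  have T_dset: "dset M (T e)" for e
    unfolding T_def dset_Collect by (intro d_intros A_dpred)
  have T_dep: "depends J (T e)" for e
    unfolding depends_def T_def mem_Collect_eq using A_cong by metis
  have T_eps: "\<not> has_box J (T (eps k))" for k
  proof
    assume "has_box J (T (eps k))"
    then obtain a b where ab: "\<forall>i\<in>J. a i < b i" "rbox J a b \<subseteq> T (eps k)"
      unfolding has_box_def by blast
    define T' where "T' j = (let (c :: rat, d :: rat) = from_nat j in
      {x. c < d \<and> (\<forall>z. of_rat c < z \<and> z < of_rat d \<longrightarrow> z \<in> A x)})" for j
    have "\<exists>j. has_box J (T' j \<inter> rbox J a b)"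
    proof (rule cover_box[where T = T'])
      show "dset M (T' j)" for j
        unfolding T'_def Let_def by (cases "from_nat j :: rat \<times> rat")
          (simp only: prod.case dset_Collect, intro d_intros A_dpred)
      show "depends J (T' j)" for j unfolding depends_def T'_def Let_def
        by (cases "from_nat j :: rat \<times> rat") (simp, metis A_cong)
      show "rbox J a b \<subseteq> (\<Union>j. T' j)"
      proof
        fix x :: "nat \<Rightarrow> 'a" assume "x \<in> rbox J a b"
        then have "x \<in> T (eps k)" using ab by blast
        then obtain y where y: "\<bar>y * eps k\<bar> < 1"
          and yA: "\<And>z. y < z \<Longrightarrow> z < y + eps k \<Longrightarrow> z \<in> A x"
          unfolding T_def by blast
        have "\<bar>y\<bar> \<le> of_nat (Suc k)" using y by (simp add: abs_mult field_simps del: of_nat_Suc)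
        then obtain c d :: rat where "c < d" "y < of_rat c" "of_rat d < y + eps k"
          using rational_interval_between[of y "Suc k" k "y + eps k"] by blast
        then have "x \<in> T' (to_nat (c, d))" using yA by (auto simp: T'_def)
        then show "x \<in> (\<Union>j. T' j)" by blast
      qed
    qed (use J ab in auto)
    then obtain j where "has_box J (T' j \<inter> rbox J a b)" ..
    then obtain a' b' where ab': "\<forall>i\<in>J. a' i < b' i" "rbox J a' b' \<subseteq> T' j"
      by (rule has_box_IntE)
    obtain c d :: rat where cd: "from_nat j = (c, d)" by (rule prod.exhaust)
    have T'_iff: "x \<in> T' j \<longleftrightarrow> c < d \<and> (\<forall>z. of_rat c < z \<and> z < of_rat d \<longrightarrow> z \<in> A x)" for x
      by (simp add: T'_def cd)
    have "c < d" using ab'(2) rbox_nonempty[OF ab'(1), where ?'a = 'a] T'_iff by blast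
    have "has_box ?V (D \<inter> rbox ?V (a'(v := c)) (b'(v := d)))"
    proof (rule dense_box[OF V])
      show "\<forall>i\<in>?V. (a'(v := c)) i < (b'(v := d)) i" using ab' \<open>c < d\<close> by auto
      fix x :: "nat \<Rightarrow> 'a" assume x: "x \<in> rbox ?V (a'(v := c)) (b'(v := d))"
      then have "x \<in> rbox J a' b'" using v by (auto simp: rbox_def split: if_splits)
      then have "x \<in> T' j" using ab' by blast
      moreover have "of_rat c < x v" "x v < of_rat d" using x by (auto simp: rbox_def)
      ultimately have "x v \<in> A x" using T'_iff by blast
      then obtain y where "y \<in> D" "close n J x y" "y v = x v" unfolding A_def by blast
      then show "\<exists>y\<in>D. near ?V x y" using n(1) close_near[OF _ n(2)]
        by (intro bexI[of _ y]) (auto simp: near_def infinitesimals_def)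
    qed (use D in auto)
    then show False using D(2) has_box_mono by blast
  qed
  \<comment> \<open>Smallness of \<open>T e\<close> is one condition for each rational box and holds
    for all \<open>e = eps k\<close>; overspill passes it to an infinitesimal
    \<open>d\<close>.\<close>
  obtain d where d: "d > 0" "d \<in> infinitesimals"
    and d_box: "\<And>l. \<not> ((\<forall>i\<in>J. fst (nat_box l) i < snd (nat_box l) i) \<and>
      rbox J (fst (nat_box l)) (snd (nat_box l)) \<subseteq> T d)"
  proof (rule overspill[of "\<lambda>l d. \<not> ((\<forall>i\<in>J. fst (nat_box l) i < snd (nat_box l) i) \<and>
      rbox J (fst (nat_box l)) (snd (nat_box l)) \<subseteq> T d)"])
    show "dpred M (\<lambda>e. \<not> ((\<forall>i\<in>J. fst (nat_box l) i < snd (nat_box l) i) \<and>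
      rbox J (fst (nat_box l)) (snd (nat_box l)) \<subseteq> T (e 0)))" for l
      unfolding subset_eq T_def mem_Collect_eq by (intro d_intros dset_rbox J A_dpred)
    show "\<not> ((\<forall>i\<in>J. fst (nat_box l) i < snd (nat_box l) i) \<and>
      rbox J (fst (nat_box l)) (snd (nat_box l)) \<subseteq> T (eps k))" for l k
      using T_eps[of k] unfolding has_box_def by blast
  qed blast
  have T_box: "\<not> has_box J (T d)"
  proof
    assume "has_box J (T d)"
    then obtain a b where ab: "\<forall>i\<in>J. a i < b i" "rbox J a b \<subseteq> T d"
      unfolding has_box_def by blast
    obtain l where l: "\<And>i. i \<in> J \<Longrightarrow> fst (nat_box l) i = a i \<and> snd (nat_box l) i = b i"
      using ex_nat_box[OF J] by blast
    have "rbox J (fst (nat_box l)) (snd (nat_box l)) = (rbox J a b :: (nat \<Rightarrow> 'a) set)"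
      by (rule rbox_cong) (use l in auto)
    then show False using d_box[of l] ab l by auto
  qed

  define R where "R j x \<longleftrightarrow> at_least j (bd (A x)) (x v)" for j x
  have bd_dpred: "dpred M (\<lambda>e. bd (A (\<lambda>i. e (Suc i))) (e 0))"
    using dpred_bd[of "\<lambda>z x. z \<in> A x"] A_dpred[of "\<lambda>e. e 0" "\<lambda>e i. e (Suc i)"]
    by (simp add: dterm_var)
  have bd_dset: "dpred M (\<lambda>x. bd (A x) (x v))"
    using dpred_rename[OF bd_dpred, of "case_nat v (\<lambda>i. i)"] by simp
  have R_dset: "dpred M (R j)" for j
    using dpred_rename[OF dpred_at_least[of "\<lambda>b x. bd (A x) b" j, OF bd_dpred],
        of "case_nat v (\<lambda>i. i)"] by (simp add: R_def[abs_def])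
  have R_dep: "R j x \<longleftrightarrow> R j y" if "\<And>i. i \<in> ?V \<Longrightarrow> x i = y i" for j x y
    using A_cong[of x y] that by (simp add: R_def)
  have bd_fin: "finite {b. bd (A x) b}" for x
    by (rule finite_bd) (intro A_dpred dterm_var dterm_const)
  \<comment> \<open>Each fibre has finitely many boundary points by o-minimality. If their numbers
    were unbounded, saturation would produce a fibre with infinitely many.\<close>
  have "\<exists>N. {x. R N x} = {}"
  proof (rule ccontr)
    assume "\<not> (\<exists>N. {x. R N x} = {})"
    then have ne: "{x. R N x} \<noteq> {}" for N by blast
    obtain x where x: "\<And>N. x \<in> {x. R N x}"
    proof (rule decreasing_nonempty[of ?V "\<lambda>N. {x. R N x}"])
      show "dset M {x. R N x}" for N unfolding dset_Collect by (rule R_dset)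
      show "depends ?V {x. R N x}" for N
        unfolding depends_def mem_Collect_eq by (intro allI impI R_dep) auto
      show "{x. R (Suc N) x} \<subseteq> {x. R N x}" for N
        using at_least_Suc unfolding R_def by blast
    qed (rule V, rule ne, rule that)
    have "N \<le> card {b. bd (A x) b \<and> b < x v}" for N
      using x[of N] at_least_card[OF bd_fin] by (simp add: R_def)
    from this[of "Suc (card {b. bd (A x) b \<and> b < x v})"] show False by simp
  qed
  then obtain N where N: "\<And>x. \<not> R N x" by blast
  \<comment> \<open>Exactly \<open>j\<close> boundary points of the fibre lie below a point of
    \<open>G j\<close>, so each fibre contributes at most one point.\<close>
  define G where "G j = {x. bd (A x) (x v) \<and> R j x \<and> \<not> R (Suc j) x}" for j
  have "sheeted v J D (T d) G N" unfolding sheeted_def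
  proof (intro conjI allI ballI impI)
    show "dset M (T d)" "depends J (T d)" by (rule T_dset T_dep)+
    show "\<not> has_box J (T d)" by (rule T_box)
    show "dset M (G j)" for j unfolding G_def dset_Collect
      by (intro dpred_conj dpred_neg bd_dset R_dset)
    show "depends ?V (G j)" for j unfolding depends_def G_def mem_Collect_eq
    proof (intro allI impI)
      fix x y :: "nat \<Rightarrow> 'a" assume *: "\<forall>i\<in>?V. x i = y i"
      then have "A x = A y" by (intro A_cong) auto
      moreover have "R i x = R i y" for i using * by (intro R_dep) auto
      ultimately show "(bd (A x) (x v) \<and> R j x \<and> \<not> R (Suc j) x) =
        (bd (A y) (y v) \<and> R j y \<and> \<not> R (Suc j) y)" using * by simp
    qed
    show "x v = y v" if "x \<in> G j" "y \<in> G j" "\<forall>i\<in>J. x i = y i" for j x y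
    proof (rule ccontr)
      have "A x = A y" using that(3) by (intro A_cong) auto
      then have *: "bd (A y) (x v)" "bd (A y) (y v)" "at_least j (bd (A y)) (x v)"
        "at_least j (bd (A y)) (y v)"
        "\<not> at_least (Suc j) (bd (A y)) (x v)" "\<not> at_least (Suc j) (bd (A y)) (y v)"
        using that by (auto simp: G_def R_def)
      assume "x v \<noteq> y v"
      then consider "x v < y v" | "y v < x v" by (meson neqE)
      then show False using * by cases auto
    qed
    fix p assume p: "p \<in> st_pts ?V D" "p \<notin> st_pts J (T d)"
    define w where "w = (\<lambda>i. lift (p i))"
    have w: "lifts ?V p w" unfolding w_def by (rule lifts_lift)
    then have "w \<notin> T d" using p(2) lifts_mono[OF w subset_insertI] by (auto simp: st_pts_iff)
    let ?y = "x p v"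
    have y: "?y \<in> A w" unfolding A_def using x[OF p(1)] n(3)[OF p(1)] by (auto simp: w_def)
    have yf: "?y \<in> finite_elems" "st ?y = p v" using x[OF p(1)] by (auto simp: lifts_def)
    then obtain k where k: "\<bar>?y\<bar> \<le> of_nat k" using finite_elems_bound by blast
    have "\<bar>?y * d\<bar> < 1"
    proof -
      have "\<bar>?y\<bar> * \<bar>d\<bar> \<le> of_nat k * eps k"
        using k infinitesimal_less[OF d(2), of k] by (intro mult_mono) auto
      also have "\<dots> < 1" by (simp add: divide_less_eq del: of_nat_Suc)
      finally show ?thesis by (simp add: abs_mult)
    qed
    with \<open>w \<notin> T d\<close> obtain z where z: "?y < z" "z < ?y + d" "z \<notin> A w" unfolding T_def by blast
    have "dpred M (\<lambda>e. e 0 \<in> A w)" by (intro A_dpred dterm_var dterm_const)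
    \<comment> \<open>As \<open>w\<close> is not in \<open>T d\<close>, the interval of length
      \<open>d\<close> above \<open>?y\<close> leaves the fibre at some \<open>z\<close>, so a
      boundary point lies within \<open>d\<close> of \<open>?y\<close>.\<close>
    then obtain b where b: "?y \<le> b" "b \<le> z" "bd (A w) b" using bd_between y z by blast
    have "b - ?y \<in> infinitesimals"
      by (rule infinitesimal_le[OF d(2)]) (use b z in \<open>auto simp: abs_le_iff algebra_simps\<close>)
    then have bf: "b \<in> finite_elems" "st b = p v" using finite_elems_near[OF yf(1), of b] yf by auto
    have Aw: "A (w(v := b)) = A w" using v by (intro A_cong) auto
    have "\<not> R N (w(v := b))" "R 0 (w(v := b))" using N[of "w(v := b)"] by (simp_all add: R_def[of 0])
    then obtain j where "j < N" "R j (w(v := b))" "\<not> R (Suc j) (w(v := b))"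
      using ex_least_nat_less[of "\<lambda>j. \<not> R j (w(v := b))" N] by auto
    then have "w(v := b) \<in> G j" using b Aw by (simp add: G_def)
    with \<open>j < N\<close> bf show "\<exists>j<N. \<exists>y. y \<in> finite_elems \<and> st y = p v \<and> (\<lambda>i. lift (p i))(v := y) \<in> G j"
      unfolding w_def by blast
  qed
  then show ?thesis by blast
qed

section \<open>The algebra generated by the standard parts\<close>

text \<open>The finite unions of differences from the theorem, for cylinders. That they form a
  Boolean algebra rests on \<open>st_pts_Int\<close>.\<close>

inductive alg :: "nat set \<Rightarrow> (nat \<Rightarrow> real) set \<Rightarrow> bool" for V where
  alg_empty: "alg V {}"
| alg_insert: "alg V W \<Longrightarrow> cyl V X \<Longrightarrow> cyl V Y \<Longrightarrow> alg V (W \<union> (st_pts V X - st_pts V Y))"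

lemma cyl_UNIV: "cyl V UNIV"
  by (simp add: dset_UNIV depends_def)

lemma cyl_empty: "cyl V {}"
  by (simp add: dset_empty depends_def)

lemma st_pts_UNIV: "st_pts V (UNIV :: (nat \<Rightarrow> 'a) set) = UNIV"
  by (simp add: set_eq_iff st_pts_iff) (blast intro: lifts_lift)

lemma st_pts_empty: "st_pts V {} = {}"
  by (simp add: st_pts_def)

lemma alg_diff: "cyl V X \<Longrightarrow> cyl V Y \<Longrightarrow> alg V (st_pts V X - st_pts V Y)"
  using alg_insert[OF alg_empty, of X V Y] by simp

lemma alg_st_pts: "cyl V X \<Longrightarrow> alg V (st_pts V X)"
  using alg_diff[of X V "{}"] cyl_empty by (simp add: st_pts_empty)

lemma alg_Un:
  assumes "alg V A" "alg V B" shows "alg V (A \<union> B)"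
  using assms(2)
proof induction
  case alg_empty
  then show ?case using assms(1) by simp
next
  case (alg_insert W X Y)
  then show ?case using alg.alg_insert[of V "A \<union> W" X Y] by (simp add: Un_assoc)
qed

text \<open>An intersection of two differences is the intersection of the minuends minus the union
  of the subtrahends; \<open>st_pts_Int\<close> turns the former into a standard part again.\<close>

lemma alg_Int_diff:
  assumes "finite V" "alg V A" and X: "cyl V X" and Y: "cyl V Y"
  shows "alg V (A \<inter> (st_pts V X - st_pts V Y))"
  using assms(2)
proof induction
  case alg_empty
  show ?case using alg.alg_empty by simp
next
  case (alg_insert W X' Y')
  obtain Z where Z: "cyl V Z" "st_pts V X' \<inter> st_pts V X = st_pts V Z"
    using st_pts_Int[OF assms(1) \<open>cyl V X'\<close> X] by blast
  have "cyl V (Y' \<union> Y)" using alg_insert Y by (blast intro: dset_Un depends_Un)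
  then have "alg V ((W \<inter> (st_pts V X - st_pts V Y)) \<union> (st_pts V Z - st_pts V (Y' \<union> Y)))"
    using alg_insert Z by (intro alg.alg_insert)
  also have "(W \<inter> (st_pts V X - st_pts V Y)) \<union> (st_pts V Z - st_pts V (Y' \<union> Y)) =
      (W \<union> (st_pts V X' - st_pts V Y')) \<inter> (st_pts V X - st_pts V Y)"
    unfolding st_pts_Un Z(2)[symmetric] by blast
  finally show ?case .
qed

lemma alg_Int:
  assumes "finite V" "alg V A" "alg V B" shows "alg V (A \<inter> B)"
  using assms(3)
proof induction
  case alg_empty
  show ?case using alg.alg_empty by simp
next
  case (alg_insert W X Y)
  then have "alg V (A \<inter> W \<union> A \<inter> (st_pts V X - st_pts V Y))"
    using alg_Un alg_Int_diff assms by blast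
  then show ?case by (simp add: Int_Un_distrib)
qed

lemma alg_Compl:
  assumes "finite V" "alg V A" shows "alg V (- A)"
  using assms(2)
proof induction
  case alg_empty
  show ?case using alg_st_pts[of UNIV V] cyl_UNIV by (simp add: st_pts_UNIV)
next
  case (alg_insert W X Y)
  have "alg V (st_pts V (UNIV :: (nat \<Rightarrow> 'a) set) - st_pts V X)" by (intro alg_diff cyl_UNIV alg_insert)
  moreover have "alg V (st_pts V Y)" by (intro alg_st_pts alg_insert)
  ultimately have "alg V (- W \<inter> ((st_pts V (UNIV :: (nat \<Rightarrow> 'a) set) - st_pts V X) \<union> st_pts V Y))"
    using alg_insert assms alg_Un alg_Int by blast
  also have "- W \<inter> ((st_pts V (UNIV :: (nat \<Rightarrow> 'a) set) - st_pts V X) \<union> st_pts V Y) =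
      - (W \<union> (st_pts V X - st_pts V Y))"
    unfolding st_pts_UNIV by blast
  finally show ?case .
qed

lemma alg_Diff: "finite V \<Longrightarrow> alg V A \<Longrightarrow> alg V B \<Longrightarrow> alg V (A - B)"
  unfolding Diff_eq by (intro alg_Int alg_Compl)

lemma alg_UN: "finite I \<Longrightarrow> (\<And>i. i \<in> I \<Longrightarrow> alg V (A i)) \<Longrightarrow> alg V (\<Union>i\<in>I. A i)"
  by (induction I rule: finite_induct) (auto intro: alg_empty alg_Un)

lemma alg_INT:
  assumes "finite V" "finite I" "\<And>i. i \<in> I \<Longrightarrow> alg V (A i)" shows "alg V (\<Inter>i\<in>I. A i)"
proof -
  have "alg V (- (\<Union>i\<in>I. - A i))" using assms by (intro alg_Compl alg_UN) auto
  then show ?thesis by simp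
qed

text \<open>A cylinder over \<open>U\<close> leaves the remaining coordinates free, so they can be
  filled with values of \<open>lift\<close>.\<close>

lemma st_pts_coords:
  fixes X :: "(nat \<Rightarrow> 'a) set"
  assumes "depends U X" "U \<subseteq> V" shows "st_pts U X = st_pts V X"
proof (intro equalityI subsetI)
  fix p assume "p \<in> st_pts U X"
  then obtain x where x: "x \<in> X" "lifts U p x" by (auto simp: st_pts_iff)
  define y where "y i = (if i \<in> U then x i else lift (p i))" for i
  have "y \<in> X" using x(1) dependsD[OF assms(1), of x y] by (simp add: y_def)
  moreover have "lifts V p y" using x(2) by (auto simp: lifts_def y_def lift)
  ultimately show "p \<in> st_pts V X" by (auto simp: st_pts_iff)
next
  fix p assume "p \<in> st_pts V X"
  then show "p \<in> st_pts U X" using lifts_mono[OF _ assms(2)] by (auto simp: st_pts_iff)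
qed

lemma alg_coords:
  assumes "U \<subseteq> V" "alg U A" shows "alg V A"
  using assms(2)
proof induction
  case alg_empty
  show ?case by (rule alg.alg_empty)
next
  case (alg_insert W X Y)
  then show ?case using alg.alg_insert[of V W X Y] st_pts_coords[of U _ V] assms(1)
    by (simp add: depends_mono[of U _ V])
qed

lemma alg_depends: "alg V A \<Longrightarrow> depends V A"
proof (induction rule: alg.induct)
  case alg_empty
  show ?case by (simp add: depends_def)
next
  case (alg_insert W X Y)
  have "depends V (st_pts V Z)" for Z :: "(nat \<Rightarrow> 'a) set"
    by (simp add: depends_def st_pts_def)
  with alg_insert show ?case by (intro depends_Un depends_Diff)
qed

section \<open>Externally definable sets\<close>

text \<open>For a projection of a set in the algebra this property can be checked directly, by
  saturation; o-minimality is needed to return from it to the algebra.\<close>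

definition ext_def :: "nat set \<Rightarrow> (nat \<Rightarrow> real) set \<Rightarrow> bool" where
  "ext_def V W \<longleftrightarrow> (\<forall>g :: (nat \<Rightarrow> real) \<Rightarrow> nat \<Rightarrow> 'a. (\<forall>p. lifts V p (g p)) \<longrightarrow>
     (\<exists>X. cyl V X \<and> (\<forall>p. p \<in> W \<longleftrightarrow> g p \<in> X)))"

text \<open>Smallness is measured over \<open>J\<close>, since \<open>S\<close> itself may be small
  over \<open>V\<close>. Injectivity of \<open>S\<close> over \<open>J\<close> is what makes the
  projections of its two halves disjoint.\<close>

lemma ext_def_on_sheet:
  assumes V: "finite V" and "J \<subseteq> V" and W: "ext_def V W" and S: "cyl V S"
    and inj: "\<And>x y. x \<in> S \<Longrightarrow> y \<in> S \<Longrightarrow> \<forall>i\<in>J. x i = y i \<Longrightarrow> \<forall>i\<in>V. x i = y i"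
  obtains X Y where "cyl V X" "X \<subseteq> S" "cyl J Y" "\<not> has_box J Y"
    "\<And>p. p \<in> st_pts V S \<Longrightarrow> p \<notin> st_pts J Y \<Longrightarrow> p \<in> W \<longleftrightarrow> p \<in> st_pts V X"
proof -
  have J: "finite J" using V \<open>J \<subseteq> V\<close> finite_subset by blast
  \<comment> \<open>The quantifier over all sections in \<open>ext_def\<close> permits a
    \<open>g\<close> that takes its value in \<open>S\<close> at every point of
    \<open>st_pts V S\<close>.\<close>
  have "\<exists>x. lifts V p x \<and> (p \<in> st_pts V S \<longrightarrow> x \<in> S)" for p
    using lifts_lift[of V p] by (cases "p \<in> st_pts V S") (auto simp: st_pts_iff)
  then obtain g where g: "\<And>p. lifts V p (g p)" "\<And>p. p \<in> st_pts V S \<Longrightarrow> g p \<in> S" by metis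
  obtain X where X: "cyl V X" "\<And>p. p \<in> W \<longleftrightarrow> g p \<in> X"
    using W g(1) unfolding ext_def_def by blast
  define E where "E Z = {x :: nat \<Rightarrow> 'a. \<exists>y\<in>Z. \<forall>i\<in>J. x i = y i}" for Z
  have E: "cyl J (E Z)" if "dset M Z" for Z
  proof
    show "dset M (E Z)" unfolding E_def dset_Collect by (intro d_intros that J)
    show "depends J (E Z)" unfolding E_def depends_def by simp
  qed
  have "cyl V (X \<inter> S)" "cyl V (S - X)"
    using X S by (auto intro: dset_Int dset_Diff depends_Int depends_Diff)
  moreover have "E (X \<inter> S) \<inter> E (S - X) = {}"
  proof -
    have False if "y \<in> X \<inter> S" "\<forall>i\<in>J. x i = y i" "z \<in> S - X" "\<forall>i\<in>J. x i = z i" for x y z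
    proof -
      have "\<forall>i\<in>V. y i = z i" using that by (intro inj) auto
      then have "y \<in> X \<longleftrightarrow> z \<in> X" using dependsD[of V X y z] X by blast
      then show False using that by blast
    qed
    then show ?thesis unfolding E_def by blast
  qed
  ultimately obtain Y where Y: "cyl J Y" "\<not> has_box J Y"
    "st_pts J (E (X \<inter> S)) \<inter> st_pts J (E (S - X)) \<subseteq> st_pts J Y"
    using st_pts_disjoint[OF J E E] by metis
  have proj: "p \<in> st_pts J (E Z)" if "p \<in> st_pts V Z" for p Z
  proof -
    obtain x where "x \<in> Z" "lifts V p x" using \<open>p \<in> st_pts V Z\<close> by (auto simp: st_pts_iff)
    then have "x \<in> E Z" "lifts J p x" using lifts_mono \<open>J \<subseteq> V\<close> by (auto simp: E_def)
    then show ?thesis by (auto simp: st_pts_iff)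
  qed
  have "p \<in> W \<longleftrightarrow> p \<in> st_pts V (X \<inter> S)" if p: "p \<in> st_pts V S" "p \<notin> st_pts J Y" for p
  proof
    assume "p \<in> W"
    then show "p \<in> st_pts V (X \<inter> S)" using g p X(2) by (auto simp: st_pts_iff)
  next
    assume "p \<in> st_pts V (X \<inter> S)"
    show "p \<in> W"
    proof (rule ccontr)
      assume "p \<notin> W"
      then have "p \<in> st_pts V (S - X)" using g p X(2) by (auto simp: st_pts_iff)
      then show False using proj \<open>p \<in> st_pts V (X \<inter> S)\<close> Y(3) p(2) by blast
    qed
  qed
  then show ?thesis using that[of "X \<inter> S" Y] \<open>cyl V (X \<inter> S)\<close> Y(1,2) by blast
qed

text \<open>One sheet in each direction outside \<open>J\<close> cuts out a graph over
  \<open>J\<close>, to which \<open>ext_def_on_sheet\<close> applies. There are finitely many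
  choices of sheets, and their exceptional sets are collected in \<open>T\<close>. For
  \<open>J = V\<close> the condition on \<open>p\<close> involving \<open>D\<close> is vacuous,
  which starts the induction.\<close>

lemma ext_def_off_small:
  assumes V: "finite V" and "J \<subseteq> V" and W: "ext_def V W"
    and D: "\<And>i. i \<in> V - J \<Longrightarrow> cyl (insert i J) (D i)" "\<And>i. i \<in> V - J \<Longrightarrow> \<not> has_box (insert i J) (D i)"
  obtains T H where "cyl J T" "\<not> has_box J T" "alg V H"
    "\<And>p. (\<forall>i\<in>V - J. p \<in> st_pts (insert i J) (D i)) \<Longrightarrow> p \<notin> st_pts J T \<Longrightarrow> p \<in> W \<longleftrightarrow> p \<in> H"
proof -
  have J: "finite J" using V \<open>J \<subseteq> V\<close> finite_subset by blast
  have "\<exists>T G N. i \<in> V - J \<longrightarrow> sheeted i J (D i) T G N" for i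
    using sheets[OF J _ D, of i] by blast
  then obtain T G N where sh: "\<And>i. i \<in> V - J \<Longrightarrow> sheeted i J (D i) (T i) (G i) (N i)" by metis
  have T: "cyl J (T i)" "\<not> has_box J (T i)"
    and G: "cyl (insert i J) (G i j)"
    and G_inj: "x \<in> G i j \<Longrightarrow> y \<in> G i j \<Longrightarrow> \<forall>k\<in>J. x k = y k \<Longrightarrow> x i = y i"
    and cover: "p \<in> st_pts (insert i J) (D i) \<Longrightarrow> p \<notin> st_pts J (T i) \<Longrightarrow>
        \<exists>j<N i. \<exists>y. y \<in> finite_elems \<and> st y = p i \<and> (\<lambda>k. lift (p k))(i := y) \<in> G i j"
    if "i \<in> V - J" for i j x y p
    using sh[OF that] unfolding sheeted_def by blast+
  define S where "S g = {x. \<forall>i\<in>V - J. x \<in> G i (g i)}" for g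
  have S_cyl: "cyl V (S g)" for g
  proof
    show "dset M (S g)" unfolding S_def dset_Collect using G V
      by (intro dpred_ball dpred_mem dterm_var) auto
    have dep: "depends V (G i (g i))" if "i \<in> V - J" for i
      using G[OF that] depends_mono[of "insert i J" _ V] that \<open>J \<subseteq> V\<close> by blast
    show "depends V (S g)" unfolding S_def depends_def[of _ "Collect _"] mem_Collect_eq
      by (intro allI impI ball_cong refl dependsD[OF dep]) auto
  qed
  have S_inj: "\<forall>i\<in>V. x i = y i" if "x \<in> S g" "y \<in> S g" "\<forall>i\<in>J. x i = y i" for g x y
    using that G_inj unfolding S_def by blast
  define Q where "Q g X Y \<longleftrightarrow> cyl V X \<and> X \<subseteq> S g \<and> cyl J Y \<and> \<not> has_box J Y \<and>
    (\<forall>p. p \<in> st_pts V (S g) \<longrightarrow> p \<notin> st_pts J Y \<longrightarrow> (p \<in> W \<longleftrightarrow> p \<in> st_pts V X))" for g X Y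
  have "\<exists>X Y. Q g X Y" for g
  proof (rule ext_def_on_sheet[OF V \<open>J \<subseteq> V\<close> W S_cyl S_inj])
    fix X Y assume "cyl V X" "X \<subseteq> S g" "cyl J Y" "\<not> has_box J Y"
      "\<And>p. p \<in> st_pts V (S g) \<Longrightarrow> p \<notin> st_pts J Y \<Longrightarrow> p \<in> W \<longleftrightarrow> p \<in> st_pts V X"
    then have "Q g X Y" unfolding Q_def by simp
    then show "\<exists>X Y. Q g X Y" by blast
  qed
  then obtain X Y where "\<And>g. Q g (X g) (Y g)" by metis
  then have XY: "cyl V (X g)" "X g \<subseteq> S g" "cyl J (Y g)" "\<not> has_box J (Y g)"
    "p \<in> st_pts V (S g) \<Longrightarrow> p \<notin> st_pts J (Y g) \<Longrightarrow> p \<in> W \<longleftrightarrow> p \<in> st_pts V (X g)" for g p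
    unfolding Q_def by simp_all
  define \<Phi> where "\<Phi> = (\<Pi>\<^sub>E i\<in>V - J. {..<N i})"
  have \<Phi>: "finite \<Phi>" unfolding \<Phi>_def using V by (intro finite_PiE) auto
  let ?T = "(\<Union>i\<in>V - J. T i) \<union> (\<Union>g\<in>\<Phi>. Y g)"
  let ?H = "\<Union>g\<in>\<Phi>. st_pts V (X g)"
  have small: "cyl J ?T \<and> \<not> has_box J ?T"
  proof -
    have "cyl J (\<Union>i\<in>V - J. T i) \<and> \<not> has_box J (\<Union>i\<in>V - J. T i)"
      using T V by (intro has_box_UN J) auto
    moreover have "cyl J (\<Union>g\<in>\<Phi>. Y g) \<and> \<not> has_box J (\<Union>g\<in>\<Phi>. Y g)"
      using XY \<Phi> by (intro has_box_UN J) auto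
    ultimately show ?thesis using has_box_Un[OF J] by (blast intro: dset_Un depends_Un)
  qed
  show ?thesis
  proof (rule that[of ?T ?H])
    show "cyl J ?T" "\<not> has_box J ?T" using small by blast+
    show "alg V ?H" using XY \<Phi> by (intro alg_UN alg_st_pts) auto
    fix p assume p: "\<forall>i\<in>V - J. p \<in> st_pts (insert i J) (D i)" "p \<notin> st_pts J ?T"
    then have pT: "i \<in> V - J \<Longrightarrow> p \<notin> st_pts J (T i)" and pY: "g \<in> \<Phi> \<Longrightarrow> p \<notin> st_pts J (Y g)" for i g
      by (auto simp: st_pts_Un st_pts_UN)
    show "p \<in> W \<longleftrightarrow> p \<in> ?H"
    proof
      assume "p \<in> ?H"
      then obtain g where g: "g \<in> \<Phi>" "p \<in> st_pts V (X g)" by blast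
      then have "p \<in> st_pts V (S g)" using st_pts_mono[OF XY(2)] by blast
      then show "p \<in> W" using XY(5) pY g by blast
    next
      assume "p \<in> W"
      have "\<exists>j y. i \<in> V - J \<longrightarrow> j < N i \<and> y \<in> finite_elems \<and> st y = p i \<and>
          (\<lambda>k. lift (p k))(i := y) \<in> G i j" for i
        using cover[of i p] p(1) pT by blast
      then obtain g y where gy: "\<And>i. i \<in> V - J \<Longrightarrow> g i < N i \<and> y i \<in> finite_elems \<and> st (y i) = p i \<and>
          (\<lambda>k. lift (p k))(i := y i) \<in> G i (g i)" by metis
      define h where "h = restrict g (V - J)"
      have "h \<in> \<Phi>" using gy by (auto simp: h_def \<Phi>_def)
      \<comment> \<open>All the sheets are met over the same base point, the lift of
        \<open>p\<close> over \<open>J\<close>, so the values \<open>y i\<close> combine to a single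
        point.\<close>
      define x where "x i = (if i \<in> V - J then y i else lift (p i))" for i
      have "lifts V p x" using gy by (auto simp: lifts_def x_def lift)
      moreover have "x \<in> S h" unfolding S_def
      proof (intro CollectI ballI)
        fix i assume i: "i \<in> V - J"
        have "x \<in> G i (g i) \<longleftrightarrow> (\<lambda>k. lift (p k))(i := y i) \<in> G i (g i)"
          by (rule dependsD[of "insert i J"]) (use G i in \<open>auto simp: x_def\<close>)
        then show "x \<in> G i (h i)" using gy i by (simp add: h_def)
      qed
      ultimately have "p \<in> st_pts V (S h)" by (auto simp: st_pts_iff)
      then have "p \<in> st_pts V (X h)" using XY(5) pY \<open>h \<in> \<Phi>\<close> \<open>p \<in> W\<close> by blast
      then show "p \<in> ?H" using \<open>h \<in> \<Phi>\<close> by blast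
    qed
  qed
qed

text \<open>Downward induction on the number \<open>e\<close> of coordinates: at each stage the description is valid
  off the points all of whose projections to \<open>e\<close> coordinates are small.\<close>

lemma ext_def_alg:
  assumes V: "finite V" and W: "ext_def V W"
  shows "alg V W"
proof -
  define P where "P e \<longleftrightarrow> (\<exists>A D. alg V A \<and>
      (\<forall>I. I \<subseteq> V \<longrightarrow> card I = e \<longrightarrow> cyl I (D I) \<and> \<not> has_box I (D I)) \<and>
      (\<forall>p. (\<exists>I. I \<subseteq> V \<and> card I = e \<and> p \<notin> st_pts I (D I)) \<longrightarrow> (p \<in> W \<longleftrightarrow> p \<in> A)))" for e
  have "P 0"
  proof (rule inc_induct[of 0 "Suc (card V)"])
    \<comment> \<open>No subset of \<open>V\<close> has \<open>card V + 1\<close> elements, so the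
      top stage holds vacuously.\<close>
    have none: "card I \<noteq> Suc (card V)" if "I \<subseteq> V" for I using card_mono[OF V that] by linarith
    have 1: "\<forall>I. I \<subseteq> V \<longrightarrow> card I = Suc (card V) \<longrightarrow>
        cyl I ((\<lambda>_. {}) I) \<and> \<not> has_box I ((\<lambda>_. {} :: (nat \<Rightarrow> 'a) set) I)"
      by (simp add: none)
    have 2: "\<forall>p. (\<exists>I. I \<subseteq> V \<and> card I = Suc (card V) \<and>
        p \<notin> st_pts I ((\<lambda>_. {} :: (nat \<Rightarrow> 'a) set) I)) \<longrightarrow> (p \<in> W \<longleftrightarrow> p \<in> {})"
      by (intro allI impI, elim exE conjE, drule none) (erule notE)
    show "P (Suc (card V))" unfolding P_def
      by (rule exI[of _ "{}"], rule exI[of _ "\<lambda>_. {}"]) (intro conjI[OF alg_empty] conjI[OF 1 2])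
  next
    fix e assume "P (Suc e)"
    then obtain A D where A: "alg V A"
      and D: "\<forall>I. I \<subseteq> V \<longrightarrow> card I = Suc e \<longrightarrow> cyl I (D I) \<and> \<not> has_box I (D I)"
      and AW: "\<forall>p. (\<exists>I. I \<subseteq> V \<and> card I = Suc e \<and> p \<notin> st_pts I (D I)) \<longrightarrow> (p \<in> W \<longleftrightarrow> p \<in> A)"
      unfolding P_def by (elim exE conjE) (rule that)
    define \<J> where "\<J> = {J. J \<subseteq> V \<and> card J = e}"
    define K where "K J = (\<Inter>i\<in>V - J. st_pts (insert i J) (D (insert i J)))" for J
    have ins: "insert i J \<subseteq> V \<and> card (insert i J) = Suc e" if "J \<in> \<J>" "i \<in> V - J" for i J
      using that finite_subset[OF _ V] by (auto simp: \<J>_def)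
    define Q where "Q J T H \<longleftrightarrow> cyl J T \<and> \<not> has_box J T \<and> alg V H \<and>
        (\<forall>p. p \<in> K J \<longrightarrow> p \<notin> st_pts J T \<longrightarrow> (p \<in> W \<longleftrightarrow> p \<in> H))" for J T H
    have "\<exists>T H. Q J T H" if J: "J \<in> \<J>" for J
    proof (rule ext_def_off_small[OF V _ W, of J "\<lambda>i. D (insert i J)"])
      show "J \<subseteq> V" using J by (simp add: \<J>_def)
      show "cyl (insert i J) (D (insert i J))" "\<not> has_box (insert i J) (D (insert i J))"
        if "i \<in> V - J" for i using D ins[OF J that] by blast+
      fix T H assume "cyl J T" "\<not> has_box J T" "alg V H"
        "\<And>p. \<forall>i\<in>V - J. p \<in> st_pts (insert i J) (D (insert i J)) \<Longrightarrow> p \<notin> st_pts J T \<Longrightarrow>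
          p \<in> W \<longleftrightarrow> p \<in> H"
      then have "Q J T H" unfolding Q_def K_def by simp
      then show ?thesis by blast
    qed
    then obtain T H where "\<And>J. J \<in> \<J> \<Longrightarrow> Q J (T J) (H J)" by metis
    then have TH: "\<And>J. J \<in> \<J> \<Longrightarrow> cyl J (T J) \<and> \<not> has_box J (T J) \<and> alg V (H J) \<and>
        (\<forall>p. p \<in> K J \<longrightarrow> p \<notin> st_pts J (T J) \<longrightarrow> (p \<in> W \<longleftrightarrow> p \<in> H J))"
      unfolding Q_def by blast
    \<comment> \<open>Off \<open>K J\<close> some projection of the point to \<open>e + 1\<close>
      coordinates avoids the standard part of its small set, and the earlier description
      \<open>A\<close> is valid; on \<open>K J\<close> the sheets over \<open>J\<close> provide
      \<open>H J\<close>.\<close>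
    define B where "B J = (A - K J) \<union> (H J \<inter> K J)" for J
    have B: "p \<in> W \<longleftrightarrow> p \<in> B J" if J: "J \<in> \<J>" and p: "p \<notin> st_pts J (T J)" for p J
    proof (cases "p \<in> K J")
      case True
      then show ?thesis using TH J p by (auto simp: B_def)
    next
      case False
      then obtain i where "i \<in> V - J" "p \<notin> st_pts (insert i J) (D (insert i J))"
        by (auto simp: K_def)
      then have "p \<in> W \<longleftrightarrow> p \<in> A" using AW ins[OF J] by blast
      with False show ?thesis by (simp add: B_def)
    qed
    have alg_st: "alg V (st_pts I X)" if "I \<subseteq> V" "cyl I X" for I X
      using alg_coords[OF that(1) alg_st_pts[OF that(2)]] .
    have "alg V (K J)" if "J \<in> \<J>" for J
      unfolding K_def using V D ins[OF that] by (intro alg_INT alg_st) auto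
    then have B_alg: "alg V (B J)" if "J \<in> \<J>" for J
      unfolding B_def using TH[OF that] that A V by (intro alg_Un alg_Diff alg_Int) auto
    \<comment> \<open>Each \<open>B J\<close> is cut down to the region where it is valid. Where
      several are valid they agree with \<open>W\<close>, so their union decides membership at every
      point outside at least one exceptional set.\<close>
    show "P e" unfolding P_def
    proof (intro exI[of _ "\<Union>J\<in>\<J>. B J - st_pts J (T J)"] exI[of _ T] conjI allI impI)
      have "finite \<J>" using V by (simp add: \<J>_def)
      then show "alg V (\<Union>J\<in>\<J>. B J - st_pts J (T J))"
        using TH B_alg V by (intro alg_UN alg_Diff alg_st) (auto simp: \<J>_def)
      fix I assume "I \<subseteq> V" "card I = e"
      then have "I \<in> \<J>" by (simp add: \<J>_def)
      then show "dset M (T I)" "depends I (T I)" "\<not> has_box I (T I)" using TH by blast+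
    next
      fix p assume "\<exists>I. I \<subseteq> V \<and> card I = e \<and> p \<notin> st_pts I (T I)"
      then show "p \<in> W \<longleftrightarrow> p \<in> (\<Union>J\<in>\<J>. B J - st_pts J (T J))" using B by (auto simp: \<J>_def)
    qed
  qed simp
  then obtain A D where A: "alg V A"
    and D0: "\<forall>I. I \<subseteq> V \<longrightarrow> card I = 0 \<longrightarrow> cyl I (D I) \<and> \<not> has_box I (D I)"
    and AW0: "\<forall>p. (\<exists>I. I \<subseteq> V \<and> card I = 0 \<and> p \<notin> st_pts I (D I)) \<longrightarrow> (p \<in> W \<longleftrightarrow> p \<in> A)"
    unfolding P_def by (elim exE conjE) (rule that)
  have D: "cyl {} (D {})" "\<not> has_box {} (D {})"
    using D0[THEN spec, of "{}"] by simp_all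
  have AW: "p \<in> W \<longleftrightarrow> p \<in> A" if "p \<notin> st_pts {} (D {})" for p
    using AW0[THEN spec, THEN mp, OF exI[of _ "{}"], of p] that by simp
  \<comment> \<open>A cylinder over no coordinates is empty or everything, and only the empty one
    contains no box.\<close>
  have "D {} = {}"
  proof (rule ccontr)
    assume "D {} \<noteq> {}"
    then have "D {} = UNIV" using D(1) unfolding depends_def by blast
    then show False using D(2) by (simp add: has_box_def)
  qed
  then have "W = A" using AW by (auto simp: st_pts_empty)
  with A show ?thesis by simp
qed

section \<open>Projections\<close>

text \<open>Along \<open>g\<close> the projection is the increasing union of the definable
  conditions \<open>Z (eps k)\<close>. For a point outside it, overspill gives an infinitesimal
  \<open>d p\<close> with \<open>g p\<close> still outside \<open>Z (d p)\<close>. An infinitesimal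
  \<open>b\<close> above all the \<open>d p\<close> separates inside from outside, since
  \<open>Z\<close> shrinks as its argument grows.\<close>

lemma proj_ext_def:
  assumes V: "finite V" and v: "v \<notin> V" and X: "cyl (insert v V) X" and Y: "cyl (insert v V) Y"
  shows "ext_def V {p. \<exists>r. p(v := r) \<in> st_pts (insert v V) X - st_pts (insert v V) Y}"
    (is "ext_def V ?W")
  unfolding ext_def_def
proof (intro allI impI)
  let ?U = "insert v V"
  fix g :: "(nat \<Rightarrow> real) \<Rightarrow> nat \<Rightarrow> 'a" assume g: "\<forall>p. lifts V p (g p)"
  have U: "finite ?U" using V by simp
  have "\<exists>r x. p \<in> ?W \<longrightarrow> x \<in> X \<and> lifts ?U (p(v := r)) x \<and> p(v := r) \<notin> st_pts ?U Y" for p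
    by (auto simp: st_pts_iff)
  then obtain r x where x: "\<And>p. p \<in> ?W \<Longrightarrow> x p \<in> X \<and> lifts ?U (p(v := r p)) (x p) \<and>
      p(v := r p) \<notin> st_pts ?U Y" by metis
  have lifts_upd: "lifts ?U (p(v := t)) z \<longleftrightarrow> lifts V p z \<and> z v \<in> finite_elems \<and> st (z v) = t"
    for p t and z :: "nat \<Rightarrow> 'a"
    using v unfolding lifts_def by (auto split: if_splits)
  obtain n where n: "n > 0" "n \<in> infinitesimals" "\<And>p. p \<in> ?W \<Longrightarrow> close n V (g p) (x p)"
    using lifts_close_bound[of "\<lambda>p. p \<in> ?W" V g x] g x lifts_upd by blast
  \<comment> \<open>The radius \<open>n\<close> bridges \<open>g p\<close> and the chosen witness.
    The factor \<open>e\<close> keeps the projected coordinate finite when \<open>e = eps k\<close>,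
    and the last clause is avoidance of \<open>st Y\<close> at scale \<open>e\<close>.\<close>
  define Z where "Z e = {z. \<exists>x\<in>X. close n V z x \<and> \<bar>x v * e\<bar> < 1 \<and> \<not> (\<exists>y\<in>Y. close e ?U x y)}" for e
  have Z_cyl: "cyl V (Z e)" for e
  proof
    show "dset M (Z e)" unfolding Z_def dset_Collect using X Y
      by (intro d_intros V U) auto
    show "depends V (Z e)" unfolding depends_def Z_def mem_Collect_eq
      by (intro allI impI bex_cong refl conj_cong close_cong) auto
  qed
  have Z_anti: "Z e \<subseteq> Z d" if "0 < d" "d \<le> e" for d e
  proof
    fix z assume "z \<in> Z e"
    then obtain x where x: "x \<in> X" "close n V z x" "\<bar>x v * e\<bar> < 1" "\<not> (\<exists>y\<in>Y. close e ?U x y)"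
      unfolding Z_def by blast
    have "\<bar>x v\<bar> * \<bar>d\<bar> \<le> \<bar>x v\<bar> * \<bar>e\<bar>" using that by (intro mult_left_mono) auto
    then have "\<bar>x v * d\<bar> < 1" using x(3) by (simp add: abs_mult)
    moreover have "close e ?U x y" if "close d ?U x y" for y
      using that \<open>d \<le> e\<close> unfolding close_def by fastforce
    ultimately show "z \<in> Z d" using x unfolding Z_def by blast
  qed
  have inW: "\<exists>k. g p \<in> Z (eps k)" if p: "p \<in> ?W" for p
  proof -
    have "\<not> (\<exists>y\<in>Y. near ?U (x p) y)"
    proof
      assume "\<exists>y\<in>Y. near ?U (x p) y"
      then have "p(v := r p) \<in> st_pts ?U Y"
        using x[OF p] lifts_near[of ?U "p(v := r p)" "x p"] by (auto simp: st_pts_iff)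
      then show False using x[OF p] by blast
    qed
    then obtain k where k: "\<not> (\<exists>y\<in>Y. close (eps k) ?U (x p) y)"
      using near_overspill[of Y ?U "x p"] Y U by blast
    have "x p v \<in> finite_elems" using x[OF p] by (simp add: lifts_def)
    then obtain m where m: "\<bar>x p v\<bar> \<le> of_nat m" using finite_elems_bound by blast
    define l where "l = max k m"
    have "\<bar>x p v * eps l\<bar> < 1"
    proof -
      have "\<bar>x p v\<bar> \<le> of_nat l" using m by (rule order_trans) (simp add: l_def)
      also have "\<dots> < of_nat (Suc l)" by simp
      finally show ?thesis by (simp add: abs_mult divide_less_eq del: of_nat_Suc)
    qed
    moreover have "(eps l :: 'a) \<le> eps k" by (rule eps_mono) (simp add: l_def)
    then have "close (eps k) ?U (x p) y" if "close (eps l) ?U (x p) y" for y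
      using that unfolding close_def by (meson less_le_trans)
    ultimately have "g p \<in> Z (eps l)" using k x[OF p] n(3)[OF p] unfolding Z_def by blast
    then show ?thesis ..
  qed
  have notW: "g p \<notin> Z (eps k)" if "p \<notin> ?W" for p k
  proof
    assume "g p \<in> Z (eps k)"
    then obtain z where z: "z \<in> X" "close n V (g p) z" "\<bar>z v * eps k\<bar> < 1"
      "\<not> (\<exists>y\<in>Y. close (eps k) ?U z y)"
      unfolding Z_def by blast
    have "\<bar>z v\<bar> < of_nat (Suc k)" using z(3) by (simp add: abs_mult divide_less_eq del: of_nat_Suc)
    then have "z v \<in> finite_elems" unfolding finite_elems_def by (blast intro: less_imp_le)
    moreover have "lifts V p z" using lifts_near close_near[OF z(2) n(2)] g by blast
    ultimately have lz: "lifts ?U (p(v := st (z v))) z" by (simp add: lifts_upd)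
    then have "p(v := st (z v)) \<in> st_pts ?U X" using z(1) by (auto simp: st_pts_iff)
    then have "p(v := st (z v)) \<in> st_pts ?U Y" using that by blast
    then obtain y where "y \<in> Y" "lifts ?U (p(v := st (z v))) y" by (auto simp: st_pts_iff)
    then show False using z(4) lifts_near[OF lz] near_close by blast
  qed
  have "\<exists>d. d > 0 \<and> d \<in> infinitesimals \<and> (p \<notin> ?W \<longrightarrow> g p \<notin> Z d)" for p
  proof (rule overspill1[of "\<lambda>d. p \<notin> ?W \<longrightarrow> g p \<notin> Z d"])
    have "dpred M (\<lambda>e. g p \<notin> Z (e 0))"
      unfolding Z_def mem_Collect_eq using X Y by (intro d_intros V U) auto
    then show "dpred M (\<lambda>e. p \<notin> ?W \<longrightarrow> g p \<notin> Z (e 0))" by (intro dpred_imp dpred_const)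
    show "p \<notin> ?W \<longrightarrow> g p \<notin> Z (eps k)" for k using notW by blast
  qed blast
  then obtain d where d: "\<And>p. d p > 0 \<and> d p \<in> infinitesimals \<and> (p \<notin> ?W \<longrightarrow> g p \<notin> Z (d p))"
    by metis
  obtain b where b: "b > 0" "b \<in> infinitesimals" "\<And>p (k :: nat). \<bar>d p\<bar> < b"
    using infinitesimal_bound[of "\<lambda>p k. d p"] d by blast
  have "p \<in> ?W \<longleftrightarrow> g p \<in> Z b" for p
  proof
    assume "p \<in> ?W"
    then obtain k where k: "g p \<in> Z (eps k)" using inW by blast
    have "b \<le> eps k" using infinitesimal_less[OF b(2), of k] b(1) by simp
    then show "g p \<in> Z b" using Z_anti[OF b(1)] k by blast
  next
    assume "g p \<in> Z b"
    moreover have "Z b \<subseteq> Z (d p)"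
      by (rule Z_anti) (use d[of p] b(3)[of p] in auto)
    ultimately show "p \<in> ?W" using d[of p] by blast
  qed
  then show "\<exists>X. cyl V X \<and> (\<forall>p. p \<in> ?W \<longleftrightarrow> g p \<in> X)" using Z_cyl by blast
qed

lemma alg_proj:
  assumes V: "finite V" and v: "v \<notin> V" and "alg (insert v V) A"
  shows "alg V {p. \<exists>r. p(v := r) \<in> A}"
  using assms(3)
proof induction
  case alg_empty
  show ?case using alg.alg_empty by simp
next
  case (alg_insert W X Y)
  have "alg V {p. \<exists>r. p(v := r) \<in> st_pts (insert v V) X - st_pts (insert v V) Y}"
    using alg_insert by (intro ext_def_alg proj_ext_def V v) auto
  with alg_insert.IH have "alg V ({p. \<exists>r. p(v := r) \<in> W} \<union>
      {p. \<exists>r. p(v := r) \<in> st_pts (insert v V) X - st_pts (insert v V) Y})"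
    by (rule alg_Un)
  also have "{p. \<exists>r. p(v := r) \<in> W} \<union>
      {p. \<exists>r. p(v := r) \<in> st_pts (insert v V) X - st_pts (insert v V) Y} =
      {p. \<exists>r. p(v := r) \<in> W \<union> (st_pts (insert v V) X - st_pts (insert v V) Y)}" by blast
  finally show ?case .
qed

lemma alg_coord_eq: "alg {v} {p. p v = r}"
proof -
  have "cyl {v} {x. x v = lift r}"
    by (auto simp: dset_Collect depends_def intro!: d_intros)
  then have "alg {v} (st_pts {v} {x. x v = lift r})" by (rule alg_st_pts)
  also have "st_pts {v} {x. x v = lift r} = {p. p v = r}"
    using lift by (auto simp: st_pts_def intro!: exI[of _ "\<lambda>_. lift r"])
  finally show ?thesis .
qed

text \<open>Fixing a coordinate is the projection of an intersection with a hyperplane, so it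
  reduces to \<open>alg_proj\<close>. This is how the parameters of a formula are
  eliminated.\<close>

lemma alg_fix_coord:
  assumes V: "finite V" and v: "v \<notin> V" and A: "alg (insert v V) A"
  shows "alg V {p. p(v := r) \<in> A}"
proof -
  have "alg (insert v V) (A \<inter> {p. p v = r})"
    using V A alg_coords[OF _ alg_coord_eq, of v "insert v V" r] by (intro alg_Int) auto
  then have "alg V {p. \<exists>t. p(v := t) \<in> A \<inter> {p. p v = r}}" by (rule alg_proj[OF V v])
  then show ?thesis by simp
qed

lemma alg_fix_coords:
  assumes "finite E" "finite U" "U \<inter> E = {}" "alg (U \<union> E) A"
  shows "alg U {p. (\<lambda>i. if i \<in> E then c i else p i) \<in> A}"
  using assms
proof (induction E arbitrary: A rule: finite_induct)
  case (insert v E)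
  have "alg (U \<union> E) {p. p(v := c v) \<in> A}"
    using insert by (intro alg_fix_coord) auto
  then have "alg U {p. (\<lambda>i. if i \<in> E then c i else p i) \<in> {p. p(v := c v) \<in> A}}"
    using insert by (intro insert.IH) auto
  moreover have "(\<lambda>i. if i \<in> E then c i else p i)(v := c v) = (\<lambda>i. if i \<in> insert v E then c i else p i)" for p
    by auto
  ultimately show ?case by simp
qed simp

section \<open>Formulas of the induced structure\<close>

text \<open>A variable may occur several times in \<open>js\<close>. A point of \<open>X\<close> may
  lift the repeated real by different, infinitely close elements, so equating coordinates in
  \<open>X\<close> would lose points; a uniform thickening of \<open>X\<close> repairs this.\<close>

lemma alg_rel:
  assumes X: "definable M m X" and js: "length js = m"
  shows "alg (set js) {q. map q js \<in> st_set X}"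
proof -
  let ?W = "{q. map q js \<in> st_set X}"
  have "\<exists>ys. q \<in> ?W \<longrightarrow> ys \<in> X \<and> ys \<in> lists finite_elems \<and> map st ys = map q js" for q
    unfolding st_set_def by auto
  then obtain ys where ys: "\<And>q. q \<in> ?W \<Longrightarrow> ys q \<in> X \<and> ys q \<in> lists finite_elems \<and>
      map st (ys q) = map q js" by metis
  have len: "length (ys q) = m" if "q \<in> ?W" for q
    using ys[OF that] js by (metis length_map)
  have ys_nth: "ys q ! k \<in> finite_elems \<and> st (ys q ! k) = q (js ! k)" if "q \<in> ?W" "k < m" for q k
  proof -
    have "ys q ! k \<in> finite_elems" using ys[OF that(1)] len[OF that(1)] that(2) by auto
    moreover have "map st (ys q) ! k = map q js ! k" using ys[OF that(1)] by simp
    then have "st (ys q ! k) = q (js ! k)" using len[OF that(1)] that(2) js by simp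
    ultimately show ?thesis ..
  qed
  define e where "e q k = (if q \<in> ?W \<and> k < m then lift (q (js ! k)) - ys q ! k else 0)" for q k
  have "e q k \<in> infinitesimals" for q k
    using ys_nth[of q k] st_eq_iff[of "lift (q (js ! k))" "ys q ! k"] lift[of "q (js ! k)"]
    by (auto simp: e_def infinitesimal_iff simp del: of_nat_Suc)
  then obtain n where n: "n > 0" "n \<in> infinitesimals" "\<And>q k. \<bar>e q k\<bar> < n"
    using infinitesimal_bound by blast
  define Z where "Z = {x. \<exists>y\<in>{y. map y [0..<m] \<in> X}. \<forall>k\<in>{..<m}. \<bar>x (js ! k) - y k\<bar> < n}"
  have "cyl (set js) Z"
  proof
    show "dset M Z" unfolding Z_def dset_Collect
      by (intro d_intros definable_dset[OF X] finite_lessThan)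
    show "depends (set js) Z" unfolding depends_def Z_def mem_Collect_eq
      using js by (intro allI impI bex_cong ball_cong refl) auto
  qed
  then have "alg (set js) (st_pts (set js) Z)" by (rule alg_st_pts)
  also have "st_pts (set js) Z = ?W"
  proof (intro equalityI subsetI)
    fix q assume "q \<in> ?W"
    define y where "y k = ys q ! k" for k
    have "map y [0..<m] = ys q"
      using len[OF \<open>q \<in> ?W\<close>] unfolding y_def by (metis map_nth)
    moreover have "\<bar>lift (q (js ! k)) - y k\<bar> < n" if "k < m" for k
      using n(3)[of q k] that \<open>q \<in> ?W\<close> by (simp add: e_def y_def)
    ultimately have "(\<lambda>i. lift (q i)) \<in> Z"
      unfolding Z_def using ys[OF \<open>q \<in> ?W\<close>] by (auto intro!: exI[of _ y])
    then show "q \<in> st_pts (set js) Z" using lifts_lift by (auto simp: st_pts_iff)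
  next
    fix q assume "q \<in> st_pts (set js) Z"
    then obtain x y where x: "lifts (set js) q x" and y: "map y [0..<m] \<in> X"
      and xy: "\<And>k. k < m \<Longrightarrow> \<bar>x (js ! k) - y k\<bar> < n"
      unfolding st_pts_iff Z_def by blast
    have yk: "y k \<in> finite_elems \<and> st (y k) = q (js ! k)" if "k < m" for k
    proof -
      have "x (js ! k) \<in> finite_elems \<and> st (x (js ! k)) = q (js ! k)"
        using x that js by (auto simp: lifts_def)
      moreover have "y k - x (js ! k) \<in> infinitesimals"
        by (rule infinitesimal_le[OF n(2)]) (use xy[OF that] n(1) in \<open>simp add: abs_minus_commute\<close>)
      ultimately show ?thesis using finite_elems_near[of "x (js ! k)" "y k"] by simp
    qed
    have "map st (map y [0..<m]) = map q js"
      using js yk by (intro nth_equalityI) auto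
    moreover have "map y [0..<m] \<in> lists finite_elems" using yk by auto
    ultimately show "q \<in> ?W" using y unfolding st_set_def by (metis (mono_tags) IntI image_eqI mem_Collect_eq)
  qed
  finally show ?thesis .
qed

lemma R_ind_trm: "trm_of (R_ind M) t \<Longrightarrow> \<exists>i. t = Var i"
  by (cases t) (auto simp: R_ind_def)

text \<open>The set \<open>V\<close> includes variables that will later carry parameters, so no
  arity is fixed in the induction; the quantifier case is \<open>alg_proj\<close>.\<close>

lemma alg_sat:
  assumes "form_of (R_ind M) p"
  shows "\<exists>V. finite V \<and> alg V {q. sat (R_ind M) q p}"
  using assms
proof (induction p)
  case (Eq t u)
  then obtain i j where ij: "t = Var i" "u = Var j" using R_ind_trm by force
  have "cyl {i, j} {x. x i = x j}"
    by (auto simp: dset_Collect depends_def intro!: d_intros)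
  then have "alg {i, j} (st_pts {i, j} {x :: nat \<Rightarrow> 'a. x i = x j})" by (rule alg_st_pts)
  also have "st_pts {i, j} {x :: nat \<Rightarrow> 'a. x i = x j} = {q. q i = q j}"
  proof (intro equalityI subsetI)
    fix q :: "nat \<Rightarrow> real" assume "q \<in> {q. q i = q j}"
    then have "(\<lambda>k. lift (q k)) \<in> {x :: nat \<Rightarrow> 'a. x i = x j}" by simp
    then show "q \<in> st_pts {i, j} {x :: nat \<Rightarrow> 'a. x i = x j}" using lifts_lift by (auto simp only: st_pts_iff)
  qed (auto simp: st_pts_def)
  finally have "alg {i, j} {q. sat (R_ind M) q (Eq t u)}" by (simp add: ij)
  then show ?case by (intro exI[of _ "{i, j}"]) simp
next
  case (Rel r ts)
  have "\<forall>t\<in>set ts. \<exists>i. t = Var i" using Rel R_ind_trm by (auto simp: list_all_iff)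
  then obtain v where "\<And>t. t \<in> set ts \<Longrightarrow> t = Var (v t)" by metis
  then have ts: "ts = map Var (map v ts)" by (simp add: map_idI)
  obtain m X where X: "definable M m X" and r: "r = (m, st_set X)" and len: "length ts = m"
    using Rel by (auto simp: R_ind_def)
  have val: "map (trm_val (R_ind M) q) ts = map q (map v ts)" for q
    by (subst ts) simp
  have int: "rel_int (R_ind M) r xs \<longleftrightarrow> xs \<in> st_set X" for xs
    by (simp add: R_ind_def r)
  have "{q. sat (R_ind M) q (Rel r ts)} = {q. map q (map v ts) \<in> st_set X}"
    by (simp only: sat.simps val int)
  then show ?case using alg_rel[OF X, of "map v ts"] len
    by (intro exI[of _ "set (map v ts)"]) simp
next
  case (Neg p)
  then obtain V where "finite V" "alg V {q. sat (R_ind M) q p}" by auto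
  then have "alg V (- {q. sat (R_ind M) q p})" by (rule alg_Compl)
  with \<open>finite V\<close> show ?case by (intro exI[of _ V]) (simp add: Collect_neg_eq)
next
  case (Conj p1 p2)
  then obtain V1 V2 where V: "finite V1" "alg V1 {q. sat (R_ind M) q p1}"
    "finite V2" "alg V2 {q. sat (R_ind M) q p2}" by auto
  then have "alg (V1 \<union> V2) ({q. sat (R_ind M) q p1} \<inter> {q. sat (R_ind M) q p2})"
    by (intro alg_Int) (auto intro: alg_coords[rotated])
  with V show ?case by (intro exI[of _ "V1 \<union> V2"]) (simp add: Collect_conj_eq)
next
  case (Ex i p)
  then obtain V where V: "finite V" "alg V {q. sat (R_ind M) q p}" by auto
  have "alg (insert i (V - {i})) {q. sat (R_ind M) q p}"
    by (rule alg_coords[OF _ V(2)]) auto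
  then have "alg (V - {i}) {q. \<exists>r. q(i := r) \<in> {q. sat (R_ind M) q p}}"
    by (rule alg_proj[rotated 2]) (use V in auto)
  with V show ?case by (intro exI[of _ "V - {i}"]) simp
qed

text \<open>The passage between lists and assignments; values of \<open>(!) xs\<close> beyond the
  length have no influence on membership in \<open>st_pts {..<n} X\<close>.\<close>

lemma st_set_coords:
  assumes "depends {..<n} X"
  shows "xs \<in> st_set {map x [0..<n] | x. x \<in> X} \<longleftrightarrow> length xs = n \<and> (!) xs \<in> st_pts {..<n} X"
proof
  assume "xs \<in> st_set {map x [0..<n] | x. x \<in> X}"
  then obtain x where "x \<in> X" "map x [0..<n] \<in> lists finite_elems" "xs = map st (map x [0..<n])"
    unfolding st_set_def by blast
  then show "length xs = n \<and> (!) xs \<in> st_pts {..<n} X"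
    by (auto simp: st_pts_def intro!: bexI[of _ x])
next
  assume "length xs = n \<and> (!) xs \<in> st_pts {..<n} X"
  then obtain x where x: "length xs = n" "x \<in> X" "\<And>i. i < n \<Longrightarrow> x i \<in> finite_elems \<and> st (x i) = xs ! i"
    by (auto simp: st_pts_def)
  show "xs \<in> st_set {map x [0..<n] | x. x \<in> X}" unfolding st_set_def
  proof (rule image_eqI)
    show "xs = map st (map x [0..<n])" using x by (intro nth_equalityI) auto
    show "map x [0..<n] \<in> {map x [0..<n] | x. x \<in> X} \<inter> lists finite_elems"
      using x by (intro IntI CollectI exI[of _ x]) auto
  qed
qed

lemma alg_lists:
  assumes "alg {..<n} A"
  shows "\<exists>F. finite F \<and> (\<forall>(X, Y) \<in> F. definable M n X \<and> definable M n Y) \<and>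
    {xs. length xs = n \<and> (!) xs \<in> A} = (\<Union>(X, Y) \<in> F. st_set X - st_set Y)"
  using assms
proof induction
  case alg_empty
  show ?case by (intro exI[of _ "{}"]) simp
next
  case (alg_insert W X Y)
  then obtain F where F: "finite F" "\<forall>(X, Y) \<in> F. definable M n X \<and> definable M n Y"
    "{xs. length xs = n \<and> (!) xs \<in> W} = (\<Union>(X, Y) \<in> F. st_set X - st_set Y)" by blast
  let ?L = "\<lambda>X. {map x [0..<n] | x. x \<in> X}"
  have "{xs. length xs = n \<and> (!) xs \<in> W \<union> (st_pts {..<n} X - st_pts {..<n} Y)} =
      {xs. length xs = n \<and> (!) xs \<in> W} \<union> (st_set (?L X) - st_set (?L Y))"
    using st_set_coords[of n X] st_set_coords[of n Y] alg_insert by blast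
  also have "\<dots> = (\<Union>(X, Y) \<in> insert (?L X, ?L Y) F. st_set X - st_set Y)"
    unfolding F(3) by simp blast
  finally show ?case using F(1,2) alg_insert dset_definable[of M _ n]
    by (intro exI[of _ "insert (?L X, ?L Y) F"]) simp
qed

lemma definable_R_ind_imp:
  assumes "definable (R_ind M) n S"
  shows "\<exists>F. finite F \<and> (\<forall>(X, Y) \<in> F. definable M n X \<and> definable M n Y) \<and>
    S = (\<Union>(X, Y) \<in> F. st_set X - st_set Y)"
proof -
  obtain p e where p: "form_of (R_ind M) p"
    and S: "S = {xs. length xs = n \<and> sat (R_ind M) (\<lambda>i. if i < n then xs ! i else e i) p}"
    using assms by (auto simp: definable_def)
  obtain V where V: "finite V" and A: "alg V {q. sat (R_ind M) q p}"
    using alg_sat[OF p] by blast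
  \<comment> \<open>These variables carry the parameters; they are fixed at the values of
    \<open>e\<close> to leave a set over the first \<open>n\<close> coordinates.\<close>
  define E where "E = V - {..<n}"
  have A': "alg ({..<n} \<union> E) {q. sat (R_ind M) q p}"
    by (rule alg_coords[OF _ A]) (auto simp: E_def)
  have A'': "alg {..<n} {q. (\<lambda>i. if i \<in> E then e i else q i) \<in> {q. sat (R_ind M) q p}}"
    by (rule alg_fix_coords) (use V A' in \<open>auto simp: E_def\<close>)
  have "S = {xs. length xs = n \<and>
      (!) xs \<in> {q. (\<lambda>i. if i \<in> E then e i else q i) \<in> {q. sat (R_ind M) q p}}}"
  proof -
    have "(\<lambda>i. if i < n then xs ! i else e i) \<in> {q. sat (R_ind M) q p} \<longleftrightarrow>
        (\<lambda>i. if i \<in> E then e i else xs ! i) \<in> {q. sat (R_ind M) q p}" for xs :: "real list"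
      by (rule dependsD[OF alg_depends[OF A']]) (auto simp: E_def)
    then show ?thesis by (simp add: S)
  qed
  then show ?thesis using alg_lists[OF A''] by (rule ssubst)
qed

lemma definable_R_ind_if:
  assumes "finite F" "\<forall>(X, Y) \<in> F. definable M n X \<and> definable M n Y"
  shows "definable (R_ind M) n (\<Union>(X, Y) \<in> F. st_set X - st_set Y)"
proof -
  have atom: "form_of (R_ind M) (Rel (n, st_set X) (map Var [0..<n]))"
    "sat (R_ind M) q (Rel (n, st_set X) (map Var [0..<n])) \<longleftrightarrow> map q [0..<n] \<in> st_set X"
    if "definable M n X" for X and q :: "nat \<Rightarrow> real"
    using that by (auto simp: R_ind_def list_all_iff comp_def)
  have "\<exists>p. form_of (R_ind M) p \<and>
      (\<forall>q. sat (R_ind M) q p \<longleftrightarrow> map q [0..<n] \<in> (\<Union>(X, Y) \<in> F. st_set X - st_set Y))"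
    using assms
  proof (induction F rule: finite_induct)
    case empty
    show ?case by (intro exI[of _ "Neg (Eq (Var 0) (Var 0))"]) simp
  next
    case (insert Z F)
    obtain X Y where Z: "Z = (X, Y)" by (rule prod.exhaust)
    have XY: "definable M n X" "definable M n Y" using insert Z by auto
    obtain p where p: "form_of (R_ind M) p"
      "\<And>q. sat (R_ind M) q p \<longleftrightarrow> map q [0..<n] \<in> (\<Union>(X, Y) \<in> F. st_set X - st_set Y)"
      using insert by auto
    let ?a = "\<lambda>X. Rel (n, st_set X) (map Var [0..<n])"
    let ?p = "Neg (Conj (Neg p) (Neg (Conj (?a X) (Neg (?a Y)))))"
    have "form_of (R_ind M) ?p" using p(1) atom(1) XY by simp
    moreover have "sat (R_ind M) q ?p \<longleftrightarrow>
        map q [0..<n] \<in> (\<Union>(X, Y) \<in> insert Z F. st_set X - st_set Y)" for q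
      unfolding sat.simps(3,4) atom(2)[OF XY(1)] atom(2)[OF XY(2)] p(2) Z by auto
    ultimately show ?case by blast
  qed
  then obtain p where p: "form_of (R_ind M) p"
    "\<And>q. sat (R_ind M) q p \<longleftrightarrow> map q [0..<n] \<in> (\<Union>(X, Y) \<in> F. st_set X - st_set Y)" by blast
  \<comment> \<open>The formula sees only the first \<open>n\<close> values of an assignment, so
    lists of other lengths have to be excluded from the union separately.\<close>
  have len: "length xs = n" if XY: "(X, Y) \<in> F" and xs: "xs \<in> st_set X" for X Y xs
  proof -
    obtain ys where ys: "ys \<in> X" "xs = map st ys" using xs unfolding st_set_def by blast
    have "definable M n X" using assms(2) XY by blast
    then have "length ys = n" using ys(1) unfolding definable_def by blast
    then show ?thesis by (simp add: ys(2))
  qed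
  have map_eq: "map (\<lambda>i. if i < n then xs ! i else undefined) [0..<n] = xs"
    if "length xs = n" for xs :: "real list"
    using that by (intro nth_equalityI) auto
  have "xs \<in> (\<Union>(X, Y) \<in> F. st_set X - st_set Y) \<longleftrightarrow>
      length xs = n \<and> sat (R_ind M) (\<lambda>i. if i < n then xs ! i else undefined) p" for xs
  proof (cases "length xs = n")
    case True
    then show ?thesis unfolding p(2) map_eq[OF True] by blast
  next
    case False
    then show ?thesis using len by blast
  qed
  then have "(\<Union>(X, Y) \<in> F. st_set X - st_set Y) =
      {xs. length xs = n \<and> sat (R_ind M) (\<lambda>i. if i < n then xs ! i else undefined) p}"
    by blast
  with p(1) show ?thesis unfolding definable_def by (intro exI[of _ p] exI[of _ "\<lambda>_. undefined"]) simp
qed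

end

theorem theorem1p1:
  fixes M :: "('f, 'r, 'a :: linordered_field) struct"
  assumes "expands_ordered_field M"
    and "o_minimal M"
    and "saturated (cardSuc |UNIV :: nat set set| ) M"
  shows "\<forall>n S. definable (R_ind M) n S \<longleftrightarrow>
    (\<exists>F. finite F \<and> (\<forall>(X, Y) \<in> F. definable M n X \<and> definable M n Y) \<and>
         S = (\<Union>(X, Y) \<in> F. st_set X - st_set Y))"
proof -
  interpret saturated_o_minimal M
    by (rule saturated_o_minimal.intro) (rule assms)+
  show ?thesis
    using definable_R_ind_imp definable_R_ind_if by blast
qed

end
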